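(* Suppose $\sigma\in L^{\infty}(\mathbb{D},\frac{1}{\pi}dz)$ is real-valued and has a radial limit $\tilde\sigma$. Then for every continuous $\psi:[\inf\sigma,\sup\sigma]\to\mathbb{C}$, $$\lim_{N\to\infty}\frac{1}{N+1}\operatorname{tr}\bigl(\psi(P_{N}T_{\sigma}P_{N})\bigr)=\int_{0}^{2\pi}\psi\bigl(\tilde{\sigma}(\theta)\bigr)\frac{d\theta}{2\pi},$$ where $T_\sigma$ is the Toeplitz operator on the Bergman space $A^2(\mathbb{D})$.
   Context: $\mathbb{D}$ is the open unit disc in $\mathbb{C}$ and $dz$ is area measure. The Bergman space $A^2(\mathbb{D})$ is the closed subspace of $L^2(\mathbb{D},\frac1\pi dz)$ consisting of holomorphic functions; it has orthonormal basis $\sqrt{n+1}\,z^n$, $n\ge0$. Let $P:L^2(\mathbb{D},\frac1\pi dz)\to A^2(\mathbb{D})$ be the orthogonal projection; the Toeplitz operator with symbol $\sigma\in L^\infty(\mathbb{D})$ is $T_\sigma f=P(\sigma f)$ on $A^2(\mathbb{D})$. Let $\mathcal{K}_N=\operatorname{span}\{z^n:n=0,1,\dots,N\}$ and let $P_N$ be the orthogonal projection onto $\mathcal{K}_N$. The operator $P_NT_\sigma P_N$ is regarded as an operator on the $(N+1)$-dimensional space $\mathcal{K}_N$; it is self-adjoint for real $\sigma$, and $\psi(P_NT_\sigma P_N)$ (functional calculus) and its trace are taken on $\mathcal{K}_N$. Symbols $\sigma$ are understood as bounded measurable functions, so that pointwise limits, $\inf\sigma$ and $\sup\sigma$ make sense.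 A real-valued $\sigma\in L^\infty(\mathbb{D})$ has a radial limit if $\tilde\sigma(\theta):=\lim_{r\to 1^-}\sigma(re^{i\theta})$ exists for almost every $\theta\in[0,2\pi)$. *)

theory Defs
  imports "HOL-Complex_Analysis.Complex_Analysis"
begin

definition disc_measure :: "complex measure" where
  "disc_measure = density (lebesgue_on (ball 0 1)) (\<lambda>_. ennreal (1 / pi))"

definition L2_disc :: "(complex \<Rightarrow> complex) set" where
  "L2_disc = {f. f \<in> borel_measurable disc_measure \<and>
                 integrable disc_measure (\<lambda>z. (cmod (f z))\<^sup>2)}"

definition L2_inner :: "(complex \<Rightarrow> complex) \<Rightarrow> (complex \<Rightarrow> complex) \<Rightarrow> complex" where
  "L2_inner f g = (LINT z|disc_measure. f z * cnj (g z))"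

text \<open>Functions on the disc are total functions on the complex plane; elements of the Bergman space
  are required to vanish off the disc, so that each has exactly one representative and equality
  of functions is equality in the Bergman space.\<close>

definition bergman_space :: "(complex \<Rightarrow> complex) set" where
  "bergman_space =
     {f \<in> L2_disc. f holomorphic_on ball 0 1 \<and> (\<forall>z. z \<notin> ball 0 1 \<longrightarrow> f z = 0)}"

text \<open>The element \<open>h\<close> of \<open>V\<close> with \<open>f - h\<close> orthogonal to \<open>V\<close>. It is used for \<open>f\<close> square integrable and
  \<open>V\<close> a closed subspace of the Bergman space, where it exists and is unique.\<close>

definition orth_proj ::
    "(complex \<Rightarrow> complex) set \<Rightarrow> (complex \<Rightarrow> complex) \<Rightarrow> (complex \<Rightarrow> complex)" where
  "orth_proj V f = (THE h. h \<in> V \<and> (\<forall>g\<in>V. L2_inner (\<lambda>z. f z - h z) g = 0))"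

definition toeplitz ::
    "(complex \<Rightarrow> complex) \<Rightarrow> (complex \<Rightarrow> complex) \<Rightarrow> (complex \<Rightarrow> complex)" where
  "toeplitz \<sigma> f = orth_proj bergman_space (\<lambda>z. \<sigma> z * f z)"

definition disc_monomial :: "nat \<Rightarrow> complex \<Rightarrow> complex" where
  "disc_monomial n z = (if z \<in> ball 0 1 then z ^ n else 0)"

definition poly_space :: "nat \<Rightarrow> (complex \<Rightarrow> complex) set" where
  "poly_space N = {f. \<exists>c::nat \<Rightarrow> complex. f = (\<lambda>z. \<Sum>n\<le>N. c n * disc_monomial n z)}"

definition compressed_toeplitz ::
    "nat \<Rightarrow> (complex \<Rightarrow> complex) \<Rightarrow> (complex \<Rightarrow> complex) \<Rightarrow> (complex \<Rightarrow> complex)" where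
  "compressed_toeplitz N \<sigma> f =
     orth_proj (poly_space N) (toeplitz \<sigma> (orth_proj (poly_space N) f))"

definition eigenspace_on ::
    "(complex \<Rightarrow> complex) set \<Rightarrow> ((complex \<Rightarrow> complex) \<Rightarrow> (complex \<Rightarrow> complex)) \<Rightarrow> real
      \<Rightarrow> (complex \<Rightarrow> complex) set" where
  "eigenspace_on V A l = {f \<in> V. A f = (\<lambda>z. of_real l * f z)}"

definition eigenvalues_on ::
    "(complex \<Rightarrow> complex) set \<Rightarrow> ((complex \<Rightarrow> complex) \<Rightarrow> (complex \<Rightarrow> complex)) \<Rightarrow> real set" where
  "eigenvalues_on V A = {l. \<exists>f \<in> eigenspace_on V A l. f \<noteq> (\<lambda>_. 0)}"

text \<open>Functional calculus of a self-adjoint operator \<open>A\<close> on a finite-dimensional space \<open>V\<close>, through its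
  spectral resolution \<open>\<psi>(A) = \<Sum>\<^sub>l \<psi>(l) E\<^sub>l\<close>, with \<open>E\<^sub>l\<close> the orthogonal projection onto
  the eigenspace of \<open>l\<close>. As \<open>A\<close> is self-adjoint, only real eigenvalues occur.\<close>

definition functional_calculus_on ::
    "(complex \<Rightarrow> complex) set \<Rightarrow> (real \<Rightarrow> complex)
      \<Rightarrow> ((complex \<Rightarrow> complex) \<Rightarrow> (complex \<Rightarrow> complex))
      \<Rightarrow> (complex \<Rightarrow> complex) \<Rightarrow> (complex \<Rightarrow> complex)" where
  "functional_calculus_on V \<psi> A f =
     (\<lambda>z. \<Sum>l \<in> eigenvalues_on V A. \<psi> l * orth_proj (eigenspace_on V A l) f z)"

definition bergman_basis :: "nat \<Rightarrow> complex \<Rightarrow> complex" where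
  "bergman_basis n z = of_real (sqrt (real n + 1)) * disc_monomial n z"

text \<open>Trace of an operator on \<open>poly_space N\<close>, which has the orthonormal basis
  \<open>bergman_basis 0, \<dots>, bergman_basis N\<close>.\<close>

definition trace_poly_space ::
    "nat \<Rightarrow> ((complex \<Rightarrow> complex) \<Rightarrow> (complex \<Rightarrow> complex)) \<Rightarrow> complex" where
  "trace_poly_space N A = (\<Sum>n\<le>N. L2_inner (A (bergman_basis n)) (bergman_basis n))"

definition has_radial_limit :: "(complex \<Rightarrow> real) \<Rightarrow> bool" where
  "has_radial_limit \<sigma> \<longleftrightarrow>
     (AE \<theta> in lebesgue_on {0..<2 * pi}.
        \<exists>L. ((\<lambda>r. \<sigma> (of_real r * cis \<theta>)) \<longlongrightarrow> L) (at_left 1))"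

definition radial_limit :: "(complex \<Rightarrow> real) \<Rightarrow> real \<Rightarrow> real" where
  "radial_limit \<sigma> \<theta> = Lim (at_left 1) (\<lambda>r. \<sigma> (of_real r * cis \<theta>))"

end

theory Submission
  imports Defs "HOL-Probability.Probability"
    "HOL-Computational_Algebra.Fundamental_Theorem_Algebra"
begin

text \<open>
  Let \<open>f\<^sub>0, \<dots>, f\<^sub>N\<close> be an orthonormal eigenbasis of the compressed Toeplitz operator with eigenvalues
  \<open>\<lambda>\<^sub>0, \<dots>, \<lambda>\<^sub>N\<close>. Each \<open>\<bar>f\<^sub>p\<bar>\<^sup>2\<close> is a probability density on the disc, \<open>\<lambda>\<^sub>p\<close> is the mean of \<open>\<sigma>\<close> under
  it, and the trace is the sum of the \<open>\<psi>(\<lambda>\<^sub>p)\<close> (\<open>trace_functional_calculus\<close>). The idea is to replace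
  \<open>\<psi>(\<lambda>\<^sub>p)\<close>, \<open>\<psi>\<close> of a mean, by the mean of \<open>\<psi> \<circ> \<sigma>\<close>. After this replacement the sum no longer involves the
  eigenfunctions: the sum of the densities \<open>\<bar>f\<^sub>p\<bar>\<^sup>2\<close> is the diagonal \<open>K\<^sub>N(z,z)\<close> of the reproducing kernel
  of the polynomials of degree at most \<open>N\<close>, for which the monomial basis gives an explicit formula.
  Divided by \<open>N + 1\<close> it is a radial probability density that concentrates on the unit circle, so
  the mean of \<open>\<psi> \<circ> \<sigma>\<close> under it tends to the mean of \<open>\<psi>\<close> of the radial limit
  (\<open>boundary_concentration\<close>).

  The error of the replacement is controlled by variances. A continuous function on a compact set satisfies
  \<open>\<bar>\<psi> x - \<psi> y\<bar> \<le> \<epsilon> + K (x - y)\<^sup>2\<close>, so it suffices that the variances of \<open>\<sigma>\<close> under the \<open>\<bar>f\<^sub>p\<bar>\<^sup>2\<close>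
  have sum \<open>o(N)\<close>. Their sum is half the energy
  \<open>\<integral>\<integral> \<bar>\<sigma> z - \<sigma> w\<bar>\<^sup>2 \<bar>K\<^sub>N(z,w)\<bar>\<^sup>2\<close> (\<open>sum_variance_eq_energy\<close>), again free of the eigenfunctions.
  For the function \<open>z\<close> in place of \<open>\<sigma>\<close> the energy is at most \<open>2\<close> for every \<open>N\<close>, because multiplication by
  \<open>z\<close> shifts the monomials (\<open>kernel_energy_identity\<close>). Since \<open>(G z - G w)\<^sup>2 \<le> \<epsilon> + K \<bar>z - w\<bar>\<^sup>2\<close>, every
  \<open>G\<close> that is continuous on the closed disc has energy \<open>o(N)\<close>. Finally \<open>\<sigma>\<close> is compared with a continuous \<open>G\<close> whose values on the circle are
  close in the mean square to the radial limit of \<open>\<sigma>\<close>; the comparison costs a multiple of the integral of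
  \<open>(\<sigma> z - G z)\<^sup>2 K\<^sub>N(z,z)\<close>, which is a small multiple of \<open>N + 1\<close> by concentration at the boundary
  (\<open>energy_density_tendsto_0\<close>).

  The operators are tied to this picture by Taylor coefficients: up to normalisation they are the
  coefficients of a Bergman function in the monomial basis, which yields the Bergman projection (\<open>orth_proj_bergman\<close>) and reduces the
  compressed operator to a Hermitian matrix.
\<close>

section \<open>Polar coordinates on the unit disc\<close>

lemma lborel_complex_eq_distr:
  "lborel = distr (lborel \<Otimes>\<^sub>M lborel) borel (\<lambda>(y, x). Complex x y)"
proof (rule lborel_eqI)
  have [measurable]: "(\<lambda>(y, x). Complex x y) \<in> borel_measurable (borel \<Otimes>\<^sub>M borel)"
    unfolding Complex_eq by measurable
  fix l u :: complex
  assume le: "\<And>b. b \<in> Basis \<Longrightarrow> l \<bullet> b \<le> u \<bullet> b"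
  have le': "Re l \<le> Re u" "Im l \<le> Im u"
    using le[of 1] le[of \<i>] by (auto simp: Basis_complex_def)
  have eq: "(\<lambda>(y, x). Complex x y) -` box l u = {Im l<..<Im u} \<times> {Re l<..<Re u}"
    by (auto simp: box_def Basis_complex_def)
  show "emeasure (distr (lborel \<Otimes>\<^sub>M lborel) borel (\<lambda>(y, x). Complex x y)) (box l u)
        = ennreal (\<Prod>b\<in>Basis. (u - l) \<bullet> b)"
    using le' by (simp add: emeasure_distr eq space_pair_measure lborel.emeasure_pair_measure_Times
        Basis_complex_def ennreal_mult[symmetric] mult.commute)
qed simp

lemma nn_integral_lborel_complex:
  fixes f :: "complex \<Rightarrow> ennreal"
  assumes [measurable]: "f \<in> borel_measurable borel"
  shows "(\<integral>\<^sup>+z. f z \<partial>lborel) = (\<integral>\<^sup>+y. \<integral>\<^sup>+x. f (Complex x y) \<partial>lborel \<partial>lborel)"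
    and "(\<integral>\<^sup>+z. f z \<partial>lborel) = (\<integral>\<^sup>+x. \<integral>\<^sup>+y. f (Complex x y) \<partial>lborel \<partial>lborel)"
proof -
  have m[measurable]: "(\<lambda>(y, x). Complex x y) \<in> borel_measurable (borel \<Otimes>\<^sub>M borel)"
    unfolding Complex_eq by measurable
  have "(\<integral>\<^sup>+z. f z \<partial>lborel) = (\<integral>\<^sup>+p. f (case p of (y, x) \<Rightarrow> Complex x y) \<partial>(lborel \<Otimes>\<^sub>M lborel))"
    by (subst lborel_complex_eq_distr) (simp add: nn_integral_distr)
  then have *: "(\<integral>\<^sup>+z. f z \<partial>lborel)
      = (\<integral>\<^sup>+p. (\<lambda>(y,x). f (Complex x y)) p \<partial>(lborel \<Otimes>\<^sub>M lborel))"
    by (simp add: split_def)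
  have [measurable]: "(\<lambda>(y,x). f (Complex x y)) \<in> borel_measurable (lborel \<Otimes>\<^sub>M lborel)"
    using measurable_compose[OF m assms] by (simp add: split_def)
  show "(\<integral>\<^sup>+z. f z \<partial>lborel) = (\<integral>\<^sup>+y. \<integral>\<^sup>+x. f (Complex x y) \<partial>lborel \<partial>lborel)"
    unfolding * by (subst lborel.nn_integral_fst[symmetric]) auto
  show "(\<integral>\<^sup>+z. f z \<partial>lborel) = (\<integral>\<^sup>+x. \<integral>\<^sup>+y. f (Complex x y) \<partial>lborel \<partial>lborel)"
    unfolding * by (subst lborel_pair.nn_integral_snd[symmetric]) auto
qed

text \<open>A shear translates every horizontal (or vertical) line into itself, so Fubini reduces its
  invariance to the translation invariance of Lebesgue measure on the line.\<close>
lemma nn_integral_complex_shear: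
  fixes f :: "complex \<Rightarrow> ennreal"
  assumes [measurable]: "f \<in> borel_measurable borel"
  shows "(\<integral>\<^sup>+z. f (z + of_real (a * Im z)) \<partial>lborel) = (\<integral>\<^sup>+z. f z \<partial>lborel)"
    and "(\<integral>\<^sup>+z. f (z + \<i> * of_real (a * Re z)) \<partial>lborel) = (\<integral>\<^sup>+z. f z \<partial>lborel)"
proof -
  have [measurable]: "(\<lambda>x. f (Complex x y)) \<in> borel_measurable borel"
       "(\<lambda>x. f (Complex y x)) \<in> borel_measurable borel" for y
    unfolding Complex_eq by measurable
  have [measurable]: "(\<lambda>z. f (z + of_real (a * Im z))) \<in> borel_measurable borel"
    "(\<lambda>z. f (z + \<i> * of_real (a * Re z))) \<in> borel_measurable borel"
    by (auto intro!: measurable_compose[OF _ assms] borel_measurable_continuous_onI continuous_intros)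
  have "Complex x y + of_real c = Complex (c + x) y" "Complex x y + \<i> * of_real c = Complex x (c + y)"
    for x y c by (simp_all add: complex_eq_iff)
  then have 1: "(\<integral>\<^sup>+x. f (Complex x y + of_real (a * y)) \<partial>lborel) = (\<integral>\<^sup>+x. f (Complex x y) \<partial>lborel)"
    and 2: "(\<integral>\<^sup>+x. f (Complex y x + \<i> * of_real (a * y)) \<partial>lborel) = (\<integral>\<^sup>+x. f (Complex y x) \<partial>lborel)" for y
    using nn_integral_real_affine[of "\<lambda>x. f (Complex x y)" 1 "a * y"]
          nn_integral_real_affine[of "\<lambda>x. f (Complex y x)" 1 "a * y"]
    by (simp_all del: of_real_mult)
  show "(\<integral>\<^sup>+z. f (z + of_real (a * Im z)) \<partial>lborel) = (\<integral>\<^sup>+z. f z \<partial>lborel)"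
    by (simp add: nn_integral_lborel_complex(1) 1 del: of_real_mult)
  show "(\<integral>\<^sup>+z. f (z + \<i> * of_real (a * Re z)) \<partial>lborel) = (\<integral>\<^sup>+z. f z \<partial>lborel)"
    by (simp add: nn_integral_lborel_complex(2) 2 del: of_real_mult)
qed

text \<open>A rotation that is not a half turn is a product of three shears,
  \<open>cis \<alpha> = S R S\<close> with \<open>S\<close> the horizontal shear by \<open>- tan (\<alpha> / 2)\<close> and \<open>R\<close> the vertical shear by
  \<open>sin \<alpha>\<close>. Half turns form a null set of angles, which is harmless because the invariance is only
  used under an average over \<open>\<alpha>\<close>.\<close>
lemma nn_integral_complex_rotate:
  fixes f :: "complex \<Rightarrow> ennreal"
  assumes [measurable]: "f \<in> borel_measurable borel" and c: "cos (\<alpha> / 2) \<noteq> 0"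
  shows "(\<integral>\<^sup>+z. f (cis \<alpha> * z) \<partial>lborel) = (\<integral>\<^sup>+z. f z \<partial>lborel)"
proof -
  define t where "t = - tan (\<alpha> / 2)"
  define S where "S = (\<lambda>z. z + of_real (t * Im z) :: complex)"
  define R where "R = (\<lambda>z. z + \<i> * of_real (sin \<alpha> * Re z) :: complex)"
  have [measurable]: "S \<in> borel_measurable borel" "R \<in> borel_measurable borel"
    unfolding S_def R_def by (auto intro!: borel_measurable_continuous_onI continuous_intros)
  have sc: "sin \<alpha> = 2 * sin (\<alpha>/2) * cos (\<alpha>/2)" "cos \<alpha> = 1 - 2 * (sin (\<alpha>/2))\<^sup>2"
    using sin_double[of "\<alpha>/2"] cos_double_sin[of "\<alpha>/2"] by simp_all
  have ts: "t * sin \<alpha> = cos \<alpha> - 1"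
    using c by (simp add: t_def sc tan_def power2_eq_square)
  have tt: "t + t * cos \<alpha> = - sin \<alpha>"
  proof -
    have "1 + cos \<alpha> = 2 * (cos (\<alpha>/2))\<^sup>2"
      using cos_double_cos[of "\<alpha>/2"] by simp
    then have "t * (1 + cos \<alpha>) = - sin \<alpha>"
      using c by (simp add: t_def sc(1) tan_def power2_eq_square)
    then show ?thesis by (simp add: algebra_simps)
  qed
  have "cis \<alpha> * z = S (R (S z))" for z
  proof (rule complex_eqI)
    have "Re (S (R (S z))) = Re z * (1 + t * sin \<alpha>) + Im z * (t + t * (1 + t * sin \<alpha>))"
      by (simp add: S_def R_def algebra_simps)
    also have "\<dots> = Re (cis \<alpha> * z)"
      using tt by (simp add: ts algebra_simps)
    finally show "Re (cis \<alpha> * z) = Re (S (R (S z)))" by simp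
    have "Im (S (R (S z))) = Im z * (1 + t * sin \<alpha>) + sin \<alpha> * Re z"
      by (simp add: S_def R_def algebra_simps)
    then show "Im (cis \<alpha> * z) = Im (S (R (S z)))"
      by (simp add: ts algebra_simps)
  qed
  then have "(\<integral>\<^sup>+z. f (cis \<alpha> * z) \<partial>lborel) = (\<integral>\<^sup>+z. (f \<circ> S \<circ> R) (S z) \<partial>lborel)"
    by simp
  also have "\<dots> = (\<integral>\<^sup>+z. (f \<circ> S \<circ> R) z \<partial>lborel)"
    unfolding S_def by (rule nn_integral_complex_shear(1)) (auto simp: R_def)
  also have "\<dots> = (\<integral>\<^sup>+z. (f \<circ> S) z \<partial>lborel)"
    using nn_integral_complex_shear(2)[of "f \<circ> S" "sin \<alpha>"] by (simp add: R_def)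
  also have "\<dots> = (\<integral>\<^sup>+z. f z \<partial>lborel)"
    using nn_integral_complex_shear(1)[of f t] by (simp add: S_def)
  finally show ?thesis .
qed

definition angle_measure :: "real measure" where
  "angle_measure = uniform_measure lborel {0..<2 * pi}"

definition unit_interval_measure :: "real measure" where
  "unit_interval_measure = uniform_measure lborel {0..<1}"

interpretation angle: prob_space angle_measure
  unfolding angle_measure_def by (rule prob_space_uniform_measure) auto

interpretation unit_interval: prob_space unit_interval_measure
  unfolding unit_interval_measure_def by (rule prob_space_uniform_measure) auto

interpretation polar: pair_prob_space angle_measure unit_interval_measure ..

abbreviation polar_measure :: "(real \<times> real) measure" where
  "polar_measure \<equiv> angle_measure \<Otimes>\<^sub>M unit_interval_measure"

abbreviation circle_measure :: "real measure" where
  "circle_measure \<equiv> lebesgue_on {0..<2 * pi}"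

lemma sets_angle [measurable_cong, simp]: "sets angle_measure = sets borel"
  by (simp add: angle_measure_def)

lemma sets_unit_interval [measurable_cong, simp]: "sets unit_interval_measure = sets borel"
  by (simp add: unit_interval_measure_def)

lemma space_angle [simp]: "space angle_measure = UNIV"
  by (simp add: angle_measure_def)

lemma space_unit_interval [simp]: "space unit_interval_measure = UNIV"
  by (simp add: unit_interval_measure_def)

lemma nn_integral_angle:
  assumes [measurable]: "f \<in> borel_measurable borel"
  shows "(\<integral>\<^sup>+\<theta>. f \<theta> \<partial>angle_measure)
    = (\<integral>\<^sup>+\<theta>. f \<theta> * indicator {0..<2*pi} \<theta> \<partial>lborel) / ennreal (2 * pi)"
  unfolding angle_measure_def by (subst nn_integral_uniform_measure) simp_all

text \<open>Periodicity: the shifted period is cut at \<open>2\<pi>\<close> and its second piece is moved back by one period.\<close>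
lemma nn_integral_angle_shift:
  fixes f :: "complex \<Rightarrow> ennreal"
  assumes [measurable]: "f \<in> borel_measurable borel"
  shows "(\<integral>\<^sup>+\<theta>. f (cis \<theta> * cis \<beta>) \<partial>angle_measure) = (\<integral>\<^sup>+\<theta>. f (cis \<theta>) \<partial>angle_measure)"
proof -
  have [measurable]: "cis \<in> borel_measurable borel"
    by (intro borel_measurable_continuous_onI continuous_intros)
  have main: "(\<integral>\<^sup>+\<theta>. f (cis \<theta> * cis \<beta>) * indicator {0..<2*pi} \<theta> \<partial>lborel)
      = (\<integral>\<^sup>+\<theta>. f (cis \<theta>) * indicator {0..<2*pi} \<theta> \<partial>lborel)"
    if \<beta>: "0 \<le> \<beta>" "\<beta> < 2 * pi" for \<beta>
  proof -
    have "(\<integral>\<^sup>+\<theta>. f (cis \<theta> * cis \<beta>) * indicator {0..<2*pi} \<theta> \<partial>lborel)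
       = (\<integral>\<^sup>+\<theta>. f (cis \<theta>) * indicator {\<beta>..<2*pi + \<beta>} \<theta> \<partial>lborel)"
      by (subst nn_integral_real_affine[where c = 1 and t = \<beta>, of "\<lambda>\<theta>. f (cis \<theta>) * indicator {\<beta>..<2*pi + \<beta>} \<theta>"])
         (auto simp: cis_mult add.commute indicator_def intro!: nn_integral_cong)
    also have "\<dots> = (\<integral>\<^sup>+\<theta>. f (cis \<theta>) * indicator {\<beta>..<2*pi} \<theta>
         + f (cis \<theta>) * indicator {2*pi..<2*pi + \<beta>} \<theta> \<partial>lborel)"
      using \<beta> by (intro nn_integral_cong) (auto simp: indicator_def)
    also have "\<dots> = (\<integral>\<^sup>+\<theta>. f (cis \<theta>) * indicator {\<beta>..<2*pi} \<theta> \<partial>lborel)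
         + (\<integral>\<^sup>+\<theta>. f (cis \<theta>) * indicator {2*pi..<2*pi + \<beta>} \<theta> \<partial>lborel)"
      by (rule nn_integral_add) auto
    also have "(\<integral>\<^sup>+\<theta>. f (cis \<theta>) * indicator {2*pi..<2*pi + \<beta>} \<theta> \<partial>lborel)
         = (\<integral>\<^sup>+\<theta>. f (cis \<theta>) * indicator {0..<\<beta>} \<theta> \<partial>lborel)"
      by (subst nn_integral_real_affine[where c = 1 and t = "2*pi", of "\<lambda>\<theta>. f (cis \<theta>) * indicator {2*pi..<2*pi + \<beta>} \<theta>"])
         (auto simp: cis_mult[symmetric] indicator_def intro!: nn_integral_cong)
    also have "(\<integral>\<^sup>+\<theta>. f (cis \<theta>) * indicator {\<beta>..<2*pi} \<theta> \<partial>lborel)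
         + (\<integral>\<^sup>+\<theta>. f (cis \<theta>) * indicator {0..<\<beta>} \<theta> \<partial>lborel)
       = (\<integral>\<^sup>+\<theta>. f (cis \<theta>) * indicator {\<beta>..<2*pi} \<theta> + f (cis \<theta>) * indicator {0..<\<beta>} \<theta> \<partial>lborel)"
      by (rule nn_integral_add[symmetric]) auto
    also have "\<dots> = (\<integral>\<^sup>+\<theta>. f (cis \<theta>) * indicator {0..<2*pi} \<theta> \<partial>lborel)"
      using \<beta> by (intro nn_integral_cong) (auto simp: indicator_def)
    finally show ?thesis .
  qed
  have "cis \<beta> = cis (Arg2pi (cis \<beta>))"
    using Arg2pi_eq[of "cis \<beta>"] by (simp add: cis_conv_exp)
  moreover have "0 \<le> Arg2pi (cis \<beta>)" "Arg2pi (cis \<beta>) < 2 * pi"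
    using Arg2pi by auto
  ultimately show ?thesis
    using main[of "Arg2pi (cis \<beta>)"] by (simp add: nn_integral_angle)
qed

lemma emeasure_unit_disc: "emeasure lborel (ball (0::complex) 1) = ennreal pi"
  by (simp add: emeasure_ball unit_ball_vol_2)

lemma emeasure_disc_radius:
  assumes "0 \<le> r" shows "emeasure lborel (cball (0::complex) r) = ennreal (pi * r\<^sup>2)"
  using assms by (simp add: emeasure_cball unit_ball_vol_2)

definition polar_map :: "real \<times> real \<Rightarrow> complex" where
  "polar_map p = of_real (sqrt (snd p)) * cis (fst p)"

definition disc_borel :: "complex measure" where
  "disc_borel = uniform_measure lborel (ball 0 1)"

lemma sets_disc_borel [measurable_cong, simp]: "sets disc_borel = sets borel"
  by (simp add: disc_borel_def)

lemma space_disc_borel [simp]: "space disc_borel = UNIV"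
  by (simp add: disc_borel_def)

lemma prob_space_disc_borel: "prob_space disc_borel"
  unfolding disc_borel_def by (rule prob_space_uniform_measure) (auto simp: emeasure_unit_disc)

lemma measurable_polar_map [measurable]: "polar_map \<in> borel_measurable (borel \<Otimes>\<^sub>M borel)"
  unfolding polar_map_def borel_prod
  by (intro borel_measurable_continuous_onI continuous_intros)

text \<open>The squared modulus of a uniformly distributed point of the disc is uniformly distributed on the unit
  interval, since the disc of radius \<open>r\<close> carries the fraction \<open>r\<^sup>2\<close> of the area. This is why the radial
  coordinate below is \<open>t = \<bar>z\<bar>\<^sup>2\<close> and no Jacobian appears.\<close>
lemma distr_cmod_disc: "distr disc_borel borel cmod = distr unit_interval_measure borel sqrt"
proof (rule cdf_unique)
  interpret D: prob_space disc_borel by (rule prob_space_disc_borel)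
  show "real_distribution (distr disc_borel borel cmod)"
    by (rule real_distribution.intro, rule D.prob_space_distr, simp)
       (unfold_locales, simp_all)
  show "real_distribution (distr unit_interval_measure borel sqrt)"
    by (rule real_distribution.intro, rule unit_interval.prob_space_distr, simp)
       (unfold_locales, simp_all)
  show "cdf (distr disc_borel borel cmod) = cdf (distr unit_interval_measure borel sqrt)"
  proof
    fix r
    have 1: "cdf (distr disc_borel borel cmod) r = measure disc_borel {z. cmod z \<le> r}"
      by (simp add: cdf_def measure_distr vimage_def)
    have 2: "cdf (distr unit_interval_measure borel sqrt) r
        = measure unit_interval_measure {t. sqrt t \<le> r}"
      by (simp add: cdf_def measure_distr vimage_def)
    have m[measurable]: "{z::complex. cmod z \<le> r} \<in> sets borel" "{t. sqrt t \<le> r} \<in> sets borel" by measurable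
    consider "r < 0" | "0 \<le> r" "r < 1" | "1 \<le> r" by linarith
    then have "emeasure disc_borel {z. cmod z \<le> r} = emeasure unit_interval_measure {t. sqrt t \<le> r}"
    proof cases
      case 1
      then have "{z::complex. cmod z \<le> r} = {}"
        by (auto simp: not_le intro: less_le_trans[OF _ norm_ge_zero])
      moreover have "{0..<1} \<inter> {t. sqrt t \<le> r} = {}"
        using 1 by (auto simp: not_le) (smt (verit) real_sqrt_ge_zero)
      ultimately show ?thesis
        by (simp add: unit_interval_measure_def emeasure_uniform_measure[OF _ m(2)])
    next
      case 2
      have "ball 0 1 \<inter> {z::complex. cmod z \<le> r} = cball 0 r" using 2 by auto
      moreover have "{0..<1} \<inter> {t. sqrt t \<le> r} = {0..r\<^sup>2}"
        using 2 by (auto intro: real_le_lsqrt sqrt_le_D simp: power_less_one_iff le_less_trans[of _ "r\<^sup>2" 1])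
      moreover have "x / 1 = x" for x :: ennreal
        by (simp add: divide_ennreal_def)
      ultimately show ?thesis using 2
        by (simp add: unit_interval_measure_def disc_borel_def emeasure_disc_radius emeasure_unit_disc
          emeasure_uniform_measure[OF _ m(2)] emeasure_uniform_measure[OF _ m(1)] divide_ennreal)
    next
      case 3
      have "ball 0 1 \<inter> {z::complex. cmod z \<le> r} = ball 0 1" using 3 by auto
      moreover have "{0..<1} \<inter> {t. sqrt t \<le> r} = {0..<1}"
        using 3 by (auto intro!: order_trans[OF _ 3] simp: real_le_lsqrt)
      ultimately show ?thesis
        by (simp add: unit_interval_measure_def disc_borel_def emeasure_unit_disc
          emeasure_uniform_measure[OF _ m(2)] emeasure_uniform_measure[OF _ m(1)] divide_ennreal)
    qed
    then show "cdf (distr disc_borel borel cmod) r = cdf (distr unit_interval_measure borel sqrt) r"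
      unfolding 1 2 by (simp add: measure_def)
  qed
qed

lemma nn_integral_disc_rotate:
  fixes f :: "complex \<Rightarrow> ennreal"
  assumes [measurable]: "f \<in> borel_measurable borel" and c: "cos (\<alpha> / 2) \<noteq> 0"
  shows "(\<integral>\<^sup>+z. f (cis \<alpha> * z) \<partial>disc_borel) = (\<integral>\<^sup>+z. f z \<partial>disc_borel)"
proof -
  have [measurable]: "(\<lambda>z. f (cis \<alpha> * z)) \<in> borel_measurable borel"
    by (auto intro!: measurable_compose[OF _ assms(1)] borel_measurable_continuous_onI continuous_intros)
  have "(\<integral>\<^sup>+z. f (cis \<alpha> * z) * indicator (ball 0 1) z \<partial>lborel)
      = (\<integral>\<^sup>+z. f (cis \<alpha> * z) * indicator (ball 0 1) (cis \<alpha> * z) \<partial>lborel)"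
    by (simp add: indicator_def norm_mult)
  also have "\<dots> = (\<integral>\<^sup>+z. f z * indicator (ball 0 1) z \<partial>lborel)"
    using c by (rule nn_integral_complex_rotate[of "\<lambda>z. f z * indicator (ball 0 1) z", rotated])
      (intro borel_measurable_times_ennreal assms borel_measurable_indicator; simp)
  finally show ?thesis
    by (simp add: disc_borel_def nn_integral_uniform_measure)
qed

text \<open>By rotation invariance the integral of \<open>f\<close> is also the integral of the average of \<open>f\<close> over the
  rotations. That average depends on the modulus only, whose distribution is known.\<close>
lemma nn_integral_disc_polar:
  fixes f :: "complex \<Rightarrow> ennreal"
  assumes f[measurable]: "f \<in> borel_measurable borel"
  shows "(\<integral>\<^sup>+z. f z \<partial>disc_borel)
    = (\<integral>\<^sup>+p. f (polar_map p) \<partial>polar_measure)"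
proof -
  interpret D: prob_space disc_borel by (rule prob_space_disc_borel)
  interpret AD: pair_sigma_finite angle_measure disc_borel ..
  have m1[measurable]: "(\<lambda>(\<alpha>, z). f (cis \<alpha> * z)) \<in> borel_measurable (borel \<Otimes>\<^sub>M borel)"
    unfolding borel_prod split_def
    by (rule measurable_compose[OF _ f]) (intro borel_measurable_continuous_onI continuous_intros)
  have m2[measurable]: "(\<lambda>(\<alpha>, r). f (of_real r * cis \<alpha>)) \<in> borel_measurable (borel \<Otimes>\<^sub>M borel)"
    unfolding borel_prod split_def
    by (rule measurable_compose[OF _ f]) (intro borel_measurable_continuous_onI continuous_intros)
  have m3[measurable]: "(\<lambda>(\<alpha>, r). f (of_real (sqrt r) * cis \<alpha>)) \<in> borel_measurable (borel \<Otimes>\<^sub>M borel)"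
    unfolding borel_prod split_def
    by (rule measurable_compose[OF _ f]) (intro borel_measurable_continuous_onI continuous_intros)
  define M where "M r = (\<integral>\<^sup>+\<alpha>. f (of_real r * cis \<alpha>) \<partial>angle_measure)" for r
  have [measurable]: "M \<in> borel_measurable borel"
    unfolding M_def using m2
    by (intro angle.borel_measurable_nn_integral) (simp add: split_def measurable_split_conv, measurable)
  \<comment> \<open>Only the half turn \<open>\<alpha> = \<pi>\<close> is excluded.\<close>
  have ae: "AE \<alpha> in angle_measure. cos (\<alpha> / 2) \<noteq> 0"
  proof -
    have "\<alpha> = pi" if "0 \<le> \<alpha>" "\<alpha> < 2 * pi" "cos (\<alpha> / 2) = 0" for \<alpha>
      using cos_is_zero that cos_inj_pi[of "\<alpha>/2" "pi/2"] by auto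
    then show ?thesis
      unfolding angle_measure_def
      by (intro AE_uniform_measureI eventually_mono[OF AE_lborel_singleton[of pi]]) auto
  qed
  have "(\<integral>\<^sup>+z. f z \<partial>disc_borel) = (\<integral>\<^sup>+\<alpha>. \<integral>\<^sup>+z. f z \<partial>disc_borel \<partial>angle_measure)"
    by (simp add: angle.emeasure_space_1[simplified])
  also have "\<dots> = (\<integral>\<^sup>+\<alpha>. \<integral>\<^sup>+z. f (cis \<alpha> * z) \<partial>disc_borel \<partial>angle_measure)"
    using ae by (intro nn_integral_cong_AE) (auto simp: nn_integral_disc_rotate elim!: eventually_mono)
  also have "\<dots> = (\<integral>\<^sup>+z. \<integral>\<^sup>+\<alpha>. f (cis \<alpha> * z) \<partial>angle_measure \<partial>disc_borel)"
    by (rule AD.Fubini'[symmetric]) (use m1 in simp)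
  also have "\<dots> = (\<integral>\<^sup>+z. M (cmod z) \<partial>disc_borel)"
  proof (rule nn_integral_cong)
    fix z :: complex
    define \<beta> where "\<beta> = Arg2pi z"
    have z: "z = of_real (cmod z) * cis \<beta>"
      using Arg2pi_eq[of z] by (simp add: \<beta>_def cis_conv_exp)
    have mm: "(\<lambda>w. f (of_real (cmod z) * w)) \<in> borel_measurable borel"
      by (rule measurable_compose[OF _ f]) (intro borel_measurable_continuous_onI continuous_intros)
    have "(\<integral>\<^sup>+\<alpha>. f (cis \<alpha> * z) \<partial>angle_measure)
        = (\<integral>\<^sup>+\<alpha>. f (of_real (cmod z) * (cis \<alpha> * cis \<beta>)) \<partial>angle_measure)"
      by (subst z) (simp add: mult_ac)
    also have "\<dots> = M (cmod z)"
      unfolding M_def by (rule nn_integral_angle_shift[OF mm])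
    finally show "(\<integral>\<^sup>+\<alpha>. f (cis \<alpha> * z) \<partial>angle_measure) = M (cmod z)" .
  qed
  also have "\<dots> = (\<integral>\<^sup>+r. M r \<partial>distr disc_borel borel cmod)"
    by (simp add: nn_integral_distr)
  also have "\<dots> = (\<integral>\<^sup>+t. M (sqrt t) \<partial>unit_interval_measure)"
    unfolding distr_cmod_disc by (simp add: nn_integral_distr)
  also have "\<dots> = (\<integral>\<^sup>+p. (\<lambda>(\<alpha>, t). f (of_real (sqrt t) * cis \<alpha>)) p
      \<partial>polar_measure)"
    unfolding M_def by (subst polar.nn_integral_snd[symmetric]) simp_all
  finally show ?thesis by (simp add: polar_map_def split_def)
qed

lemma disc_borel_eq_distr_polar:
  "disc_borel = distr polar_measure borel polar_map"
proof (rule measure_eqI)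
  fix A assume "A \<in> sets disc_borel"
  then have [measurable]: "A \<in> sets borel" by simp
  have "emeasure disc_borel A = (\<integral>\<^sup>+z. indicator A z \<partial>disc_borel)" by simp
  also have "\<dots> = (\<integral>\<^sup>+p. indicator A (polar_map p) \<partial>polar_measure)"
    by (rule nn_integral_disc_polar) simp
  also have "\<dots> = emeasure (distr polar_measure borel polar_map) A"
    using nn_integral_distr[of polar_map "polar_measure" borel
        "indicator A :: complex \<Rightarrow> ennreal"] by simp
  finally show "emeasure disc_borel A
    = emeasure (distr polar_measure borel polar_map) A" .
qed simp

lemma space_disc_measure [simp]: "space disc_measure = ball 0 1"
  by (simp add: disc_measure_def)

lemma measurable_disc_id [measurable]: "(\<lambda>z. z) \<in> measurable disc_measure borel"
  unfolding disc_measure_def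
  by (auto intro!: measurable_restrict_space1 simp: measurable_completion)

text \<open>Identifies the measure on Lebesgue sets used for the Bergman space with the uniform distribution on
  Borel sets, to which the polar coordinates apply.\<close>
lemma distr_disc_measure: "distr disc_measure borel (\<lambda>z. z) = disc_borel"
proof (rule measure_eqI)
  fix A :: "complex set" assume "A \<in> sets (distr disc_measure borel (\<lambda>z. z))"
  then have A[measurable]: "A \<in> sets borel" by simp
  then have A': "A \<inter> ball 0 1 \<in> sets (lebesgue_on (ball 0 1))"
    by (auto simp: sets_restrict_space)
  have "emeasure (distr disc_measure borel (\<lambda>z. z)) A = emeasure disc_measure (A \<inter> ball 0 1)"
    by (simp add: emeasure_distr)
  also have "\<dots> = ennreal (1/pi) * emeasure (lebesgue_on (ball 0 1)) (A \<inter> ball 0 1)"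
    unfolding disc_measure_def using A' by (subst emeasure_density_const) auto
  also have "emeasure (lebesgue_on (ball 0 1)) (A \<inter> ball 0 1) = emeasure lborel (A \<inter> ball 0 1)"
    by (subst emeasure_restrict_space) (auto simp: emeasure_completion)
  also have "ennreal (1/pi) * \<dots> = emeasure disc_borel A"
    by (simp add: disc_borel_def emeasure_unit_disc Int_commute divide_ennreal_def inverse_ennreal
         mult.commute inverse_eq_divide)
  finally show "emeasure (distr disc_measure borel (\<lambda>z. z)) A = emeasure disc_borel A" .
qed simp

lemma prob_space_disc_measure: "prob_space disc_measure"
proof
  have "emeasure (distr disc_measure borel (\<lambda>z. z)) UNIV = 1"
    unfolding distr_disc_measure
    using prob_space.emeasure_space_1[OF prob_space_disc_borel] by simp
  then show "emeasure disc_measure (space disc_measure) = 1"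
    by (simp add: emeasure_distr)
qed

lemma
  fixes f :: "complex \<Rightarrow> 'b::{banach, second_countable_topology}"
  assumes [measurable]: "f \<in> borel_measurable borel"
  shows integral_disc_polar: "(LINT z|disc_measure. f z)
      = (LINT p|polar_measure. f (polar_map p))"
    and integrable_disc_polar: "integrable disc_measure f
      \<longleftrightarrow> integrable polar_measure (\<lambda>p. f (polar_map p))"
proof -
  have eq: "distr disc_measure borel (\<lambda>z. z) = distr polar_measure borel polar_map"
    by (simp add: distr_disc_measure flip: disc_borel_eq_distr_polar)
  show "(LINT z|disc_measure. f z)
      = (LINT p|polar_measure. f (polar_map p))"
    using integral_distr[of "\<lambda>z. z" disc_measure borel f]
      integral_distr[of polar_map "polar_measure" borel f]
    by (simp add: eq)
  show "integrable disc_measure f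
      \<longleftrightarrow> integrable polar_measure (\<lambda>p. f (polar_map p))"
    using integrable_distr_eq[of "\<lambda>z. z" disc_measure borel f]
      integrable_distr_eq[of polar_map "polar_measure" borel f]
    by (simp add: eq)
qed

text \<open>A null set of the disc meets almost every radius in a null set. Through this, a Borel
  representative of a Lebesgue-measurable symbol inherits the radial limits of the symbol.\<close>
lemma AE_disc_polar:
  assumes "AE z in lborel. z \<in> ball 0 1 \<longrightarrow> P z"
  shows "AE \<theta> in angle_measure. AE t in unit_interval_measure. P (of_real (sqrt t) * cis \<theta>)"
proof -
  obtain N where N: "{z. \<not> (z \<in> ball 0 1 \<longrightarrow> P z)} \<subseteq> N" "emeasure lborel N = 0" "N \<in> sets borel"
    using AE_E[OF assms] by auto
  have "AE z in disc_borel. z \<notin> N \<and> z \<in> ball 0 1"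
    unfolding disc_borel_def using N
    by (intro AE_uniform_measureI) (auto intro: AE_I[where N=N])
  then have "AE p in polar_measure. polar_map p \<notin> N \<and> polar_map p \<in> ball 0 1"
    unfolding disc_borel_eq_distr_polar using N(3) by (subst (asm) AE_distr_iff) auto
  then have "AE p in polar_measure. P (polar_map p)"
    by (rule eventually_mono) (use N(1) in auto)
  from polar.AE_pair[OF this] show ?thesis by (simp add: polar_map_def)
qed

section \<open>Concentration at the boundary\<close>
text \<open>With \<open>t = \<bar>z\<bar>\<^sup>2\<close> this is \<open>K\<^sub>N(z,z) / (N + 1)\<close>, where \<open>K\<^sub>N\<close> is the reproducing kernel of the polynomials
  of degree at most \<open>N\<close>. It is a probability density on the disc.\<close>
definition boundary_weight :: "nat \<Rightarrow> real \<Rightarrow> real" where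
  "boundary_weight N t = (\<Sum>n\<le>N. real (n + 1) * t ^ n) / real (N + 1)"

lemma integral_unit_interval:
  fixes f :: "real \<Rightarrow> real"
  assumes [measurable]: "f \<in> borel_measurable borel"
  shows "(LINT t|unit_interval_measure. f t) = (LINT t|lborel. f t * indicator {0..1} t)"
proof -
  have e: "emeasure lborel {0..<1::real} = 1" by simp
  have eq: "unit_interval_measure = density lborel (\<lambda>t. ennreal (indicator {0..<1} t))"
    unfolding unit_interval_measure_def uniform_measure_def e
    by (intro arg_cong[where f = "density lborel"] ext) (simp add: divide_ennreal_def ennreal_indicator)
  have "(LINT t|unit_interval_measure. f t) = (LINT t|lborel. indicator {0..<1} t * f t)"
    unfolding eq by (subst integral_density) auto
  also have "\<dots> = (LINT t|lborel. f t * indicator {0..1} t)"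
    by (intro integral_cong_AE) (auto intro!: eventually_mono[OF AE_lborel_singleton[of 1]] simp: indicator_def)
  finally show ?thesis .
qed

lemma AE_unit_interval: "AE t in unit_interval_measure. 0 \<le> t \<and> t < 1"
  unfolding unit_interval_measure_def by (rule AE_uniform_measureI) auto

lemma integral_unit_interval_power: "(LINT t|unit_interval_measure. t ^ n) = 1 / real (n + 1)"
  by (simp add: integral_unit_interval integral_power)

lemma integrable_unit_interval_bounded:
  fixes f :: "real \<Rightarrow> real"
  assumes [measurable]: "f \<in> borel_measurable borel"
    and "\<And>t. 0 \<le> t \<Longrightarrow> t < 1 \<Longrightarrow> \<bar>f t\<bar> \<le> B"
  shows "integrable unit_interval_measure f"
proof -
  show ?thesis
    by (rule unit_interval.integrable_const_bound[where B=B])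
       (auto intro: eventually_mono[OF AE_unit_interval] assms(2))
qed

lemma abs_mult_bound:
  fixes a w :: real
  assumes "\<bar>a\<bar> \<le> C" "\<bar>w\<bar> \<le> B" shows "\<bar>a * w\<bar> \<le> C * B"
  using assms by (simp add: abs_mult mult_mono')

lemma boundary_weight_measurable [measurable]: "boundary_weight N \<in> borel_measurable borel"
  unfolding boundary_weight_def by measurable

lemma boundary_weight_nonneg: "0 \<le> t \<Longrightarrow> 0 \<le> boundary_weight N t"
  unfolding boundary_weight_def by (intro divide_nonneg_nonneg sum_nonneg) auto

lemma boundary_weight_mono: "0 \<le> s \<Longrightarrow> s \<le> t \<Longrightarrow> boundary_weight N s \<le> boundary_weight N t"
  unfolding boundary_weight_def
  by (intro divide_right_mono sum_mono mult_left_mono power_mono) auto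

lemma integral_boundary_weight: "(LINT t|unit_interval_measure. boundary_weight N \<bar>t\<bar>) = 1"
proof -
  have i: "integrable unit_interval_measure (\<lambda>t. real (n + 1) * t ^ n)" for n
    by (rule integrable_unit_interval_bounded[where B = "real (n + 1)"])
       (auto simp: power_le_one abs_mult)
  have "(LINT t|unit_interval_measure. boundary_weight N \<bar>t\<bar>) = (LINT t|unit_interval_measure. boundary_weight N t)"
    by (intro integral_cong_AE) (auto intro: eventually_mono[OF AE_unit_interval])
  also have "\<dots> = (\<Sum>n\<le>N. LINT t|unit_interval_measure. real (n + 1) * t ^ n) / real (N + 1)"
    unfolding boundary_weight_def using i by simp
  also have "\<dots> = 1"
    unfolding integral_mult_right_zero integral_unit_interval_power by simp
  finally show ?thesis .
qed

text \<open>The sum is bounded by the convergent series \<open>\<Sum> (n + 1) s\<^sup>n\<close>, and it is divided by \<open>N + 1\<close>.\<close>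
lemma boundary_weight_tendsto_0:
  assumes "0 \<le> s" "s < 1" shows "(\<lambda>N. boundary_weight N s) \<longlonglongrightarrow> 0"
proof -
  define B where "B = (\<Sum>n. real (n + 1) * s ^ n)"
  have "summable (\<lambda>n. real (n + 1) * s ^ n)"
    using assms geometric_deriv_sums[of s] by (auto simp: sums_iff)
  then have "(\<Sum>n\<le>N. real (n + 1) * s ^ n) \<le> B" for N
    unfolding B_def by (intro sum_le_suminf) (use assms in auto)
  then have "boundary_weight N s \<le> B / real (N + 1)" for N
    unfolding boundary_weight_def by (intro divide_right_mono) auto
  moreover have "(\<lambda>N. B / real (N + 1)) \<longlonglongrightarrow> 0"
    by real_asymp
  ultimately show ?thesis
    using boundary_weight_nonneg[OF assms(1)]
    by (rule_tac real_tendsto_sandwich[of "\<lambda>_. 0" _ _ "\<lambda>N. B / real (N + 1)"]) auto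
qed

text \<open>The mass of the density on \<open>[0, s]\<close> vanishes in the limit for every \<open>s < 1\<close>, so only the values of \<open>h\<close>
  near \<open>1\<close> count. The Borel function \<open>g\<close> stands in for \<open>h\<close>, which need not be Borel measurable.\<close>
lemma boundary_weight_approximates_limit:
  fixes g h :: "real \<Rightarrow> real"
  assumes [measurable]: "g \<in> borel_measurable borel" and gB: "\<And>t. \<bar>g t\<bar> \<le> C"
    and gh: "AE t in unit_interval_measure. g t = h t"
    and h: "(h \<longlongrightarrow> L) (at_left 1)"
  shows "(\<lambda>N. LINT t|unit_interval_measure. g t * boundary_weight N \<bar>t\<bar>) \<longlonglongrightarrow> L"
proof (rule LIMSEQ_I)
  fix e :: real assume e: "0 < e"
  from h e have "eventually (\<lambda>t. \<bar>h t - L\<bar> < e / 2) (at_left 1)"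
    unfolding tendsto_iff dist_real_def by (meson half_gt_zero)
  then obtain b where b: "b < 1" "\<And>t. b < t \<Longrightarrow> t < 1 \<Longrightarrow> \<bar>h t - L\<bar> < e / 2"
    by (auto simp: eventually_at_left[of 0 1])
  define s where "s = max 0 b"
  have s: "0 \<le> s" "s < 1" "\<And>t. s < t \<Longrightarrow> t < 1 \<Longrightarrow> \<bar>h t - L\<bar> < e / 2"
    using b by (auto simp: s_def)
  define K where "K = C + \<bar>L\<bar> + 1"
  have K: "K > 0" and K2: "\<And>t. \<bar>g t - L\<bar> \<le> K"
  proof -
    show "K > 0" using gB[of 0] abs_ge_zero[of "g 0"] abs_ge_zero[of L] unfolding K_def by linarith
    show "\<bar>g t - L\<bar> \<le> K" for t using gB[of t] unfolding K_def by linarith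
  qed
  have "(\<lambda>N. K * boundary_weight N s) \<longlonglongrightarrow> K * 0"
    by (intro tendsto_mult tendsto_const boundary_weight_tendsto_0 s)
  then obtain N0 where N0: "\<And>N. N \<ge> N0 \<Longrightarrow> K * boundary_weight N s < e / 2"
    using order_tendstoD(2)[of _ "K * 0" sequentially "e/2"] e
    by (auto simp: eventually_sequentially)
  show "\<exists>N0. \<forall>N\<ge>N0. norm ((LINT t|unit_interval_measure. g t * boundary_weight N \<bar>t\<bar>) - L) < e"
  proof (intro exI allI impI)
    fix N assume N: "N \<ge> N0"
    let ?w = "\<lambda>t. boundary_weight N \<bar>t\<bar>"
    have w1: "\<bar>?w t\<bar> \<le> boundary_weight N 1" if "0 \<le> t" "t < 1" for t
      using boundary_weight_nonneg[of t N] boundary_weight_mono[of t 1 N] that by simp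
    have iw: "integrable unit_interval_measure ?w"
      by (rule integrable_unit_interval_bounded[where B = "boundary_weight N 1"]) (measurable, erule (1) w1)
    have igw: "integrable unit_interval_measure (\<lambda>t. g t * ?w t)"
      by (rule integrable_unit_interval_bounded[where B = "C * boundary_weight N 1"])
         (measurable, intro abs_mult_bound gB, erule (1) w1)
    have igl: "integrable unit_interval_measure (\<lambda>t. (g t - L) * ?w t)"
      using Bochner_Integration.integrable_diff[OF igw integrable_mult_right[OF iw, of L]]
      by (simp add: left_diff_distrib)
    have "(LINT t|unit_interval_measure. g t * ?w t) - L
       = (LINT t|unit_interval_measure. (g t - L) * ?w t)"
      using igw iw by (simp add: left_diff_distrib integral_boundary_weight)
    also have "\<bar>\<dots>\<bar> \<le> (LINT t|unit_interval_measure. \<bar>(g t - L) * ?w t\<bar>)"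
      using integral_abs_bound by simp
    also have "\<dots> \<le> (LINT t|unit_interval_measure. e / 2 * ?w t + K * boundary_weight N s)"
    proof (rule integral_mono_AE)
      show "integrable unit_interval_measure (\<lambda>t. \<bar>(g t - L) * ?w t\<bar>)"
        using igl by simp
      show "integrable unit_interval_measure (\<lambda>t. e / 2 * ?w t + K * boundary_weight N s)"
        using iw by simp
      show "AE t in unit_interval_measure. \<bar>(g t - L) * ?w t\<bar> \<le> e / 2 * ?w t + K * boundary_weight N s"
        using gh AE_unit_interval
      proof eventually_elim
        fix t assume t: "g t = h t" "0 \<le> t \<and> t < 1"
        have wt: "0 \<le> ?w t" "0 \<le> boundary_weight N s"
          using t boundary_weight_nonneg s(1) by auto
        show "\<bar>(g t - L) * ?w t\<bar> \<le> e / 2 * ?w t + K * boundary_weight N s"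
        proof (cases "t \<le> s")
          case True
          then have "\<bar>g t - L\<bar> * ?w t \<le> K * boundary_weight N s"
            using t K K2[of t] wt by (intro mult_mono boundary_weight_mono) auto
          then show ?thesis using wt e by (simp add: abs_mult add_increasing)
        next
          case False
          then have "\<bar>g t - L\<bar> * ?w t \<le> e / 2 * ?w t"
            using s(3)[of t] t wt by (intro mult_right_mono) auto
          then show ?thesis using wt K(1) by (simp add: abs_mult add_increasing2)
        qed
      qed
    qed
    also have "\<dots> = e / 2 + K * boundary_weight N s"
      using iw by (simp add: integral_boundary_weight unit_interval.prob_space[simplified])
    also have "\<dots> < e" using N0[OF N] by simp
    finally show "norm ((LINT t|unit_interval_measure. g t * boundary_weight N \<bar>t\<bar>) - L) < e" by simp
  qed
qed

text \<open>A representative may exceed the bound on a null set; clamping it to \<open>[-C, C]\<close> repairs this.\<close>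
lemma borel_representative_bounded:
  fixes \<phi> :: "complex \<Rightarrow> real"
  assumes \<phi>: "\<phi> \<in> borel_measurable (lebesgue_on (ball 0 1))"
    and C: "\<And>z. z \<in> ball 0 1 \<Longrightarrow> \<bar>\<phi> z\<bar> \<le> C"
  obtains g where "g \<in> borel_measurable borel" "\<And>z. \<bar>g z\<bar> \<le> C"
    "AE z in lborel. z \<in> ball 0 1 \<longrightarrow> \<phi> z = g z"
proof -
  have "(\<lambda>z. if z \<in> ball 0 1 then \<phi> z else 0) \<in> borel_measurable lebesgue"
    using \<phi> by (subst (asm) borel_measurable_if[symmetric]) auto
  then obtain g where g[measurable]: "g \<in> borel_measurable borel"
    and eq: "AE z in lborel. (if z \<in> ball 0 1 then \<phi> z else 0) = g z"
    using completion_ex_borel_measurable_real[of "\<lambda>z. if z \<in> ball 0 1 then \<phi> z else 0" lborel]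
    by auto
  have "0 \<le> C" using C[of 0] by simp
  show thesis
  proof
    show "(\<lambda>z. max (-C) (min C (g z))) \<in> borel_measurable borel" by measurable
    show "\<bar>max (-C) (min C (g z))\<bar> \<le> C" for z using \<open>0 \<le> C\<close> by auto
    show "AE z in lborel. z \<in> ball 0 1 \<longrightarrow> \<phi> z = max (-C) (min C (g z))"
      using eq
    proof eventually_elim
      case (elim z)
      show ?case
      proof
        assume "z \<in> ball 0 1"
        with elim C[of z] show "\<phi> z = max (-C) (min C (g z))" by auto
      qed
    qed
  qed
qed

lemma AE_disc_measure_lborel:
  assumes "AE z in lborel. z \<in> ball 0 1 \<longrightarrow> P z"
  shows "AE z in disc_measure. P z"
proof -
  have "AE z in lebesgue. z \<in> ball 0 1 \<longrightarrow> P z"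
    using assms by (rule AE_completion)
  then have "AE z in lebesgue_on (ball 0 1). P z"
    by (subst AE_restrict_space_iff) auto
  then show ?thesis
    unfolding disc_measure_def by (subst AE_density) auto
qed

lemma AE_angle_iff: "(AE \<theta> in angle_measure. P \<theta>) \<longleftrightarrow> (AE \<theta> in circle_measure. P \<theta>)"
proof -
  have "(AE \<theta> in angle_measure. P \<theta>) \<longleftrightarrow> (AE \<theta> in lborel. \<theta> \<in> {0..<2*pi} \<longrightarrow> P \<theta>)"
    unfolding angle_measure_def by (rule AE_uniform_measure) auto
  also have "\<dots> \<longleftrightarrow> (AE \<theta> in lebesgue. \<theta> \<in> {0..<2*pi} \<longrightarrow> P \<theta>)"
    by (simp add: AE_completion_iff)
  also have "\<dots> \<longleftrightarrow> (AE \<theta> in circle_measure. P \<theta>)"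
    by (subst AE_restrict_space_iff) auto
  finally show ?thesis .
qed

lemma angle_measure_eq_density:
  "angle_measure = density lborel (\<lambda>\<theta>. ennreal (indicator {0..<2*pi} \<theta> / (2 * pi)))"
proof -
  have e: "emeasure lborel {0..<2*pi} = ennreal (2 * pi)" by simp
  show ?thesis
    unfolding angle_measure_def uniform_measure_def e
    by (intro density_cong) (auto simp: indicator_def divide_ennreal[of 1 "2*pi", symmetric])
qed

lemma integral_angle:
  fixes f :: "real \<Rightarrow> real"
  assumes [measurable]: "f \<in> borel_measurable borel"
  shows "(LINT \<theta>|angle_measure. f \<theta>) = (LINT \<theta>|circle_measure. f \<theta>) / (2 * pi)"
proof -
  have "(LINT \<theta>|angle_measure. f \<theta>) = (LINT \<theta>|lborel. indicator {0..<2*pi} \<theta> / (2*pi) * f \<theta>)"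
    unfolding angle_measure_eq_density by (subst integral_density) auto
  also have "\<dots> = (LINT \<theta>|lborel. indicator {0..<2*pi} \<theta> * f \<theta>) / (2*pi)"
    by simp
  also have "(LINT \<theta>|lborel. indicator {0..<2*pi} \<theta> * f \<theta>) = (LINT \<theta>|lebesgue. indicator {0..<2*pi} \<theta> * f \<theta>)"
    by (simp add: integral_completion)
  also have "\<dots> = (LINT \<theta>|circle_measure. f \<theta>)"
    by (subst integral_restrict_space) auto
  finally show ?thesis .
qed

text \<open>The form in which contour integrals over circles, which are Henstock-Kurzweil integrals, enter.\<close>
lemma integral_angle_continuous:
  fixes f :: "real \<Rightarrow> complex"
  assumes f: "continuous_on UNIV f" and I: "(f has_integral I) {0..2*pi}"
  shows "(LINT \<theta>|angle_measure. f \<theta>) = I / of_real (2 * pi)"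
proof -
  have [measurable]: "f \<in> borel_measurable borel"
    using f by (rule borel_measurable_continuous_onI)
  have "(LINT \<theta>|angle_measure. f \<theta>) = (LINT \<theta>|lborel. (indicator {0..<2*pi} \<theta> / (2*pi)) *\<^sub>R f \<theta>)"
    unfolding angle_measure_eq_density by (subst integral_density) auto
  also have "\<dots> = (LINT \<theta>|lborel. (1 / (2*pi)) *\<^sub>R (indicator {0..2*pi} \<theta> *\<^sub>R f \<theta>))"
    by (intro integral_cong_AE)
       (auto intro!: eventually_mono[OF AE_lborel_singleton[of "2*pi"]] simp: indicator_def)
  also have "\<dots> = (1 / (2*pi)) *\<^sub>R (LINT \<theta>:{0..2*pi}|lborel. f \<theta>)"
    unfolding set_lebesgue_integral_def by (rule integral_scaleR_right)
  also have "(LINT \<theta>:{0..2*pi}|lborel. f \<theta>) = integral {0..2*pi} f"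
    by (intro set_borel_integral_eq_integral borel_integrable_compact[folded set_integrable_def])
       (auto intro: continuous_on_subset[OF f])
  also have "\<dots> = I" using I by (rule integral_unique)
  finally show ?thesis by (simp add: scaleR_conv_of_real)
qed

lemma lebesgue_on_measurable_AE:
  fixes f g :: "'a::euclidean_space \<Rightarrow> 'b::euclidean_space"
  assumes S: "S \<in> sets lebesgue" and f: "f \<in> borel_measurable (lebesgue_on S)"
    and fg: "AE x in lebesgue_on S. f x = g x"
  shows "g \<in> borel_measurable (lebesgue_on S)"
proof -
  have "AE x in lebesgue. x \<in> S \<longrightarrow> f x = g x"
    using fg S by (subst (asm) AE_restrict_space_iff) auto
  then have "AE x in lebesgue. (if x \<in> S then f x else 0) = (if x \<in> S then g x else 0)"
    by eventually_elim auto
  moreover have "(\<lambda>x. if x \<in> S then f x else 0) \<in> borel_measurable lebesgue"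
    using f S by (subst borel_measurable_if) auto
  ultimately have "(\<lambda>x. if x \<in> S then g x else 0) \<in> borel_measurable lebesgue"
    by (rule borel_measurable_AE[rotated])
  then show ?thesis using S by (subst (asm) borel_measurable_if) auto
qed

text \<open>In polar coordinates the weighted mean of \<open>\<phi>\<close> is an average over the directions \<open>\<theta>\<close> of radial means,
  each of which tends to the radial limit \<open>L \<theta>\<close>; dominated convergence does the rest. The radial means are
  measurable in \<open>\<theta>\<close>, which also shows that their limit \<open>L\<close> is measurable although the single
  functions \<open>\<theta> \<mapsto> \<phi> (r cis \<theta>)\<close> need not be.\<close>
lemma boundary_concentration:
  fixes \<phi> :: "complex \<Rightarrow> real" and L :: "real \<Rightarrow> real"
  assumes \<phi>: "\<phi> \<in> borel_measurable (lebesgue_on (ball 0 1))"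
    and C: "\<And>z. z \<in> ball 0 1 \<Longrightarrow> \<bar>\<phi> z\<bar> \<le> C"
    and L: "AE \<theta> in circle_measure. ((\<lambda>r. \<phi> (of_real r * cis \<theta>)) \<longlongrightarrow> L \<theta>) (at_left 1)"
  shows "L \<in> borel_measurable circle_measure"
    and "(\<lambda>N. LINT z|disc_measure. \<phi> z * boundary_weight N ((cmod z)\<^sup>2))
      \<longlonglongrightarrow> (LINT \<theta>|circle_measure. L \<theta>) / (2 * pi)"
proof -
  obtain g where g[measurable]: "g \<in> borel_measurable borel" and gC: "\<And>z. \<bar>g z\<bar> \<le> C"
    and ae: "AE z in lborel. z \<in> ball 0 1 \<longrightarrow> \<phi> z = g z"
    using borel_representative_bounded[OF \<phi> C] by blast
  define I where "I N \<theta> = (LINT t|unit_interval_measure.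
      g (polar_map (\<theta>, t)) * boundary_weight N \<bar>t\<bar>)" for N \<theta>
  have [measurable]: "(\<lambda>t. g (polar_map (\<theta>, t))) \<in> borel_measurable borel" for \<theta>
    by measurable
  have Imeas[measurable]: "I N \<in> borel_measurable borel" for N
    unfolding I_def by (intro unit_interval.borel_measurable_lebesgue_integral) measurable
  have w1: "\<bar>boundary_weight N \<bar>t\<bar>\<bar> \<le> boundary_weight N 1" if "0 \<le> t" "t < 1" for t N
    using boundary_weight_nonneg[of t N] boundary_weight_mono[of t 1 N] that by simp
  have iw: "integrable unit_interval_measure (\<lambda>t. C * boundary_weight N \<bar>t\<bar>)" for N
    by (rule integrable_mult_right, rule integrable_unit_interval_bounded[where B = "boundary_weight N 1"])
       (measurable, erule (1) w1)
  have igw: "integrable unit_interval_measure (\<lambda>t. g (polar_map (\<theta>, t)) * boundary_weight N \<bar>t\<bar>)" for \<theta> N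
    by (rule integrable_unit_interval_bounded[where B = "C * boundary_weight N 1"])
       (measurable, intro abs_mult_bound gC, erule (1) w1)
  have IC: "\<bar>I N \<theta>\<bar> \<le> C" for N \<theta>
  proof -
    have "\<bar>I N \<theta>\<bar> \<le> (LINT t|unit_interval_measure. \<bar>g (polar_map (\<theta>, t)) * boundary_weight N \<bar>t\<bar>\<bar>)"
      unfolding I_def by (rule integral_abs_bound)
    also have "\<dots> \<le> (LINT t|unit_interval_measure. C * boundary_weight N \<bar>t\<bar>)"
      by (intro integral_mono integrable_abs igw iw)
        (auto simp: abs_mult boundary_weight_nonneg intro!: mult_right_mono gC)
    also have "\<dots> = C" by (simp add: integral_boundary_weight)
    finally show ?thesis .
  qed
  have lim: "AE \<theta> in angle_measure. (\<lambda>N. I N \<theta>) \<longlonglongrightarrow> L \<theta>"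
    using L[folded AE_angle_iff] AE_disc_polar[OF ae]
  proof eventually_elim
    case (elim \<theta>)
    have "filterlim sqrt (at_left 1) (at_left (1::real))"
      by (rule filterlim_at_withinI)
         (auto intro!: tendsto_eq_intros simp: eventually_at_filter)
    from filterlim_compose[OF elim(1) this]
    have "((\<lambda>t. \<phi> (of_real (sqrt t) * cis \<theta>)) \<longlongrightarrow> L \<theta>) (at_left 1)" .
    moreover have "AE t in unit_interval_measure.
        g (polar_map (\<theta>, t)) = \<phi> (of_real (sqrt t) * cis \<theta>)"
      using elim(2) by eventually_elim (simp add: polar_map_def)
    ultimately show ?case
      unfolding I_def using gC by (intro boundary_weight_approximates_limit[where C = C]) auto
  qed
  define L' where "L' \<theta> = lim (\<lambda>N. I N \<theta>)" for \<theta>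
  have [measurable]: "L' \<in> borel_measurable borel"
    unfolding L'_def by measurable
  have LL': "AE \<theta> in circle_measure. L' \<theta> = L \<theta>"
    using lim unfolding AE_angle_iff L'_def by eventually_elim (rule limI)
  show Lm: "L \<in> borel_measurable circle_measure"
    by (rule lebesgue_on_measurable_AE[OF _ _ LL'])
       (auto intro!: measurable_restrict_space1 measurable_completion)
  have "(\<lambda>N. LINT \<theta>|angle_measure. I N \<theta>) \<longlonglongrightarrow> (LINT \<theta>|angle_measure. L' \<theta>)"
  proof (rule integral_dominated_convergence[where w = "\<lambda>_. C"])
    show "AE \<theta> in angle_measure. (\<lambda>N. I N \<theta>) \<longlonglongrightarrow> L' \<theta>"
      using lim by eventually_elim (simp add: L'_def limI)
  qed (use IC in auto)
  moreover have "(LINT \<theta>|angle_measure. L' \<theta>) = (LINT \<theta>|circle_measure. L \<theta>) / (2 * pi)"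
  proof -
    have "(LINT \<theta>|circle_measure. L' \<theta>) = (LINT \<theta>|circle_measure. L \<theta>)"
      by (intro integral_cong_AE LL' Lm measurable_restrict_space1 measurable_completion) simp
    then show ?thesis by (simp add: integral_angle)
  qed
  moreover have "(LINT z|disc_measure. \<phi> z * boundary_weight N ((cmod z)\<^sup>2)) = (LINT \<theta>|angle_measure. I N \<theta>)" for N
  proof -
    have \<phi>'[measurable]: "\<phi> \<in> borel_measurable disc_measure"
      using \<phi> by (simp add: disc_measure_def)
    have [measurable]: "g \<in> borel_measurable disc_measure" "cmod \<in> borel_measurable disc_measure"
      by (rule measurable_compose[OF measurable_disc_id], simp)+
    have cm: "(cmod (polar_map p))\<^sup>2 = \<bar>snd p\<bar>" for p
    proof -
      have "(sqrt t)\<^sup>2 = \<bar>t\<bar>" for t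
      proof (cases "0 \<le> t")
        case False
        then have "(sqrt (- t))\<^sup>2 = - t" by (intro real_sqrt_pow2) simp
        then show ?thesis using False by (simp add: real_sqrt_minus)
      qed simp
      then show ?thesis by (simp add: polar_map_def norm_mult)
    qed
    have "(LINT z|disc_measure. \<phi> z * boundary_weight N ((cmod z)\<^sup>2))
       = (LINT z|disc_measure. g z * boundary_weight N ((cmod z)\<^sup>2))"
    proof (rule integral_cong_AE)
      show "AE z in disc_measure. \<phi> z * boundary_weight N ((cmod z)\<^sup>2)
          = g z * boundary_weight N ((cmod z)\<^sup>2)"
        using AE_disc_measure_lborel[OF ae] by eventually_elim simp
    qed measurable
    also have "\<dots> = (LINT p|polar_measure.
        g (polar_map p) * boundary_weight N \<bar>snd p\<bar>)"
      by (subst integral_disc_polar) (simp_all add: cm)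
    also have "\<dots> = (LINT \<theta>|angle_measure. LINT t|unit_interval_measure.
        g (polar_map (\<theta>, t)) * boundary_weight N \<bar>snd (\<theta>, t)\<bar>)"
    proof (rule polar.integral_fst'[symmetric])
      show "integrable polar_measure
          (\<lambda>p. g (polar_map p) * boundary_weight N \<bar>snd p\<bar>)"
      proof (rule polar.P.integrable_const_bound[where B = "C * boundary_weight N 1"])
        have "AE p in polar_measure. 0 \<le> snd p \<and> snd p < 1"
        proof (rule polar.AE_pair_measure)
          show "{p \<in> space polar_measure. 0 \<le> snd p \<and> snd p < 1}
              \<in> sets polar_measure"
            by measurable
        qed (use AE_unit_interval in simp)
        then show "AE p in polar_measure.
            norm (g (polar_map p) * boundary_weight N \<bar>snd p\<bar>) \<le> C * boundary_weight N 1"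
          by eventually_elim
            (simp only: real_norm_def, intro abs_mult_bound gC w1, auto)
      qed measurable
    qed
    finally show ?thesis by (simp add: I_def)
  qed
  ultimately show "(\<lambda>N. LINT z|disc_measure. \<phi> z * boundary_weight N ((cmod z)\<^sup>2))
      \<longlonglongrightarrow> (LINT \<theta>|circle_measure. L \<theta>) / (2 * pi)"
    by simp
qed

section \<open>Square-integrable functions on the disc\<close>
interpretation disc: prob_space disc_measure
  by (rule prob_space_disc_measure)

lemma cnj_measurable [measurable]: "cnj \<in> borel_measurable borel"
  by (intro borel_measurable_continuous_onI continuous_intros)

lemma L2_discD:
  assumes "f \<in> L2_disc"
  shows "f \<in> borel_measurable disc_measure" "integrable disc_measure (\<lambda>z. (cmod (f z))\<^sup>2)"
  using assms by (auto simp: L2_disc_def)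

lemma L2_disc_add:
  assumes "f \<in> L2_disc" "g \<in> L2_disc" shows "(\<lambda>z. f z + g z) \<in> L2_disc"
proof -
  note [measurable] = L2_discD(1)[OF assms(1)] L2_discD(1)[OF assms(2)]
  have le: "(cmod (f z + g z))\<^sup>2 \<le> 2 * (cmod (f z))\<^sup>2 + 2 * (cmod (g z))\<^sup>2" for z
  proof -
    have "(cmod (f z + g z))\<^sup>2 \<le> (cmod (f z) + cmod (g z))\<^sup>2"
      by (intro power_mono norm_triangle_ineq) simp
    then show ?thesis
      using sum_squares_bound[of "cmod (f z)" "cmod (g z)"] by (simp add: power2_sum)
  qed
  have "integrable disc_measure (\<lambda>z. (cmod (f z + g z))\<^sup>2)"
    by (rule Bochner_Integration.integrable_bound[of _ "\<lambda>z. 2 * (cmod (f z))\<^sup>2 + 2 * (cmod (g z))\<^sup>2"])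
       (use L2_discD(2)[OF assms(1)] L2_discD(2)[OF assms(2)] le in \<open>auto intro!: AE_I2\<close>)
  then show ?thesis by (simp add: L2_disc_def)
qed

lemma L2_disc_bounded_mult:
  assumes f: "f \<in> L2_disc" and [measurable]: "h \<in> borel_measurable disc_measure"
    and C: "\<And>z. z \<in> ball 0 1 \<Longrightarrow> cmod (h z) \<le> C"
  shows "(\<lambda>z. h z * f z) \<in> L2_disc"
proof -
  note [measurable] = L2_discD(1)[OF f]
  have le: "(cmod (h z * f z))\<^sup>2 \<le> C\<^sup>2 * (cmod (f z))\<^sup>2" if "z \<in> ball 0 1" for z
    unfolding norm_mult power_mult_distrib
    by (intro mult_right_mono power_mono C that) auto
  have "integrable disc_measure (\<lambda>z. (cmod (h z * f z))\<^sup>2)"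
    by (rule Bochner_Integration.integrable_bound[of _ "\<lambda>z. C\<^sup>2 * (cmod (f z))\<^sup>2"])
       (use L2_discD(2)[OF f] le in \<open>auto intro!: AE_I2\<close>)
  then show ?thesis by (simp add: L2_disc_def)
qed

lemma L2_disc_bounded:
  assumes [measurable]: "h \<in> borel_measurable disc_measure"
    and C: "\<And>z. z \<in> ball 0 1 \<Longrightarrow> cmod (h z) \<le> C"
  shows "h \<in> L2_disc"
proof -
  have "(\<lambda>_. 1) \<in> L2_disc" by (simp add: L2_disc_def)
  from L2_disc_bounded_mult[OF this assms] show ?thesis by simp
qed

lemma L2_disc_cmult: "f \<in> L2_disc \<Longrightarrow> (\<lambda>z. c * f z) \<in> L2_disc"
  by (rule L2_disc_bounded_mult[where C = "cmod c"]) auto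

lemma L2_disc_0: "(\<lambda>_. 0) \<in> L2_disc"
  by (simp add: L2_disc_def)

lemma L2_disc_sum:
  assumes "\<And>i. i \<in> A \<Longrightarrow> f i \<in> L2_disc"
  shows "(\<lambda>z. \<Sum>i\<in>A. c i * f i z) \<in> L2_disc"
  using assms
proof (induction A rule: infinite_finite_induct)
  case (insert x F)
  then show ?case using L2_disc_add[OF L2_disc_cmult, of "f x"] by simp
qed (simp_all add: L2_disc_0)

lemma L2_disc_diff:
  assumes "f \<in> L2_disc" "g \<in> L2_disc" shows "(\<lambda>z. f z - g z) \<in> L2_disc"
  using L2_disc_add[OF assms(1) L2_disc_cmult[OF assms(2), of "-1"]] by simp

lemma L2_integrable:
  assumes "f \<in> L2_disc" "g \<in> L2_disc"
  shows "integrable disc_measure (\<lambda>z. f z * cnj (g z))"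
proof -
  note [measurable] = L2_discD(1)[OF assms(1)] L2_discD(1)[OF assms(2)]
  have le: "cmod (f z * cnj (g z)) \<le> (cmod (f z))\<^sup>2 + (cmod (g z))\<^sup>2" for z
  proof -
    have "2 * (cmod (f z) * cmod (g z)) \<le> (cmod (f z))\<^sup>2 + (cmod (g z))\<^sup>2"
      using sum_squares_bound[of "cmod (f z)" "cmod (g z)"] by simp
    moreover have "0 \<le> cmod (f z) * cmod (g z)" by simp
    ultimately show ?thesis unfolding norm_mult complex_mod_cnj by linarith
  qed
  show ?thesis
    by (rule Bochner_Integration.integrable_bound[of _ "\<lambda>z. (cmod (f z))\<^sup>2 + (cmod (g z))\<^sup>2"])
       (use L2_discD(2)[OF assms(1)] L2_discD(2)[OF assms(2)] le in \<open>auto intro!: AE_I2\<close>)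
qed

lemma L2_inner_commute: "L2_inner g f = cnj (L2_inner f g)"
  using Bochner_Integration.integral_cnj[of disc_measure "\<lambda>z. f z * cnj (g z)"]
  by (simp add: L2_inner_def mult.commute del: Bochner_Integration.integral_cnj)

lemma L2_inner_diff_left:
  assumes "f \<in> L2_disc" "h \<in> L2_disc" "g \<in> L2_disc"
  shows "L2_inner (\<lambda>z. f z - h z) g = L2_inner f g - L2_inner h g"
  unfolding L2_inner_def
  using L2_integrable[OF assms(1,3)] L2_integrable[OF assms(2,3)]
  by (simp add: left_diff_distrib)

lemma L2_inner_diff_right:
  assumes "f \<in> L2_disc" "h \<in> L2_disc" "g \<in> L2_disc"
  shows "L2_inner g (\<lambda>z. f z - h z) = L2_inner g f - L2_inner g h"
  by (subst (1 2 3) L2_inner_commute) (simp only: L2_inner_diff_left[OF assms] complex_cnj_diff)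

lemma L2_inner_sum_left:
  assumes "\<And>i. i \<in> A \<Longrightarrow> f i \<in> L2_disc" "g \<in> L2_disc"
  shows "L2_inner (\<lambda>z. \<Sum>i\<in>A. c i * f i z) g = (\<Sum>i\<in>A. c i * L2_inner (f i) g)"
proof -
  have "L2_inner (\<lambda>z. \<Sum>i\<in>A. c i * f i z) g
      = (LINT z|disc_measure. (\<Sum>i\<in>A. c i * (f i z * cnj (g z))))"
    unfolding L2_inner_def by (simp add: sum_distrib_right mult.assoc)
  also have "\<dots> = (\<Sum>i\<in>A. LINT z|disc_measure. c i * (f i z * cnj (g z)))"
    by (intro Bochner_Integration.integral_sum integrable_mult_right L2_integrable assms)
  finally show ?thesis
    by (simp add: L2_inner_def)
qed

lemma L2_inner_cmult_left: "L2_inner (\<lambda>z. c * f z) g = c * L2_inner f g"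
  unfolding L2_inner_def by (simp add: mult.assoc)

lemma L2_inner_cmult_right: "L2_inner f (\<lambda>z. c * g z) = cnj c * L2_inner f g"
  by (subst (1 2) L2_inner_commute) (simp add: L2_inner_cmult_left)

lemma L2_inner_sum_right:
  assumes "\<And>i. i \<in> A \<Longrightarrow> f i \<in> L2_disc" "g \<in> L2_disc"
  shows "L2_inner g (\<lambda>z. \<Sum>i\<in>A. c i * f i z) = (\<Sum>i\<in>A. cnj (c i) * L2_inner g (f i))"
proof -
  have "L2_inner g (\<lambda>z. \<Sum>i\<in>A. c i * f i z) = cnj (\<Sum>i\<in>A. c i * L2_inner (f i) g)"
    by (subst L2_inner_commute) (simp add: L2_inner_sum_left assms)
  also have "\<dots> = (\<Sum>i\<in>A. cnj (c i) * L2_inner g (f i))"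
    by (simp add: flip: L2_inner_commute)
  finally show ?thesis .
qed

lemma L2_inner_self: "L2_inner f f = of_real (LINT z|disc_measure. (cmod (f z))\<^sup>2)"
  unfolding L2_inner_def complex_norm_square[symmetric] by (simp flip: integral_complex_of_real)

text \<open>Strong convergence implies weak convergence. The Cauchy-Schwarz inequality is replaced by
  \<open>2 \<bar>s u\<bar> \<le> \<delta> \<bar>s\<bar>\<^sup>2 + \<bar>u\<bar>\<^sup>2 / \<delta>\<close> with a fixed small \<open>\<delta>\<close>.\<close>
lemma L2_inner_tendsto_0:
  assumes s: "s \<in> L2_disc" and u: "\<And>N. u N \<in> L2_disc"
    and lim: "(\<lambda>N. LINT z|disc_measure. (cmod (u N z))\<^sup>2) \<longlonglongrightarrow> 0"
  shows "(\<lambda>N. L2_inner s (u N)) \<longlonglongrightarrow> 0"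
proof (rule LIMSEQ_I)
  fix e :: real assume e: "e > 0"
  define S where "S = (LINT z|disc_measure. (cmod (s z))\<^sup>2)"
  have S: "S \<ge> 0" unfolding S_def by (rule integral_nonneg_AE) simp
  define \<delta> where "\<delta> = e / (S + 1)"
  have \<delta>: "\<delta> > 0" "\<delta> * S < e" using e S by (auto simp: \<delta>_def field_simps)
  obtain N0 where N0: "\<And>N. N \<ge> N0 \<Longrightarrow> (LINT z|disc_measure. (cmod (u N z))\<^sup>2) < e * \<delta>"
    using order_tendstoD(2)[OF lim, of "e * \<delta>"] e \<delta> by (auto simp: eventually_sequentially)
  show "\<exists>N0. \<forall>N\<ge>N0. norm (L2_inner s (u N) - 0) < e"
  proof (intro exI allI impI)
    fix N assume "N \<ge> N0"
    have i: "integrable disc_measure (\<lambda>z. \<delta> * (cmod (s z))\<^sup>2 + (cmod (u N z))\<^sup>2 / \<delta>)"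
      using L2_discD(2)[OF s] L2_discD(2)[OF u] by simp
    have le: "2 * (cmod (s z) * cmod (u N z)) \<le> \<delta> * (cmod (s z))\<^sup>2 + (cmod (u N z))\<^sup>2 / \<delta>" for z
      using sum_squares_bound[of "sqrt \<delta> * cmod (s z)" "cmod (u N z) / sqrt \<delta>"] \<delta>(1)
      by (simp add: power_mult_distrib power_divide)
    have "2 * norm (L2_inner s (u N)) \<le> 2 * (LINT z|disc_measure. cmod (s z * cnj (u N z)))"
      unfolding L2_inner_def by (intro mult_left_mono integral_norm_bound) auto
    also have "\<dots> = (LINT z|disc_measure. 2 * cmod (s z * cnj (u N z)))" by simp
    also have "\<dots> \<le> (LINT z|disc_measure. \<delta> * (cmod (s z))\<^sup>2 + (cmod (u N z))\<^sup>2 / \<delta>)"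
      by (rule integral_mono[OF integrable_mult_right[OF integrable_norm[OF L2_integrable[OF s u]]] i])
         (use le in \<open>simp add: norm_mult\<close>)
    also have "\<dots> = \<delta> * S + (LINT z|disc_measure. (cmod (u N z))\<^sup>2) / \<delta>"
      unfolding S_def using L2_discD(2)[OF s] L2_discD(2)[OF u] by simp
    also have "\<dots> < e + e"
      using N0[OF \<open>N \<ge> N0\<close>] \<delta> by (intro add_strict_mono) (auto simp: field_simps)
    finally show "norm (L2_inner s (u N) - 0) < e" by simp
  qed
qed

section \<open>Taylor coefficients and the Bergman projection\<close>
lemma bergman_space_measurable:
  assumes "g \<in> bergman_space" shows "g \<in> borel_measurable borel"
proof -
  have "continuous_on (ball 0 1) g"
    using assms by (auto simp: bergman_space_def intro: holomorphic_on_imp_continuous_on)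
  then have "(\<lambda>z. if z \<in> ball 0 1 then g z else 0) \<in> borel_measurable borel"
    by (intro borel_measurable_continuous_on_if) auto
  also have "(\<lambda>z. if z \<in> ball 0 1 then g z else 0) = g"
    using assms by (auto simp: bergman_space_def)
  finally show ?thesis .
qed

lemma bergman_spaceD:
  assumes "g \<in> bergman_space"
  shows "g \<in> L2_disc" "g holomorphic_on ball 0 1" "\<And>z. z \<notin> ball 0 1 \<Longrightarrow> g z = 0"
  using assms by (auto simp: bergman_space_def)

lemma disc_monomial_bound: "cmod (disc_monomial n z) \<le> 1"
  by (auto simp: disc_monomial_def norm_power power_le_one)

lemma disc_monomial_measurable [measurable]: "disc_monomial n \<in> borel_measurable borel"
  unfolding disc_monomial_def
  by (intro borel_measurable_continuous_on_if continuous_intros) auto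

lemma borel_measurable_disc:
  "f \<in> borel_measurable borel \<Longrightarrow> f \<in> borel_measurable disc_measure"
  by (rule measurable_compose[OF measurable_disc_id])

lemma disc_monomial_bergman: "disc_monomial n \<in> bergman_space"
proof -
  have "disc_monomial n holomorphic_on ball 0 1"
    by (rule holomorphic_transform[of "\<lambda>z. z ^ n"]) (auto simp: disc_monomial_def intro!: holomorphic_intros)
  moreover have "disc_monomial n \<in> L2_disc"
    by (rule L2_disc_bounded[where C = 1]) (auto simp: disc_monomial_bound borel_measurable_disc)
  ultimately show ?thesis by (auto simp: bergman_space_def disc_monomial_def)
qed

text \<open>Cauchy's formula for the derivatives: on the circle of radius \<open>r\<close> one has
  \<open>cnj (z\<^sup>n) = r\<^sup>2\<^sup>n / z\<^sup>n\<close> and \<open>dz = \<i> z d\<theta>\<close>.\<close>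
lemma circle_taylor_coefficient:
  assumes g: "g holomorphic_on ball 0 1" and r: "0 < r" "r < 1"
  shows "(LINT \<theta>|angle_measure. g (of_real r * cis \<theta>) * cnj ((of_real r * cis \<theta>) ^ n))
    = of_real (r ^ (2 * n)) * ((deriv ^^ n) g 0 / fact n)"
proof -
  define b where "b = (deriv ^^ n) g 0 / fact n"
  have sub: "cball 0 r \<subseteq> ball (0::complex) 1" using r by auto
  have cont: "continuous_on (ball 0 1) g" using g by (rule holomorphic_on_imp_continuous_on)
  have "((\<lambda>u. g u / (u - 0) ^ Suc n) has_contour_integral (2 * pi * \<i> / fact n * (deriv ^^ n) g 0)) (circlepath 0 r)"
    using continuous_on_subset[OF cont sub] holomorphic_on_subset[OF g subset_trans[OF ball_subset_cball sub]] r
    by (intro Cauchy_has_contour_integral_higher_derivative_circlepath) auto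
  then have "((\<lambda>t. g (0 + of_real r * cis t) / (0 + of_real r * cis t - 0) ^ Suc n * of_real r * \<i> * cis t)
     has_integral (2 * pi * \<i> / fact n * (deriv ^^ n) g 0)) {0..2*pi}"
    unfolding circlepath_def by (subst (asm) has_contour_integral_part_circlepath_iff) auto
  \<comment> \<open>The factor turns \<open>dz / z\<^sup>n\<^sup>+\<^sup>1\<close> into \<open>cnj (z\<^sup>n) d\<theta>\<close>.\<close>
  then have "((\<lambda>t. (of_real (r ^ (2 * n)) / \<i>) *
        (g (0 + of_real r * cis t) / (0 + of_real r * cis t - 0) ^ Suc n * of_real r * \<i> * cis t))
     has_integral (of_real (r ^ (2 * n)) / \<i>) * (2 * pi * \<i> / fact n * (deriv ^^ n) g 0)) {0..2*pi}"
    by (rule has_integral_mult_right)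
  also have "(of_real (r ^ (2 * n)) / \<i>) * (2 * pi * \<i> / fact n * (deriv ^^ n) g 0)
      = of_real (2 * pi) * (of_real (r ^ (2 * n)) * b)"
    by (simp add: b_def field_simps)
  also have "(\<lambda>t. (of_real (r ^ (2 * n)) / \<i>) *
        (g (0 + of_real r * cis t) / (0 + of_real r * cis t - 0) ^ Suc n * of_real r * \<i> * cis t))
      = (\<lambda>t. g (of_real r * cis t) * cnj ((of_real r * cis t) ^ n))"
  proof
    fix t
    define w where "w = complex_of_real r * cis t"
    have w: "w \<noteq> 0" "of_real r * cis t = w" using r by (auto simp: w_def)
    have "w * cnj w = of_real (r\<^sup>2)"
      using r by (simp only: complex_norm_square[symmetric]) (simp add: w_def norm_mult)
    then have "complex_of_real (r ^ (2 * n)) = (w * cnj w) ^ n"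
      by (simp add: power_mult)
    then have "(of_real (r ^ (2 * n)) / \<i>) * (g w / w ^ Suc n * \<i> * w) = g w * cnj (w ^ n)"
      using w(1) by (simp add: field_simps)
    moreover have "x * of_real r * \<i> * cis t = x * \<i> * w" for x
      by (simp add: w_def mult_ac)
    ultimately show "(of_real (r ^ (2 * n)) / \<i>) *
        (g (0 + of_real r * cis t) / (0 + of_real r * cis t - 0) ^ Suc n * of_real r * \<i> * cis t)
      = g (of_real r * cis t) * cnj ((of_real r * cis t) ^ n)"
      by (simp only: w(2) add_0_left diff_0_right)
  qed
  finally have I: "((\<lambda>t. g (of_real r * cis t) * cnj ((of_real r * cis t) ^ n))
     has_integral of_real (2 * pi) * (of_real (r ^ (2 * n)) * b)) {0..2*pi}" .
  have "continuous_on UNIV (\<lambda>t. g (of_real r * cis t) * cnj ((of_real r * cis t) ^ n))"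
    using r by (intro continuous_intros continuous_on_compose2[OF cont]) (auto simp: norm_mult)
  from integral_angle_continuous[OF this I] show ?thesis by (simp add: b_def)
qed

text \<open>Integrating Cauchy's formula over the radii gives \<open>\<integral> t\<^sup>n dt = 1 / (n + 1)\<close> times the Taylor
  coefficient. Hence the orthogonal expansion of a Bergman function is its Taylor series.\<close>
lemma L2_inner_disc_monomial:
  assumes g: "g \<in> bergman_space"
  shows "L2_inner g (disc_monomial n) = (deriv ^^ n) g 0 / fact n / of_nat (n + 1)"
proof -
  define b where "b = (deriv ^^ n) g 0 / fact n"
  note gm[measurable] = bergman_space_measurable[OF g]
  define f where "f z = g z * cnj (disc_monomial n z)" for z
  have [measurable]: "f \<in> borel_measurable borel" unfolding f_def by measurable
  have "integrable disc_measure f"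
    unfolding f_def by (intro L2_integrable bergman_spaceD(1) g disc_monomial_bergman)
  then have int: "integrable polar_measure (\<lambda>(\<theta>, t). f (polar_map (\<theta>, t)))"
    by (subst (asm) integrable_disc_polar) (auto simp: split_def)
  have "L2_inner g (disc_monomial n) = (LINT z|disc_measure. f z)"
    by (simp add: L2_inner_def f_def)
  also have "\<dots> = (LINT p|polar_measure. f (polar_map p))"
    by (rule integral_disc_polar) simp
  also have "\<dots> = (LINT t|unit_interval_measure. LINT \<theta>|angle_measure. f (polar_map (\<theta>, t)))"
    using polar.integral_snd[OF int] by (simp add: split_def)
  also have "\<dots> = (LINT t|unit_interval_measure. of_real (t ^ n) * b)"
  proof (rule integral_cong_AE)
    have "(\<lambda>t. LINT \<theta>|angle_measure. f (polar_map (\<theta>, t))) \<in> borel_measurable borel"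
      by (intro angle.borel_measurable_lebesgue_integral) measurable
    then show "(\<lambda>t. LINT \<theta>|angle_measure. f (polar_map (\<theta>, t))) \<in> borel_measurable unit_interval_measure"
      by simp
    have "AE t in unit_interval_measure. 0 < t \<and> t < 1"
      unfolding unit_interval_measure_def
      by (intro AE_uniform_measureI eventually_mono[OF AE_lborel_singleton[of 0]]) auto
    then show "AE t in unit_interval_measure.
        (LINT \<theta>|angle_measure. f (polar_map (\<theta>, t))) = of_real (t ^ n) * b"
    proof eventually_elim
      fix t :: real assume t: "0 < t \<and> t < 1"
      define r where "r = sqrt t"
      have r: "0 < r" "r < 1" "r ^ (2 * n) = t ^ n" using t by (auto simp: r_def power_mult)
      have "f (polar_map (\<theta>, t)) = g (of_real r * cis \<theta>) * cnj ((of_real r * cis \<theta>) ^ n)" for \<theta>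
        using r by (simp add: f_def polar_map_def disc_monomial_def norm_mult r_def)
      then show "(LINT \<theta>|angle_measure. f (polar_map (\<theta>, t))) = of_real (t ^ n) * b"
        using circle_taylor_coefficient[OF bergman_spaceD(2)[OF g] r(1,2), of n]
        by (simp add: b_def r(3))
    qed
  qed simp
  also have "\<dots> = of_real (1 / real (n + 1)) * b"
    by (simp only: integral_mult_left_zero integral_complex_of_real integral_unit_interval_power)
  finally show ?thesis by (simp add: b_def)
qed

lemma taylor_coefficient_disc_monomial:
  "(deriv ^^ n) (disc_monomial m) 0 / fact n = (if m = n then 1 else 0)"
proof -
  have "(deriv ^^ n) (disc_monomial m) 0 = (deriv ^^ n) (\<lambda>w. (w - 0) ^ m) 0"
    by (rule higher_deriv_transform_within_open[of _ "ball 0 1"])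
       (auto simp: disc_monomial_def bergman_spaceD(2)[OF disc_monomial_bergman] intro!: holomorphic_intros)
  also have "\<dots> = pochhammer (of_nat (Suc m - n)) n * (0 - 0) ^ (m - n)"
    by (rule higher_deriv_power)
  also have "\<dots> / fact n = (if m = n then 1 else 0)"
    by (cases m n rule: linorder_cases) (auto simp: pochhammer_0_left pochhammer_fact[symmetric])
  finally show ?thesis .
qed

lemma bergman_basis_eq: "bergman_basis n = (\<lambda>z. of_real (sqrt (real n + 1)) * disc_monomial n z)"
  by (simp add: bergman_basis_def fun_eq_iff)

lemma bergman_basis_L2: "bergman_basis n \<in> L2_disc"
  unfolding bergman_basis_eq by (intro L2_disc_cmult bergman_spaceD(1) disc_monomial_bergman)

lemma bergman_basis_outside: "z \<notin> ball 0 1 \<Longrightarrow> bergman_basis n z = 0"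
  by (simp add: bergman_basis_def disc_monomial_def)

lemma sqrt_Suc_square: "complex_of_real (sqrt (real n + 1)) * of_real (sqrt (real n + 1)) = of_nat (n + 1)"
  by (simp flip: of_real_mult)

lemma L2_inner_bergman_basis:
  "L2_inner (bergman_basis m) (bergman_basis n) = (if m = n then 1 else 0)"
proof -
  have *: "L2_inner (disc_monomial m) (disc_monomial n) = (if m = n then 1 / of_nat (n + 1) else 0)"
    using L2_inner_disc_monomial[OF disc_monomial_bergman[of m], of n]
    unfolding taylor_coefficient_disc_monomial by auto
  show ?thesis
    unfolding bergman_basis_eq L2_inner_cmult_left L2_inner_cmult_right *
    using sqrt_Suc_square[of n] by (auto simp: field_simps)
qed

lemma norm_sum_bergman_basis:
  assumes "finite A"
  shows "(LINT z|disc_measure. (cmod (\<Sum>n\<in>A. c n * bergman_basis n z))\<^sup>2) = (\<Sum>n\<in>A. (cmod (c n))\<^sup>2)"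
proof -
  let ?S = "\<lambda>z. \<Sum>n\<in>A. c n * bergman_basis n z"
  have S: "?S \<in> L2_disc" by (intro L2_disc_sum bergman_basis_L2)
  have "of_real (LINT z|disc_measure. (cmod (?S z))\<^sup>2) = L2_inner ?S ?S"
    by (rule L2_inner_self[symmetric])
  also have "\<dots> = (\<Sum>n\<in>A. c n * (\<Sum>m\<in>A. cnj (c m) * (if n = m then 1 else 0)))"
    by (simp only: L2_inner_sum_left[OF bergman_basis_L2 S] L2_inner_sum_right[OF bergman_basis_L2 bergman_basis_L2]
        L2_inner_bergman_basis)
  also have "\<dots> = (\<Sum>n\<in>A. c n * cnj (c n))"
    using assms by (intro sum.cong refl) (simp add: if_distrib sum.delta cong: if_cong)
  also have "\<dots> = of_real (\<Sum>n\<in>A. (cmod (c n))\<^sup>2)"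
    by (simp only: complex_norm_square of_real_sum)
  finally show ?thesis by (simp only: of_real_eq_iff)
qed

lemma bessel_inequality:
  assumes f: "f \<in> L2_disc" and "finite A"
  shows "(\<Sum>n\<in>A. (cmod (L2_inner f (bergman_basis n)))\<^sup>2) \<le> (LINT z|disc_measure. (cmod (f z))\<^sup>2)"
proof -
  define c where "c n = L2_inner f (bergman_basis n)" for n
  define S where "S = (\<lambda>z. \<Sum>n\<in>A. c n * bergman_basis n z)"
  have S: "S \<in> L2_disc" unfolding S_def by (intro L2_disc_sum bergman_basis_L2)
  have fS: "L2_inner f S = (\<Sum>n\<in>A. of_real ((cmod (c n))\<^sup>2))"
    unfolding S_def L2_inner_sum_right[OF bergman_basis_L2 f]
    by (intro sum.cong refl) (simp only: c_def[symmetric] complex_norm_square mult.commute)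
  have SS: "L2_inner S S = (\<Sum>n\<in>A. of_real ((cmod (c n))\<^sup>2))"
    unfolding L2_inner_self S_def norm_sum_bergman_basis[OF \<open>finite A\<close>] by simp
  have Sf: "L2_inner S f = (\<Sum>n\<in>A. of_real ((cmod (c n))\<^sup>2))"
    by (subst L2_inner_commute) (simp add: fS)
  have d: "(\<lambda>z. f z - S z) \<in> L2_disc" by (rule L2_disc_diff[OF f S])
  have "of_real (LINT z|disc_measure. (cmod (f z - S z))\<^sup>2) = L2_inner (\<lambda>z. f z - S z) (\<lambda>z. f z - S z)"
    by (rule L2_inner_self[symmetric])
  also have "\<dots> = L2_inner f (\<lambda>z. f z - S z) - L2_inner S (\<lambda>z. f z - S z)"
    by (rule L2_inner_diff_left[OF f S d])
  also have "\<dots> = (L2_inner f f - L2_inner f S) - (L2_inner S f - L2_inner S S)"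
    by (simp only: L2_inner_diff_right[OF f S f] L2_inner_diff_right[OF f S S])
  also have "\<dots> = of_real ((LINT z|disc_measure. (cmod (f z))\<^sup>2) - (\<Sum>n\<in>A. (cmod (c n))\<^sup>2))"
    by (simp add: L2_inner_self[of f] fS SS Sf)
  finally have "(LINT z|disc_measure. (cmod (f z))\<^sup>2) - (\<Sum>n\<in>A. (cmod (c n))\<^sup>2)
      = (LINT z|disc_measure. (cmod (f z - S z))\<^sup>2)"
    by (simp only: of_real_eq_iff)
  moreover have "0 \<le> (LINT z|disc_measure. (cmod (f z - S z))\<^sup>2)"
    by (rule integral_nonneg_AE) simp
  ultimately have "(\<Sum>n\<in>A. (cmod (c n))\<^sup>2) \<le> (LINT z|disc_measure. (cmod (f z))\<^sup>2)"
    by linarith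
  then show ?thesis by (simp only: c_def)
qed

text \<open>By Fatou's lemma the distance from \<open>h\<close> to a partial sum is at most the lower limit of the distances
  between partial sums, that is, the tail of \<open>\<Sum> \<bar>c n\<bar>\<^sup>2\<close>.\<close>
lemma bergman_series_L2:
  assumes c: "summable (\<lambda>n. (cmod (c n))\<^sup>2)"
    and h: "\<And>z. (\<lambda>n. c n * bergman_basis n z) sums h z"
  shows "h \<in> L2_disc"
    and "(\<lambda>N. LINT z|disc_measure. (cmod (h z - (\<Sum>n<N. c n * bergman_basis n z)))\<^sup>2) \<longlonglongrightarrow> 0"
proof -
  define S where "S N z = (\<Sum>n<N. c n * bergman_basis n z)" for N z
  define T where "T N = (\<Sum>n. (cmod (c n))\<^sup>2) - (\<Sum>n<N. (cmod (c n))\<^sup>2)" for N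
  have S_L2: "S N \<in> L2_disc" for N unfolding S_def by (intro L2_disc_sum bergman_basis_L2)
  note [measurable] = L2_discD(1)[OF S_L2]
  have lim: "(\<lambda>N. S N z) \<longlonglongrightarrow> h z" for z
    using h[of z] by (simp add: sums_def S_def)
  have [measurable]: "h \<in> borel_measurable disc_measure"
    by (rule borel_measurable_LIMSEQ_metric[OF L2_discD(1)[OF S_L2] lim])
  have T: "T \<longlonglongrightarrow> 0"
    unfolding T_def
    using tendsto_diff[OF tendsto_const[of "\<Sum>n. (cmod (c n))\<^sup>2"] summable_LIMSEQ[OF c]] by simp
  have SS: "(\<integral>\<^sup>+z. ennreal ((cmod (S M z - S N z))\<^sup>2) \<partial>disc_measure) \<le> ennreal (T N)" if "N \<le> M" for N M
  proof -
    have eq: "S M z - S N z = (\<Sum>n\<in>{N..<M}. c n * bergman_basis n z)" for z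
      unfolding S_def using sum_diff_nat_ivl[of 0 N M "\<lambda>n. c n * bergman_basis n z"] that
      by (simp add: atLeast0LessThan)
    have "(\<integral>\<^sup>+z. ennreal ((cmod (S M z - S N z))\<^sup>2) \<partial>disc_measure)
        = ennreal (LINT z|disc_measure. (cmod (S M z - S N z))\<^sup>2)"
      by (intro nn_integral_eq_integral L2_discD(2) L2_disc_diff S_L2) auto
    also have "\<dots> = ennreal (\<Sum>n\<in>{N..<M}. (cmod (c n))\<^sup>2)"
      unfolding eq by (subst norm_sum_bergman_basis) auto
    also have "(\<Sum>n\<in>{N..<M}. (cmod (c n))\<^sup>2) = (\<Sum>n<M. (cmod (c n))\<^sup>2) - (\<Sum>n<N. (cmod (c n))\<^sup>2)"
      using sum_diff_nat_ivl[of 0 N M "\<lambda>n. (cmod (c n))\<^sup>2"] that by (simp add: atLeast0LessThan)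
    also have "\<dots> \<le> T N"
      unfolding T_def using sum_le_suminf[OF c, of "{..<M}"] by simp
    finally show ?thesis by (simp add: ennreal_leI)
  qed
  have bound: "(\<integral>\<^sup>+z. ennreal ((cmod (h z - S N z))\<^sup>2) \<partial>disc_measure) \<le> ennreal (T N)" for N
  proof -
    have "liminf (\<lambda>M. ennreal ((cmod (S M z - S N z))\<^sup>2)) = ennreal ((cmod (h z - S N z))\<^sup>2)" for z
      by (intro lim_imp_Liminf tendsto_ennrealI tendsto_intros lim) simp
    then have "(\<integral>\<^sup>+z. ennreal ((cmod (h z - S N z))\<^sup>2) \<partial>disc_measure)
      = (\<integral>\<^sup>+z. liminf (\<lambda>M. ennreal ((cmod (S M z - S N z))\<^sup>2)) \<partial>disc_measure)" by simp
    also have "\<dots> \<le> liminf (\<lambda>M. \<integral>\<^sup>+z. ennreal ((cmod (S M z - S N z))\<^sup>2) \<partial>disc_measure)"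
      by (rule nn_integral_liminf) measurable
    also have "\<dots> \<le> limsup (\<lambda>M. \<integral>\<^sup>+z. ennreal ((cmod (S M z - S N z))\<^sup>2) \<partial>disc_measure)"
      by (intro Liminf_le_Limsup) simp
    also have "\<dots> \<le> ennreal (T N)"
      by (intro Limsup_bounded eventually_sequentiallyI[of N] SS)
    finally show ?thesis .
  qed
  have int: "integrable disc_measure (\<lambda>z. (cmod (h z - S N z))\<^sup>2)" for N
    by (rule integrableI_nonneg) (auto intro: le_less_trans[OF bound])
  show "h \<in> L2_disc"
    using int[of 0] by (simp add: L2_disc_def S_def)
  have T0: "0 \<le> T N" for N
    unfolding T_def using sum_le_suminf[OF c, of "{..<N}"] by simp
  have "(LINT z|disc_measure. (cmod (h z - S N z))\<^sup>2) \<le> T N" for N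
    using bound[of N] T0[of N] nn_integral_eq_integral[OF int[of N]] by simp
  then have "(\<lambda>N. LINT z|disc_measure. (cmod (h z - S N z))\<^sup>2) \<longlonglongrightarrow> 0"
    by (rule_tac real_tendsto_sandwich[of "\<lambda>_. 0" _ _ T])
       (auto intro!: always_eventually integral_nonneg_AE T)
  then show "(\<lambda>N. LINT z|disc_measure. (cmod (h z - (\<Sum>n<N. c n * bergman_basis n z)))\<^sup>2) \<longlonglongrightarrow> 0"
    by (simp add: S_def)
qed

lemma L2_inner_bergman_series:
  assumes c: "summable (\<lambda>n. (cmod (c n))\<^sup>2)"
    and h: "\<And>z. (\<lambda>n. c n * bergman_basis n z) sums h z" and s: "s \<in> L2_disc"
  shows "(\<lambda>n. cnj (c n) * L2_inner s (bergman_basis n)) sums L2_inner s h"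
proof -
  note hL = bergman_series_L2[OF c h]
  define S where "S N z = (\<Sum>n<N. c n * bergman_basis n z)" for N z
  have S_L2: "S N \<in> L2_disc" for N unfolding S_def by (intro L2_disc_sum bergman_basis_L2)
  have "(\<lambda>N. L2_inner s (\<lambda>z. h z - S N z)) \<longlonglongrightarrow> 0"
    using hL(2) by (intro L2_inner_tendsto_0 s L2_disc_diff hL(1) S_L2) (simp add: S_def)
  moreover have "L2_inner s (\<lambda>z. h z - S N z) = L2_inner s h - (\<Sum>n<N. cnj (c n) * L2_inner s (bergman_basis n))" for N
  proof -
    have "L2_inner s (\<lambda>z. h z - S N z) = L2_inner s h - L2_inner s (S N)"
      by (rule L2_inner_diff_right[OF hL(1) S_L2 s])
    also have "L2_inner s (S N) = (\<Sum>n<N. cnj (c n) * L2_inner s (bergman_basis n))"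
      unfolding S_def by (rule L2_inner_sum_right[OF bergman_basis_L2 s])
    finally show ?thesis .
  qed
  ultimately have "(\<lambda>N. L2_inner s h - (\<Sum>n<N. cnj (c n) * L2_inner s (bergman_basis n))) \<longlonglongrightarrow> 0"
    by simp
  from tendsto_diff[OF tendsto_const[of "L2_inner s h"] this] show ?thesis
    by (simp add: sums_def)
qed

text \<open>Together with \<open>L2_inner_bergman_series\<close> this says that the monomials are total in the Bergman space:
  Bessel's inequality makes the coefficients square-summable, and the expansion converges pointwise
  because it is the Taylor series.\<close>
lemma bergman_expansion:
  assumes g: "g \<in> bergman_space"
  shows "summable (\<lambda>n. (cmod (L2_inner g (bergman_basis n)))\<^sup>2)"
    and "(\<lambda>n. L2_inner g (bergman_basis n) * bergman_basis n z) sums g z"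
proof -
  show "summable (\<lambda>n. (cmod (L2_inner g (bergman_basis n)))\<^sup>2)"
    using bessel_inequality[OF bergman_spaceD(1)[OF g], of "{..<n}" for n]
    by (intro summableI_nonneg_bounded) auto
  show "(\<lambda>n. L2_inner g (bergman_basis n) * bergman_basis n z) sums g z"
  proof (cases "z \<in> ball 0 1")
    case True
    have "L2_inner g (bergman_basis n) * bergman_basis n z = (deriv ^^ n) g 0 / fact n * (z - 0) ^ n" for n
    proof -
      have "L2_inner g (bergman_basis n) * bergman_basis n z
         = (of_real (sqrt (real n + 1)) * of_real (sqrt (real n + 1))) * (L2_inner g (disc_monomial n) * z ^ n)"
      proof -
        have "disc_monomial n z = z ^ n" using True by (simp add: disc_monomial_def)
        then show ?thesis by (simp only: bergman_basis_eq L2_inner_cmult_right) simp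
      qed
      also have "\<dots> = (deriv ^^ n) g 0 / fact n * (z - 0) ^ n"
        unfolding sqrt_Suc_square L2_inner_disc_monomial[OF g]
        by (simp add: field_simps del: of_nat_add of_nat_Suc)
      finally show ?thesis .
    qed
    then show ?thesis
      using holomorphic_power_series[OF bergman_spaceD(2)[OF g] True] by simp
  next
    case False
    then show ?thesis by (simp add: bergman_basis_outside bergman_spaceD(3)[OF g])
  qed
qed

lemma bergman_orthogonalI:
  assumes "s \<in> L2_disc" "\<And>n. L2_inner s (bergman_basis n) = 0" "g \<in> bergman_space"
  shows "L2_inner s g = 0"
  using L2_inner_bergman_series[OF bergman_expansion[OF assms(3)] assms(1)] assms(2)
    sums_unique2[OF _ sums_zero] by simp

lemma bergman_eqI:
  assumes "g \<in> bergman_space" "h \<in> bergman_space"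
    and "\<And>n. L2_inner g (bergman_basis n) = L2_inner h (bergman_basis n)"
  shows "g = h"
proof
  fix z show "g z = h z"
    using bergman_expansion(2)[OF assms(1), of z] bergman_expansion(2)[OF assms(2), of z]
    unfolding assms(3) by (rule sums_unique2)
qed

lemma bergman_basis_bergman: "bergman_basis n \<in> bergman_space"
  using disc_monomial_bergman[of n] L2_disc_cmult[of "disc_monomial n"]
  by (auto simp: bergman_space_def bergman_basis_eq intro!: holomorphic_intros)

text \<open>The projection is the series built from the Fourier coefficients of \<open>f\<close>. They are bounded, so the
  series is a power series that converges in the unit disc.\<close>
lemma bergman_projection_exists:
  assumes f: "f \<in> L2_disc"
  obtains h where "h \<in> bergman_space" "\<And>n. L2_inner h (bergman_basis n) = L2_inner f (bergman_basis n)"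
proof -
  define c where "c n = L2_inner f (bergman_basis n)" for n
  define B where "B = (LINT z|disc_measure. (cmod (f z))\<^sup>2)"
  have c: "summable (\<lambda>n. (cmod (c n))\<^sup>2)"
    unfolding c_def using bessel_inequality[OF f, of "{..<n}" for n]
    by (intro summableI_nonneg_bounded) auto
  \<comment> \<open>Bessel gives \<open>\<bar>c n\<bar>\<^sup>2 \<le> B\<close>, and \<open>x \<le> x\<^sup>2 + 1\<close> avoids a square root.\<close>
  have cB: "cmod (c n) \<le> B + 1" for n
  proof -
    have "(cmod (c n))\<^sup>2 \<le> B"
      using bessel_inequality[OF f, of "{n}"] by (simp add: B_def c_def)
    moreover have "2 * cmod (c n) \<le> (cmod (c n))\<^sup>2 + 1"
      using sum_squares_bound[of "cmod (c n)" 1] by simp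
    moreover have "0 \<le> (cmod (c n))\<^sup>2" by simp
    ultimately show ?thesis by linarith
  qed
  define h where "h z = (\<Sum>n. c n * bergman_basis n z)" for z
  have sq: "sqrt (real n + 1) \<le> real (Suc n)" for n
    by (rule real_le_lsqrt) (auto simp: power2_eq_square algebra_simps)
  have sums: "(\<lambda>n. c n * bergman_basis n z) sums h z" for z
  proof (cases "z \<in> ball 0 1")
    case True
    have sm: "summable (\<lambda>n. (B + 1) * (real (Suc n) * cmod z ^ n))"
      using True geometric_deriv_sums[of "cmod z"] by (intro summable_mult) (auto simp: sums_iff)
    have "norm (c n * bergman_basis n z) \<le> (B + 1) * (real (Suc n) * cmod z ^ n)" for n
      using True sq[of n] order_trans[OF norm_ge_zero cB[of n]]
      by (simp add: norm_mult bergman_basis_def disc_monomial_def norm_power del: of_nat_Suc)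
         (intro mult_mono cB, auto simp del: of_nat_Suc)
    then have "summable (\<lambda>n. c n * bergman_basis n z)"
      by (rule summable_comparison_test'[OF sm])
    then show ?thesis by (simp add: h_def summable_sums)
  next
    case False
    then show ?thesis by (simp add: h_def bergman_basis_outside)
  qed
  have "h holomorphic_on ball 0 1"
  proof (rule power_series_holomorphic)
    fix w :: complex assume "w \<in> ball 0 1"
    then show "(\<lambda>n. (c n * of_real (sqrt (real n + 1))) * (w - 0) ^ n) sums h w"
      using sums[of w] by (simp add: bergman_basis_def disc_monomial_def mult_ac)
  qed
  moreover have "h z = 0" if "z \<notin> ball 0 1" for z
    using that by (simp add: h_def bergman_basis_outside)
  ultimately have h: "h \<in> bergman_space"
    using bergman_series_L2(1)[OF c sums] by (simp add: bergman_space_def)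
  have "L2_inner h (bergman_basis m) = c m" for m
  proof -
    have "(\<lambda>n. cnj (c n) * L2_inner (bergman_basis m) (bergman_basis n)) sums L2_inner (bergman_basis m) h"
      by (rule L2_inner_bergman_series[OF c sums bergman_basis_L2])
    moreover have "(\<lambda>n. cnj (c n) * L2_inner (bergman_basis m) (bergman_basis n)) sums cnj (c m)"
    proof -
      have "(\<lambda>n. cnj (c n) * L2_inner (bergman_basis m) (bergman_basis n))
          = (\<lambda>n. if n = m then cnj (c n) else 0)"
        by (auto simp: L2_inner_bergman_basis)
      then show ?thesis using sums_single[of m "\<lambda>n. cnj (c n)"] by simp
    qed
    ultimately have "L2_inner (bergman_basis m) h = cnj (c m)" by (rule sums_unique2)
    then show ?thesis by (subst L2_inner_commute) simp
  qed
  with h that show thesis by (simp add: c_def)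
qed

text \<open>Orthogonality to the whole Bergman space amounts to orthogonality to the basis, and a Bergman
  function is determined by its coefficients. So the description defining the projection has exactly one
  solution.\<close>
lemma orth_proj_bergman:
  assumes f: "f \<in> L2_disc"
  shows "orth_proj bergman_space f \<in> bergman_space"
    and "L2_inner (orth_proj bergman_space f) (bergman_basis n) = L2_inner f (bergman_basis n)"
proof -
  have iff: "(\<forall>g\<in>bergman_space. L2_inner (\<lambda>z. f z - h z) g = 0)
      \<longleftrightarrow> (\<forall>n. L2_inner h (bergman_basis n) = L2_inner f (bergman_basis n))"
    if h: "h \<in> bergman_space" for h
  proof
    note hL = bergman_spaceD(1)[OF h]
    have eq: "L2_inner (\<lambda>z. f z - h z) (bergman_basis n) = L2_inner f (bergman_basis n) - L2_inner h (bergman_basis n)" for n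
      by (rule L2_inner_diff_left[OF f hL bergman_basis_L2])
    show "\<forall>n. L2_inner h (bergman_basis n) = L2_inner f (bergman_basis n)"
      if "\<forall>g\<in>bergman_space. L2_inner (\<lambda>z. f z - h z) g = 0"
      using that bergman_basis_bergman eq by simp
    show "\<forall>g\<in>bergman_space. L2_inner (\<lambda>z. f z - h z) g = 0"
      if "\<forall>n. L2_inner h (bergman_basis n) = L2_inner f (bergman_basis n)"
    proof
      fix g assume g: "g \<in> bergman_space"
      show "L2_inner (\<lambda>z. f z - h z) g = 0"
        by (rule bergman_orthogonalI[OF L2_disc_diff[OF f hL] _ g]) (simp add: eq that)
    qed
  qed
  obtain h where h: "h \<in> bergman_space" "\<And>n. L2_inner h (bergman_basis n) = L2_inner f (bergman_basis n)"
    using bergman_projection_exists[OF f] by blast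
  have "orth_proj bergman_space f = h"
    unfolding orth_proj_def
  proof (rule the_equality)
    show "h \<in> bergman_space \<and> (\<forall>g\<in>bergman_space. L2_inner (\<lambda>z. f z - h z) g = 0)"
      using h iff by simp
    show "h' = h" if "h' \<in> bergman_space \<and> (\<forall>g\<in>bergman_space. L2_inner (\<lambda>z. f z - h' z) g = 0)" for h'
      using that iff[of h'] h by (intro bergman_eqI) auto
  qed
  with h show "orth_proj bergman_space f \<in> bergman_space"
    "L2_inner (orth_proj bergman_space f) (bergman_basis n) = L2_inner f (bergman_basis n)" by auto
qed

lemma orth_proj_span:
  fixes b :: "'i \<Rightarrow> complex \<Rightarrow> complex"
  assumes I: "finite I" and b: "\<And>i. i \<in> I \<Longrightarrow> b i \<in> L2_disc"
    and on: "\<And>i j. i \<in> I \<Longrightarrow> j \<in> I \<Longrightarrow> L2_inner (b i) (b j) = (if i = j then 1 else 0)"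
    and V: "V = {f. \<exists>c. f = (\<lambda>z. \<Sum>i\<in>I. c i * b i z)}" and f: "f \<in> L2_disc"
  shows "orth_proj V f = (\<lambda>z. \<Sum>i\<in>I. L2_inner f (b i) * b i z)"
  unfolding orth_proj_def
proof (rule the_equality)
  have coeff: "L2_inner (\<lambda>z. \<Sum>i\<in>I. c i * b i z) (b j) = c j" if "j \<in> I" for c j
  proof -
    have "L2_inner (\<lambda>z. \<Sum>i\<in>I. c i * b i z) (b j) = (\<Sum>i\<in>I. c i * L2_inner (b i) (b j))"
      by (rule L2_inner_sum_left) (use b that in auto)
    also have "\<dots> = (\<Sum>i\<in>I. if i = j then c j else 0)"
      using that by (intro sum.cong) (auto simp: on)
    finally show ?thesis using that I by simp
  qed
  let ?h = "\<lambda>z. \<Sum>i\<in>I. L2_inner f (b i) * b i z"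
  have hL: "(\<lambda>z. \<Sum>i\<in>I. c i * b i z) \<in> L2_disc" for c by (intro L2_disc_sum b)
  have orth: "L2_inner (\<lambda>z. f z - ?h z) (b j) = 0" if "j \<in> I" for j
    using that by (simp add: L2_inner_diff_left[OF f hL b] coeff)
  show "?h \<in> V \<and> (\<forall>g\<in>V. L2_inner (\<lambda>z. f z - ?h z) g = 0)"
  proof (intro conjI ballI)
    show "?h \<in> V" unfolding V by (intro CollectI exI[of _ "\<lambda>i. L2_inner f (b i)"] refl)
    fix g assume "g \<in> V"
    then obtain c where g: "g = (\<lambda>z. \<Sum>i\<in>I. c i * b i z)" unfolding V by blast
    show "L2_inner (\<lambda>z. f z - ?h z) g = 0"
      unfolding g by (subst L2_inner_sum_right) (auto intro: b L2_disc_diff f hL simp: orth)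
  qed
  fix h assume h: "h \<in> V \<and> (\<forall>g\<in>V. L2_inner (\<lambda>z. f z - h z) g = 0)"
  then obtain c where c: "h = (\<lambda>z. \<Sum>i\<in>I. c i * b i z)" unfolding V by blast
  have "c j = L2_inner f (b j)" if j: "j \<in> I" for j
  proof -
    have "b j = (\<lambda>z. \<Sum>i\<in>I. (if i = j then 1 else 0) * b i z)"
      using I j by (auto simp: if_distrib if_distribR sum.delta cong: if_cong)
    then have "b j \<in> V" unfolding V mem_Collect_eq by (rule exI[of _ "\<lambda>i. if i = j then 1 else 0"])
    with h have "L2_inner (\<lambda>z. f z - h z) (b j) = 0" by blast
    then show ?thesis
      unfolding c using j by (simp add: L2_inner_diff_left[OF f hL b] coeff)
  qed
  then show "h = ?h" unfolding c by (intro ext sum.cong) auto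
qed

section \<open>Spectral theorem for Hermitian matrices\<close>
text \<open>Gaussian elimination: a pivot in the last equation is used to eliminate one unknown.\<close>
lemma homogeneous_system_nontrivial:
  fixes M :: "'k \<Rightarrow> nat \<Rightarrow> 'a::field"
  assumes "finite K" "n < card K"
  shows "\<exists>c. (\<exists>k\<in>K. c k \<noteq> 0) \<and> (\<forall>i<n. (\<Sum>k\<in>K. c k * M k i) = 0)"
  using assms
proof (induction n arbitrary: K M)
  case 0
  then have "K \<noteq> {}" by auto
  then show ?case by (intro exI[of _ "\<lambda>_. 1"]) auto
next
  case (Suc n)
  show ?case
  proof (cases "\<forall>k\<in>K. M k n = 0")
    case True
    obtain c where "\<exists>k\<in>K. c k \<noteq> 0" "\<forall>i<n. (\<Sum>k\<in>K. c k * M k i) = 0"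
      using Suc.IH[of K M] Suc.prems by auto
    with True show ?thesis by (intro exI[of _ c]) (auto simp: less_Suc_eq)
  next
    case False
    then obtain k0 where k0: "k0 \<in> K" "M k0 n \<noteq> 0" by blast
    define K' where "K' = K - {k0}"
    define M' where "M' k i = M k i - M k n / M k0 n * M k0 i" for k i
    have "finite K'" "n < card K'" using Suc.prems k0 by (auto simp: K'_def)
    from Suc.IH[OF this, of M'] obtain c
      where c: "\<exists>k\<in>K'. c k \<noteq> 0" "\<And>i. i < n \<Longrightarrow> (\<Sum>k\<in>K'. c k * M' k i) = 0" by blast
    define d where "d = (\<Sum>k\<in>K'. c k * M k n) / M k0 n"
    define c' where "c' = c(k0 := - d)"
    have split: "(\<Sum>k\<in>K. c' k * M k i) = (\<Sum>k\<in>K'. c k * M k i) - d * M k0 i" for i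
    proof -
      have "(\<Sum>k\<in>K. c' k * M k i) = c' k0 * M k0 i + (\<Sum>k\<in>K'. c' k * M k i)"
        unfolding K'_def using Suc.prems k0 by (intro sum.remove) auto
      also have "(\<Sum>k\<in>K'. c' k * M k i) = (\<Sum>k\<in>K'. c k * M k i)"
        by (intro sum.cong) (auto simp: c'_def K'_def)
      finally show ?thesis by (simp add: c'_def)
    qed
    have "(\<Sum>k\<in>K'. c k * M' k i) = (\<Sum>k\<in>K'. c k * M k i) - d * M k0 i" for i
      unfolding M'_def d_def
      by (simp add: right_diff_distrib sum_subtractf sum_divide_distrib sum_distrib_right mult.assoc)
    then have "(\<Sum>k\<in>K. c' k * M k i) = 0" if "i < n" for i
      using c(2)[OF that] split by simp
    moreover have "(\<Sum>k\<in>K. c' k * M k n) = 0"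
      unfolding split using k0(2) by (simp add: d_def)
    moreover have "\<exists>k\<in>K. c' k \<noteq> 0"
      using c(1) by (auto simp: c'_def K'_def)
    ultimately show ?thesis by (intro exI[of _ c']) (auto simp: less_Suc_eq)
  qed
qed

locale hermitian_matrix =
  fixes a :: "nat \<Rightarrow> nat \<Rightarrow> complex" and n :: nat
  assumes hermitian: "i < n \<Longrightarrow> j < n \<Longrightarrow> a j i = cnj (a i j)"
begin

definition ip :: "(nat \<Rightarrow> complex) \<Rightarrow> (nat \<Rightarrow> complex) \<Rightarrow> complex" where
  "ip x y = (\<Sum>i<n. x i * cnj (y i))"

definition vec :: "(nat \<Rightarrow> complex) set" where
  "vec = {x. \<forall>i\<ge>n. x i = 0}"

definition act :: "(nat \<Rightarrow> complex) \<Rightarrow> nat \<Rightarrow> complex" where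
  "act x i = (if i < n then \<Sum>j<n. a i j * x j else 0)"

lemma ip_commute: "ip y x = cnj (ip x y)"
  by (simp add: ip_def mult.commute)

lemma ip_sum_left: "ip (\<lambda>i. \<Sum>k\<in>K. c k * f k i) y = (\<Sum>k\<in>K. c k * ip (f k) y)"
proof -
  have "ip (\<lambda>i. \<Sum>k\<in>K. c k * f k i) y = (\<Sum>i<n. \<Sum>k\<in>K. c k * (f k i * cnj (y i)))"
    by (simp add: ip_def sum_distrib_right mult.assoc)
  also have "\<dots> = (\<Sum>k\<in>K. \<Sum>i<n. c k * (f k i * cnj (y i)))" by (rule sum.swap)
  finally show ?thesis by (simp add: ip_def sum_distrib_left)
qed

lemma ip_diff_left: "ip (\<lambda>i. x i - x' i) y = ip x y - ip x' y"
  by (simp add: ip_def left_diff_distrib sum_subtractf)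

lemma ip_scale_left: "ip (\<lambda>i. c * x i) y = c * ip x y"
  by (simp add: ip_def sum_distrib_left mult.assoc)

lemma ip_scale_right: "ip x (\<lambda>i. c * y i) = cnj c * ip x y"
  by (simp add: ip_def sum_distrib_left mult_ac)

lemma ip_self: "ip x x = of_real (\<Sum>i<n. (cmod (x i))\<^sup>2)"
  by (simp only: ip_def of_real_sum complex_norm_square)

lemma ip_self_eq_0: "x \<in> vec \<Longrightarrow> ip x x = 0 \<longleftrightarrow> x = (\<lambda>_. 0)"
proof
  assume x: "x \<in> vec" and "ip x x = 0"
  then have "(\<Sum>i<n. (cmod (x i))\<^sup>2) = 0" by (simp only: ip_self of_real_eq_0_iff)
  then have "\<forall>i<n. x i = 0" by (subst (asm) sum_nonneg_eq_0_iff) auto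
  with x show "x = (\<lambda>_. 0)" by (auto simp: vec_def) (metis not_less)
qed (simp add: ip_def)

lemma act_self_adjoint: "ip (act x) y = ip x (act y)"
proof -
  have "ip (act x) y = (\<Sum>i<n. \<Sum>j<n. a i j * x j * cnj (y i))"
    by (simp add: ip_def act_def sum_distrib_right)
  also have "\<dots> = (\<Sum>j<n. \<Sum>i<n. a i j * x j * cnj (y i))" by (rule sum.swap)
  also have "\<dots> = (\<Sum>j<n. \<Sum>i<n. x j * cnj (a j i * y i))"
  proof (intro sum.cong refl)
    fix j i assume "j \<in> {..<n}" "i \<in> {..<n}"
    then have "a i j = cnj (a j i)" by (intro hermitian) auto
    then show "a i j * x j * cnj (y i) = x j * cnj (a j i * y i)" by simp
  qed
  also have "\<dots> = ip x (act y)"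
    by (simp add: ip_def act_def sum_distrib_left)
  finally show ?thesis .
qed

lemma act_vec: "act x \<in> vec"
  by (simp add: act_def vec_def)

lemma act_sum: "act (\<lambda>i. \<Sum>k\<in>K. c k * f k i) = (\<lambda>i. \<Sum>k\<in>K. c k * act (f k) i)"
proof
  fix i
  have "(\<Sum>j<n. a i j * (\<Sum>k\<in>K. c k * f k j)) = (\<Sum>j<n. \<Sum>k\<in>K. c k * (a i j * f k j))"
    by (simp add: sum_distrib_left mult_ac)
  also have "\<dots> = (\<Sum>k\<in>K. \<Sum>j<n. c k * (a i j * f k j))" by (rule sum.swap)
  finally show "act (\<lambda>i. \<Sum>k\<in>K. c k * f k i) i = (\<Sum>k\<in>K. c k * act (f k) i)"
    by (simp add: act_def sum_distrib_left)
qed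

text \<open>The vector \<open>p(A) v\<close> for the operator \<open>A\<close> given by the matrix.\<close>
definition poly_act :: "complex poly \<Rightarrow> (nat \<Rightarrow> complex) \<Rightarrow> nat \<Rightarrow> complex" where
  "poly_act p v i = (\<Sum>k\<le>degree p. coeff p k * (act ^^ k) v i)"

lemma poly_act_bound:
  assumes "degree p \<le> m"
  shows "poly_act p v i = (\<Sum>k\<le>m. coeff p k * (act ^^ k) v i)"
  unfolding poly_act_def using assms
  by (intro sum.mono_neutral_left) (auto simp: coeff_eq_0)

lemma poly_act_linear_factor:
  "poly_act ([:- z, 1:] * q) v i = act (poly_act q v) i - z * poly_act q v i"
proof -
  let ?m = "degree q"
  have e: "[:- z, 1:] * q = pCons 0 q - smult z q" by simp
  have "degree (pCons 0 q - smult z q) \<le> Suc ?m"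
    by (intro degree_diff_le order_trans[OF degree_pCons_le] order_trans[OF degree_smult_le]) auto
  then have "poly_act ([:- z, 1:] * q) v i
      = (\<Sum>k\<le>Suc ?m. coeff (pCons 0 q - smult z q) k * (act ^^ k) v i)"
    unfolding e by (rule poly_act_bound)
  also have "\<dots> = (\<Sum>k\<le>Suc ?m. coeff (pCons 0 q) k * (act ^^ k) v i)
      - z * (\<Sum>k\<le>Suc ?m. coeff q k * (act ^^ k) v i)"
    by (simp add: left_diff_distrib sum_subtractf sum_distrib_left mult.assoc del: sum.atMost_Suc)
  also have "(\<Sum>k\<le>Suc ?m. coeff q k * (act ^^ k) v i) = poly_act q v i"
    by (rule poly_act_bound[symmetric]) simp
  also have "(\<Sum>k\<le>Suc ?m. coeff (pCons 0 q) k * (act ^^ k) v i)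
      = (\<Sum>k\<le>?m. coeff q k * act ((act ^^ k) v) i)"
    by (subst sum.atMost_Suc_shift) simp
  also have "\<dots> = act (poly_act q v) i"
    using act_sum[where K = "{..?m}" and c = "coeff q" and f = "\<lambda>k. (act ^^ k) v"] by (simp add: poly_act_def[abs_def])
  finally show ?thesis .
qed

text \<open>The \<open>n + 1\<close> iterates of \<open>v\<close> under the matrix \<open>A\<close> are dependent, so \<open>p(A) v = 0\<close> for some nonzero
  polynomial \<open>p\<close>. A linear factor \<open>x - z\<close> is split off \<open>p\<close>: either the remaining factor already
  annihilates \<open>v\<close>, or it maps \<open>v\<close> to an eigenvector for \<open>z\<close>.\<close>
lemma invariant_subspace_eigenvector:
  assumes W: "W \<subseteq> vec" "\<And>x. x \<in> W \<Longrightarrow> act x \<in> W"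
    "\<And>K (c :: nat \<Rightarrow> complex) f. finite K \<Longrightarrow> (\<And>k. k \<in> K \<Longrightarrow> f k \<in> W) \<Longrightarrow> (\<lambda>i. \<Sum>k\<in>K. c k * f k i) \<in> W"
    and v: "v \<in> W" "v \<noteq> (\<lambda>_. 0)"
  obtains x \<mu> where "x \<in> W" "x \<noteq> (\<lambda>_. 0)" "act x = (\<lambda>i. \<mu> * x i)"
proof -
  have iter: "(act ^^ k) v \<in> W" for k
    by (induction k) (auto intro: v W)
  have pW: "poly_act q v \<in> W" for q
    unfolding poly_act_def[abs_def] by (intro W(3) iter) simp
  have *: "\<exists>x\<in>W. x \<noteq> (\<lambda>_. 0) \<and> (\<exists>\<mu>. act x = (\<lambda>i. \<mu> * x i))"
    if "p \<noteq> 0" "poly_act p v = (\<lambda>_. 0)" for p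
    using that
  proof (induction "degree p" arbitrary: p)
    case 0
    then obtain c where "p = [:c:]" "c \<noteq> 0" by (metis degree_eq_zeroE pCons_eq_0_iff)
    with 0 v(2) have False by (auto simp: poly_act_def[abs_def] fun_eq_iff)
    then show ?case ..
  next
    case (Suc d)
    then have "\<not> constant (poly p)" by (simp add: constant_degree)
    then obtain z where "poly p z = 0" using fundamental_theorem_of_algebra by blast
    then obtain q where q: "p = [:- z, 1:] * q" by (auto simp: poly_eq_0_iff_dvd)
    have "q \<noteq> 0" using Suc.prems q by auto
    then have "degree p = Suc (degree q)" unfolding q by (subst degree_mult_eq) auto
    then have d: "d = degree q" using Suc.hyps(2) by simp
    show ?case
    proof (cases "poly_act q v = (\<lambda>_. 0)")
      case True
      then show ?thesis using Suc.hyps(1)[OF d \<open>q \<noteq> 0\<close>] by simp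
    next
      case False
      have "act (poly_act q v) = (\<lambda>i. z * poly_act q v i)"
      proof
        fix i
        have "poly_act p v i = 0" using Suc.prems(2) by simp
        then show "act (poly_act q v) i = z * poly_act q v i"
          unfolding q poly_act_linear_factor by simp
      qed
      with False pW show ?thesis by blast
    qed
  qed
  obtain c where c: "\<exists>k\<in>{..n}. c k \<noteq> 0" "\<And>i. i < n \<Longrightarrow> (\<Sum>k\<in>{..n}. c k * (act ^^ k) v i) = 0"
    using homogeneous_system_nontrivial[of "{..n}" n "\<lambda>k. (act ^^ k) v"] by auto
  define p where "p = (\<Sum>k\<le>n. monom (c k) k)"
  have coeff: "coeff p k = (if k \<le> n then c k else 0)" for k
    by (simp add: p_def coeff_sum)
  have "degree p \<le> n" by (rule degree_le) (simp add: coeff)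
  then have pv: "poly_act p v i = (\<Sum>k\<le>n. c k * (act ^^ k) v i)" for i
    by (subst poly_act_bound) (auto simp: coeff)
  have "poly_act p v i = 0" for i
  proof (cases "i < n")
    case False
    then show ?thesis using pW[of p] W(1) by (auto simp: vec_def)
  qed (simp add: pv c)
  moreover have "p \<noteq> 0" using c(1) coeff by (metis atMost_iff coeff_0)
  ultimately show thesis using *[of p] that by auto
qed

lemma eigenvalue_real:
  assumes "x \<in> vec" "x \<noteq> (\<lambda>_. 0)" "act x = (\<lambda>i. \<mu> * x i)"
  shows "\<mu> = of_real (Re \<mu>)"
proof -
  have "\<mu> * ip x x = ip (act x) x" by (simp add: assms(3) ip_scale_left)
  also have "\<dots> = ip x (act x)" by (rule act_self_adjoint)
  also have "\<dots> = cnj \<mu> * ip x x" by (simp add: assms(3) ip_scale_right)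
  finally have "\<mu> = cnj \<mu>" using ip_self_eq_0[OF assms(1)] assms(2) by simp
  then have "\<mu> \<in> \<real>" by (simp add: Reals_cnj_iff)
  then show ?thesis by (simp add: complex_is_Real_iff complex_eq_iff)
qed

definition orthonormal_eigenvectors :: "nat \<Rightarrow> (nat \<Rightarrow> nat \<Rightarrow> complex) \<Rightarrow> (nat \<Rightarrow> real) \<Rightarrow> bool" where
  "orthonormal_eigenvectors k u l \<longleftrightarrow>
     (\<forall>p<k. u p \<in> vec \<and> act (u p) = (\<lambda>i. of_real (l p) * u p i)) \<and>
     (\<forall>p<k. \<forall>q<k. ip (u p) (u q) = (if p = q then 1 else 0))"

lemma orthonormal_eigenvectors_le:
  assumes "orthonormal_eigenvectors k u l" shows "k \<le> n"
proof (rule ccontr)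
  assume "\<not> k \<le> n"
  then obtain c where c: "\<exists>p\<in>{..<k}. c p \<noteq> 0" "\<And>i. i < n \<Longrightarrow> (\<Sum>p\<in>{..<k}. c p * u p i) = 0"
    using homogeneous_system_nontrivial[of "{..<k}" n u] by auto
  then obtain q where q: "q < k" "c q \<noteq> 0" by auto
  have "0 = ip (\<lambda>i. \<Sum>p<k. c p * u p i) (u q)"
    unfolding ip_def by (intro sum.neutral[symmetric]) (simp add: c(2))
  also have "\<dots> = (\<Sum>p<k. c p * (if p = q then 1 else 0))"
    unfolding ip_sum_left using assms q by (intro sum.cong) (auto simp: orthonormal_eigenvectors_def)
  also have "\<dots> = c q" using q by (simp add: if_distrib sum.delta cong: if_cong)
  finally show False using q by simp
qed

text \<open>The orthogonal complement of a family of eigenvectors is invariant. Were it nonzero, it would contain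
  an eigenvector that extends the family.\<close>
lemma maximal_eigenvectors_complete:
  assumes u: "orthonormal_eigenvectors k u l"
    and max: "\<And>u l. \<not> orthonormal_eigenvectors (Suc k) u l"
    and v: "v \<in> vec"
  shows "v = (\<lambda>i. \<Sum>p<k. ip v (u p) * u p i)"
proof (rule ccontr)
  assume neq: "v \<noteq> (\<lambda>i. \<Sum>p<k. ip v (u p) * u p i)"
  have uv: "u p \<in> vec" "act (u p) = (\<lambda>i. of_real (l p) * u p i)"
      "q < k \<Longrightarrow> ip (u p) (u q) = (if p = q then 1 else 0)" if "p < k" for p q
    using u that by (auto simp: orthonormal_eigenvectors_def)
  define W where "W = {x \<in> vec. \<forall>p<k. ip x (u p) = 0}"
  define w where "w i = v i - (\<Sum>p<k. ip v (u p) * u p i)" for i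
  have wW: "w \<in> W"
  proof -
    have "ip w (u q) = 0" if "q < k" for q
    proof -
      have "ip w (u q) = ip v (u q) - (\<Sum>p<k. ip v (u p) * ip (u p) (u q))"
        unfolding w_def by (simp add: ip_diff_left ip_sum_left)
      also have "(\<Sum>p<k. ip v (u p) * ip (u p) (u q)) = (\<Sum>p<k. if p = q then ip v (u q) else 0)"
        using that by (intro sum.cong) (auto simp: uv)
      finally show ?thesis using that by simp
    qed
    moreover have "w \<in> vec" using v uv(1) by (auto simp: w_def vec_def)
    ultimately show ?thesis by (simp add: W_def)
  qed
  have w0: "w \<noteq> (\<lambda>_. 0)" using neq by (auto simp: w_def fun_eq_iff)
  have Wact: "act x \<in> W" if "x \<in> W" for x
    using that uv(2) by (auto simp: W_def act_vec act_self_adjoint ip_scale_right)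
  have Wsum: "(\<lambda>i. \<Sum>k\<in>K. c k * f k i) \<in> W" if "\<And>k. k \<in> K \<Longrightarrow> f k \<in> W"
    for K :: "nat set" and c f
    using that by (auto simp: W_def vec_def ip_sum_left)
  have Wv: "W \<subseteq> vec" by (auto simp: W_def)
  obtain x \<mu> where x: "x \<in> W" "x \<noteq> (\<lambda>_. 0)" "act x = (\<lambda>i. \<mu> * x i)"
    using invariant_subspace_eigenvector[OF Wv Wact Wsum wW w0] by blast
  have xv: "x \<in> vec" using x(1) by (simp add: W_def)
  define s where "s = sqrt (\<Sum>i<n. (cmod (x i))\<^sup>2)"
  have s2: "ip x x = of_real (s * s)"
    unfolding ip_self s_def by (simp add: sum_nonneg)
  have s0: "s \<noteq> 0" using s2 ip_self_eq_0[OF xv] x(2) by auto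
  define y where "y i = of_real (1 / s) * x i" for i
  have y: "y \<in> vec" "ip y y = 1" "\<And>p. p < k \<Longrightarrow> ip y (u p) = 0"
    using xv s0 x(1) s2 unfolding y_def[abs_def] ip_scale_left ip_scale_right by (auto simp: vec_def W_def)
  have yu: "ip (u p) y = 0" if "p < k" for p
    using y(3)[OF that] by (subst ip_commute) simp
  have "act y i = of_real (Re \<mu>) * y i" for i
  proof -
    have "act y = (\<lambda>i. of_real (1 / s) * act x i)"
      using act_sum[where K = "{0::nat}" and c = "\<lambda>_. of_real (1 / s)" and f = "\<lambda>_. x"] by (simp add: y_def[abs_def])
    then have "act y i = \<mu> * y i" by (simp add: x(3) y_def)
    then show ?thesis
      using arg_cong[OF eigenvalue_real[OF xv x(2,3)], of "\<lambda>m. m * y i"] by (rule trans)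
  qed
  then have "orthonormal_eigenvectors (Suc k) (u(k := y)) (l(k := Re \<mu>))"
    using y yu uv unfolding orthonormal_eigenvectors_def by (auto simp: less_Suc_eq fun_eq_iff)
  with max show False by blast
qed

text \<open>Completeness of a maximal orthonormal family of eigenvectors is the orthonormality of the columns.
  Counting the squared entries by rows and by columns shows that the family has exactly \<open>n\<close> members.\<close>
theorem spectral_theorem:
  obtains u l where
    "\<And>p i. p < n \<Longrightarrow> i < n \<Longrightarrow> (\<Sum>j<n. a i j * u p j) = of_real (l p) * u p i"
    "\<And>p q. p < n \<Longrightarrow> q < n \<Longrightarrow> (\<Sum>i<n. u p i * cnj (u q i)) = (if p = q then 1 else 0)"
    "\<And>i j. i < n \<Longrightarrow> j < n \<Longrightarrow> (\<Sum>p<n. u p i * cnj (u p j)) = (if i = j then 1 else 0)"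
proof -
  have "\<exists>k. (\<exists>u l. orthonormal_eigenvectors k u l) \<and> \<not> (\<exists>u l. orthonormal_eigenvectors (Suc k) u l)"
  proof (rule ccontr)
    assume *: "\<not> ?thesis"
    have "\<exists>u l. orthonormal_eigenvectors k u l" for k
    proof (induction k)
      case 0 show ?case by (simp add: orthonormal_eigenvectors_def)
    next
      case (Suc k) with * show ?case by blast
    qed
    from this[of "Suc n"] show False using orthonormal_eigenvectors_le by fastforce
  qed
  then obtain k u l where u: "orthonormal_eigenvectors k u l"
    and max: "\<And>u l. \<not> orthonormal_eigenvectors (Suc k) u l" by blast
  have cols: "(\<Sum>p<k. u p i * cnj (u p j)) = (if i = j then 1 else 0)" if "i < n" "j < n" for i j
  proof -
    define e where "e i = (if i = j then 1 else 0 :: complex)" for i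
    have "e \<in> vec" using that by (simp add: e_def vec_def)
    from maximal_eigenvectors_complete[OF u max this]
    have "e i = (\<Sum>p<k. ip e (u p) * u p i)" by (simp add: fun_eq_iff)
    moreover have "ip e (u p) = cnj (u p j)" for p
      using that by (simp add: ip_def e_def if_distrib if_distribR sum.delta cong: if_cong)
    ultimately show ?thesis by (simp add: e_def mult.commute)
  qed
  have "of_nat k = (\<Sum>p<k. ip (u p) (u p))"
    using u by (simp add: orthonormal_eigenvectors_def)
  also have "\<dots> = (\<Sum>i<n. \<Sum>p<k. u p i * cnj (u p i))"
    unfolding ip_def by (rule sum.swap)
  also have "\<dots> = of_nat n" by (simp add: cols)
  finally have "k = n" by simp
  show thesis
  proof (rule that[of u l])
    fix p i assume "p < n" "i < n"
    then have "act (u p) i = of_real (l p) * u p i"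
      using u \<open>k = n\<close> by (simp add: orthonormal_eigenvectors_def)
    then show "(\<Sum>j<n. a i j * u p j) = of_real (l p) * u p i" using \<open>i < n\<close> by (simp add: act_def)
  next
    fix p q assume "p < n" "q < n"
    then show "(\<Sum>i<n. u p i * cnj (u q i)) = (if p = q then 1 else 0)"
      using u \<open>k = n\<close> by (simp add: orthonormal_eigenvectors_def ip_def)
  next
    fix i j assume "i < n" "j < n"
    then show "(\<Sum>p<n. u p i * cnj (u p j)) = (if i = j then 1 else 0)"
      using cols \<open>k = n\<close> by simp
  qed
qed

end

section \<open>The compressed Toeplitz operator and its eigenbasis\<close>
lemma lincombI:
  "f = (\<lambda>z. \<Sum>i\<in>A. c i * b i z) \<Longrightarrow> f \<in> {f. \<exists>c. f = (\<lambda>z. \<Sum>i\<in>A. c i * b i z :: complex)}"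
  unfolding mem_Collect_eq by (rule exI[of _ c])

lemma poly_space_eq: "poly_space N = {f. \<exists>c. f = (\<lambda>z. \<Sum>n\<in>{..N}. c n * bergman_basis n z)}"
proof (intro equalityI subsetI)
  have nz: "complex_of_real (sqrt (real n + 1)) \<noteq> 0" for n by simp
  fix f assume "f \<in> poly_space N"
  then obtain c where "f = (\<lambda>z. \<Sum>n\<le>N. c n * disc_monomial n z)" by (auto simp: poly_space_def)
  then have "f = (\<lambda>z. \<Sum>n\<in>{..N}. (c n / of_real (sqrt (real n + 1))) * bergman_basis n z)"
    using nz by (simp add: bergman_basis_def)
  then show "f \<in> {f. \<exists>c. f = (\<lambda>z. \<Sum>n\<in>{..N}. c n * bergman_basis n z)}" by (rule lincombI)
next
  fix f assume "f \<in> {f. \<exists>c. f = (\<lambda>z. \<Sum>n\<in>{..N}. c n * bergman_basis n z)}"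
  then obtain c where "f = (\<lambda>z. \<Sum>n\<le>N. c n * bergman_basis n z)" by blast
  then have "f = (\<lambda>z. \<Sum>n\<le>N. (c n * of_real (sqrt (real n + 1))) * disc_monomial n z)"
    by (simp add: bergman_basis_def mult.assoc)
  then show "f \<in> poly_space N" unfolding poly_space_def by (rule lincombI)
qed

lemma poly_space_L2: "f \<in> poly_space N \<Longrightarrow> f \<in> L2_disc"
  unfolding poly_space_eq by (auto intro: L2_disc_sum bergman_basis_L2)

lemma orth_proj_poly_space:
  assumes "f \<in> L2_disc"
  shows "orth_proj (poly_space N) f = (\<lambda>z. \<Sum>n\<le>N. L2_inner f (bergman_basis n) * bergman_basis n z)"
  by (rule orth_proj_span[OF _ _ _ poly_space_eq assms])
     (auto simp: bergman_basis_L2 L2_inner_bergman_basis)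

lemma L2_inner_basis_sum:
  assumes "j \<le> N"
  shows "L2_inner (\<lambda>z. \<Sum>n\<le>N. c n * bergman_basis n z) (bergman_basis j) = c j"
proof -
  have "L2_inner (\<lambda>z. \<Sum>n\<le>N. c n * bergman_basis n z) (bergman_basis j)
      = (\<Sum>n\<le>N. if n = j then c j else 0)"
    unfolding L2_inner_sum_left[OF bergman_basis_L2 bergman_basis_L2]
    by (intro sum.cong) (auto simp: L2_inner_bergman_basis)
  then show ?thesis using assms by simp
qed

lemma poly_space_expansion:
  assumes "f \<in> poly_space N"
  shows "f = (\<lambda>z. \<Sum>n\<le>N. L2_inner f (bergman_basis n) * bergman_basis n z)"
proof -
  obtain c where c: "f = (\<lambda>z. \<Sum>n\<le>N. c n * bergman_basis n z)"
    using assms unfolding poly_space_eq by blast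
  show ?thesis by (subst (1) c) (intro ext sum.cong refl, simp add: c L2_inner_basis_sum)
qed

locale bounded_symbol =
  fixes \<sigma> :: "complex \<Rightarrow> real" and C :: real
  assumes measurable_symbol: "\<sigma> \<in> borel_measurable (lebesgue_on (ball 0 1))"
    and symbol_bound: "z \<in> ball 0 1 \<Longrightarrow> \<bar>\<sigma> z\<bar> \<le> C"
begin

lemma symbol_measurable [measurable]: "\<sigma> \<in> borel_measurable disc_measure"
  using measurable_symbol by (simp add: disc_measure_def)

lemma symbol_mult_L2: "f \<in> L2_disc \<Longrightarrow> (\<lambda>z. of_real (\<sigma> z) * f z) \<in> L2_disc"
  by (rule L2_disc_bounded_mult[where C = C]) (auto simp: symbol_bound)

lemma symbol_mult_sum:
  assumes "\<And>i. i \<in> A \<Longrightarrow> f i \<in> L2_disc" "g \<in> L2_disc"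
  shows "L2_inner (\<lambda>z. of_real (\<sigma> z) * (\<Sum>i\<in>A. c i * f i z)) g
     = (\<Sum>i\<in>A. c i * L2_inner (\<lambda>z. of_real (\<sigma> z) * f i z) g)"
  using L2_inner_sum_left[of A "\<lambda>i z. of_real (\<sigma> z) * f i z" g c] assms symbol_mult_L2
  by (simp add: sum_distrib_left mult.left_commute)

text \<open>The Bergman projection does not change inner products with polynomials, so compressing the Toeplitz
  operator to \<open>poly_space N\<close> amounts to multiplying by the symbol and projecting once.\<close>
lemma compressed_toeplitz_eq:
  assumes f: "f \<in> poly_space N"
  shows "compressed_toeplitz N (\<lambda>z. of_real (\<sigma> z)) f
    = (\<lambda>z. \<Sum>n\<le>N. L2_inner (\<lambda>z. of_real (\<sigma> z) * f z) (bergman_basis n) * bergman_basis n z)"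
proof -
  note fL = poly_space_L2[OF f]
  have "orth_proj (poly_space N) f = f"
    using orth_proj_poly_space[OF fL, of N] poly_space_expansion[OF f] by simp
  moreover have "orth_proj (poly_space N) (toeplitz (\<lambda>z. of_real (\<sigma> z)) f)
      = (\<lambda>z. \<Sum>n\<le>N. L2_inner (\<lambda>z. of_real (\<sigma> z) * f z) (bergman_basis n) * bergman_basis n z)"
    unfolding toeplitz_def
    by (subst orth_proj_poly_space)
       (simp_all add: bergman_spaceD(1) orth_proj_bergman symbol_mult_L2 fL)
  ultimately show ?thesis by (simp add: compressed_toeplitz_def)
qed

end

text \<open>Row \<open>p\<close> of the unitary matrix \<open>u\<close> holds the coordinates, in the monomial basis, of a normalised
  eigenfunction with eigenvalue \<open>l p\<close>.\<close>
locale toeplitz_eigenbasis = bounded_symbol +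
  fixes N :: nat and l :: "nat \<Rightarrow> real" and u :: "nat \<Rightarrow> nat \<Rightarrow> complex"
  assumes eigen: "p \<le> N \<Longrightarrow> i \<le> N \<Longrightarrow>
      (\<Sum>j\<le>N. L2_inner (\<lambda>z. of_real (\<sigma> z) * bergman_basis j z) (bergman_basis i) * u p j)
        = of_real (l p) * u p i"
    and rows: "p \<le> N \<Longrightarrow> q \<le> N \<Longrightarrow> (\<Sum>i\<le>N. u p i * cnj (u q i)) = (if p = q then 1 else 0)"
    and cols: "i \<le> N \<Longrightarrow> j \<le> N \<Longrightarrow> (\<Sum>p\<le>N. u p i * cnj (u p j)) = (if i = j then 1 else 0)"
begin

definition eigenfunction :: "nat \<Rightarrow> complex \<Rightarrow> complex" where
  "eigenfunction p z = (\<Sum>i\<le>N. u p i * bergman_basis i z)"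

lemma eigenfunction_poly_space: "eigenfunction p \<in> poly_space N"
  unfolding poly_space_eq eigenfunction_def[abs_def] by (rule lincombI) simp

lemma eigenfunction_L2: "eigenfunction p \<in> L2_disc"
  by (rule poly_space_L2[OF eigenfunction_poly_space])

lemma eigenfunction_inner_basis: "i \<le> N \<Longrightarrow> L2_inner (eigenfunction p) (bergman_basis i) = u p i"
  unfolding eigenfunction_def[abs_def] by (rule L2_inner_basis_sum)

lemma eigenfunction_orthonormal:
  assumes "p \<le> N" "q \<le> N"
  shows "L2_inner (eigenfunction p) (eigenfunction q) = (if p = q then 1 else 0)"
proof -
  have "L2_inner (eigenfunction p) (eigenfunction q)
      = (\<Sum>i\<le>N. cnj (u q i) * L2_inner (eigenfunction p) (bergman_basis i))"
    unfolding eigenfunction_def[of q, abs_def]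
    by (rule L2_inner_sum_right[OF bergman_basis_L2 eigenfunction_L2])
  also have "\<dots> = (\<Sum>i\<le>N. u p i * cnj (u q i))"
    by (intro sum.cong) (auto simp: eigenfunction_inner_basis)
  finally show ?thesis using rows assms by simp
qed

lemma symbol_eigenfunction_basis:
  assumes "p \<le> N" "i \<le> N"
  shows "L2_inner (\<lambda>z. of_real (\<sigma> z) * eigenfunction p z) (bergman_basis i) = of_real (l p) * u p i"
  unfolding eigenfunction_def symbol_mult_sum[OF bergman_basis_L2 bergman_basis_L2]
  using eigen[OF assms] by (simp add: mult.commute)

lemma symbol_eigenfunction:
  assumes "p \<le> N" "q \<le> N"
  shows "L2_inner (\<lambda>z. of_real (\<sigma> z) * eigenfunction p z) (eigenfunction q)
    = (if p = q then of_real (l p) else 0)"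
proof -
  have "L2_inner (\<lambda>z. of_real (\<sigma> z) * eigenfunction p z) (eigenfunction q)
      = (\<Sum>i\<le>N. cnj (u q i) * L2_inner (\<lambda>z. of_real (\<sigma> z) * eigenfunction p z) (bergman_basis i))"
    unfolding eigenfunction_def[of q, abs_def]
    by (rule L2_inner_sum_right[OF bergman_basis_L2 symbol_mult_L2[OF eigenfunction_L2]])
  also have "\<dots> = of_real (l p) * (\<Sum>i\<le>N. u p i * cnj (u q i))"
    unfolding sum_distrib_left using assms
    by (intro sum.cong) (auto simp: symbol_eigenfunction_basis)
  finally show ?thesis using rows assms by simp
qed

lemma basis_eq_sum_eigenfunction:
  assumes "i \<le> N" shows "bergman_basis i z = (\<Sum>p\<le>N. cnj (u p i) * eigenfunction p z)"
proof -
  have "(\<Sum>p\<le>N. cnj (u p i) * eigenfunction p z) = (\<Sum>p\<le>N. \<Sum>j\<le>N. (u p j * cnj (u p i)) * bergman_basis j z)"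
    by (simp add: eigenfunction_def sum_distrib_left mult_ac)
  also have "\<dots> = (\<Sum>j\<le>N. (\<Sum>p\<le>N. u p j * cnj (u p i)) * bergman_basis j z)"
    by (subst sum.swap) (simp add: sum_distrib_right)
  also have "\<dots> = (\<Sum>j\<le>N. if j = i then bergman_basis i z else 0)"
    using assms by (intro sum.cong) (auto simp: cols)
  finally show ?thesis using assms by simp
qed

text \<open>The reproducing kernel of \<open>poly_space N\<close> is the same for every orthonormal basis. This is what frees
  the averaged quantities below from any knowledge of the eigenfunctions.\<close>
lemma eigenfunction_kernel:
  "(\<Sum>p\<le>N. eigenfunction p z * cnj (eigenfunction p w)) = (\<Sum>i\<le>N. bergman_basis i z * cnj (bergman_basis i w))"
proof -
  have "(\<Sum>i\<le>N. bergman_basis i z * cnj (bergman_basis i w))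
      = (\<Sum>i\<le>N. \<Sum>p\<le>N. eigenfunction p z * (cnj (u p i) * cnj (bergman_basis i w)))"
    by (intro sum.cong refl, subst basis_eq_sum_eigenfunction) (simp_all add: sum_distrib_left mult_ac)
  also have "\<dots> = (\<Sum>p\<le>N. eigenfunction p z * cnj (eigenfunction p w))"
  proof -
    have "cnj (eigenfunction p w) = (\<Sum>i\<le>N. cnj (u p i) * cnj (bergman_basis i w))" for p
      by (simp add: eigenfunction_def)
    then show ?thesis by (subst sum.swap) (simp add: sum_distrib_left)
  qed
  finally show ?thesis ..
qed

abbreviation T where "T \<equiv> compressed_toeplitz N (\<lambda>z. complex_of_real (\<sigma> z))"

lemma poly_space_eigenfunction:
  "poly_space N = {f. \<exists>c. f = (\<lambda>z. \<Sum>p\<in>{..N}. c p * eigenfunction p z)}"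
proof (intro equalityI subsetI)
  fix f assume "f \<in> poly_space N"
  then obtain c where "f = (\<lambda>z. \<Sum>i\<le>N. c i * bergman_basis i z)" unfolding poly_space_eq by blast
  then have "f = (\<lambda>z. \<Sum>i\<le>N. \<Sum>p\<le>N. (c i * cnj (u p i)) * eigenfunction p z)"
    by (simp add: basis_eq_sum_eigenfunction sum_distrib_left mult.assoc cong: sum.cong_simp)
  then have "f = (\<lambda>z. \<Sum>p\<in>{..N}. (\<Sum>i\<le>N. c i * cnj (u p i)) * eigenfunction p z)"
    by (subst (asm) sum.swap) (simp add: sum_distrib_right)
  then show "f \<in> {f. \<exists>c. f = (\<lambda>z. \<Sum>p\<in>{..N}. c p * eigenfunction p z)}" by (rule lincombI)
next
  fix f assume "f \<in> {f. \<exists>c. f = (\<lambda>z. \<Sum>p\<in>{..N}. c p * eigenfunction p z)}"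
  then obtain c where "f = (\<lambda>z. \<Sum>p\<le>N. c p * eigenfunction p z)" by blast
  then have "f = (\<lambda>z. \<Sum>p\<le>N. \<Sum>i\<le>N. (c p * u p i) * bergman_basis i z)"
    by (simp add: eigenfunction_def sum_distrib_left mult.assoc)
  then have "f = (\<lambda>z. \<Sum>i\<in>{..N}. (\<Sum>p\<le>N. c p * u p i) * bergman_basis i z)"
    by (subst (asm) sum.swap) (simp add: sum_distrib_right)
  then show "f \<in> poly_space N" unfolding poly_space_eq by (rule lincombI)
qed

lemma T_sum_eigenfunction:
  "T (\<lambda>z. \<Sum>p\<le>N. c p * eigenfunction p z) = (\<lambda>z. \<Sum>p\<le>N. (c p * of_real (l p)) * eigenfunction p z)"
proof -
  have mem: "(\<lambda>z. \<Sum>p\<le>N. c p * eigenfunction p z) \<in> poly_space N"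
    unfolding poly_space_eigenfunction by (rule lincombI) simp
  have "T (\<lambda>z. \<Sum>p\<le>N. c p * eigenfunction p z)
      = (\<lambda>z. \<Sum>i\<le>N. (\<Sum>p\<le>N. c p * (of_real (l p) * u p i)) * bergman_basis i z)"
    unfolding compressed_toeplitz_eq[OF mem] symbol_mult_sum[OF eigenfunction_L2 bergman_basis_L2]
    by (simp add: symbol_eigenfunction_basis cong: sum.cong_simp)
  also have "\<dots> = (\<lambda>z. \<Sum>i\<le>N. \<Sum>p\<le>N. (c p * of_real (l p)) * (u p i * bergman_basis i z))"
    by (simp add: sum_distrib_right mult.assoc)
  also have "\<dots> = (\<lambda>z. \<Sum>p\<le>N. (c p * of_real (l p)) * eigenfunction p z)"
    by (subst sum.swap) (simp add: eigenfunction_def sum_distrib_left)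
  finally show ?thesis .
qed

lemma L2_inner_eigenfunction_sum:
  assumes "q \<le> N"
  shows "L2_inner (\<lambda>z. \<Sum>p\<le>N. c p * eigenfunction p z) (eigenfunction q) = c q"
proof -
  have "L2_inner (\<lambda>z. \<Sum>p\<le>N. c p * eigenfunction p z) (eigenfunction q)
      = (\<Sum>p\<le>N. if p = q then c q else 0)"
    unfolding L2_inner_sum_left[OF eigenfunction_L2 eigenfunction_L2]
    using assms by (intro sum.cong) (auto simp: eigenfunction_orthonormal)
  then show ?thesis using assms by simp
qed

lemma eigenspace_eq:
  "eigenspace_on (poly_space N) T m
    = {f. \<exists>c. f = (\<lambda>z. \<Sum>p\<in>{p. p \<le> N \<and> l p = m}. c p * eigenfunction p z)}"
proof (intro equalityI subsetI)
  fix f assume f: "f \<in> eigenspace_on (poly_space N) T m"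
  then obtain c where c: "f = (\<lambda>z. \<Sum>p\<le>N. c p * eigenfunction p z)"
    unfolding eigenspace_on_def poly_space_eigenfunction by blast
  have "(\<lambda>z. \<Sum>p\<le>N. (c p * of_real (l p)) * eigenfunction p z) = T f"
    unfolding c by (rule T_sum_eigenfunction[symmetric])
  also have "\<dots> = (\<lambda>z. of_real m * f z)" using f by (simp add: eigenspace_on_def)
  also have "\<dots> = (\<lambda>z. \<Sum>p\<le>N. (of_real m * c p) * eigenfunction p z)"
    by (simp add: c sum_distrib_left mult.assoc)
  finally have eq: "(\<lambda>z. \<Sum>p\<le>N. (c p * of_real (l p)) * eigenfunction p z)
      = (\<lambda>z. \<Sum>p\<le>N. (of_real m * c p) * eigenfunction p z)" .
  have "c q * of_real (l q) = of_real m * c q" if "q \<le> N" for q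
    using arg_cong[OF eq, of "\<lambda>f. L2_inner f (eigenfunction q)"]
    unfolding L2_inner_eigenfunction_sum[OF that] .
  then have "c q = 0" if "q \<le> N" "l q \<noteq> m" for q
    using that by (metis mult.commute mult_cancel_right of_real_eq_iff)
  then have "f = (\<lambda>z. \<Sum>p\<in>{p. p \<le> N \<and> l p = m}. c p * eigenfunction p z)"
    unfolding c by (intro ext sum.mono_neutral_right) auto
  then show "f \<in> {f. \<exists>c. f = (\<lambda>z. \<Sum>p\<in>{p. p \<le> N \<and> l p = m}. c p * eigenfunction p z)}" by (rule lincombI)
next
  fix f assume "f \<in> {f. \<exists>c. f = (\<lambda>z. \<Sum>p\<in>{p. p \<le> N \<and> l p = m}. c p * eigenfunction p z)}"
  then obtain c where f: "f = (\<lambda>z. \<Sum>p\<in>{p. p \<le> N \<and> l p = m}. c p * eigenfunction p z)" by blast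
  define d where "d p = (if l p = m then c p else 0)" for p
  have d: "f = (\<lambda>z. \<Sum>p\<le>N. d p * eigenfunction p z)"
    unfolding f by (intro ext sum.mono_neutral_cong_left) (auto simp: d_def)
  have "T f = (\<lambda>z. of_real m * f z)"
    unfolding d T_sum_eigenfunction sum_distrib_left
    by (intro ext sum.cong) (auto simp: d_def)
  moreover have "f \<in> poly_space N" unfolding poly_space_eigenfunction by (rule lincombI[OF d])
  ultimately show "f \<in> eigenspace_on (poly_space N) T m" by (simp add: eigenspace_on_def)
qed

lemma eigenvalues_eq: "eigenvalues_on (poly_space N) T = l ` {..N}"
proof (intro equalityI subsetI)
  fix m assume "m \<in> eigenvalues_on (poly_space N) T"
  then obtain f where f: "f \<in> eigenspace_on (poly_space N) T m" "f \<noteq> (\<lambda>_. 0)"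
    by (auto simp: eigenvalues_on_def)
  then obtain c where c: "f = (\<lambda>z. \<Sum>p\<in>{p. p \<le> N \<and> l p = m}. c p * eigenfunction p z)"
    unfolding eigenspace_eq by blast
  have "{p. p \<le> N \<and> l p = m} \<noteq> {}"
  proof
    assume "{p. p \<le> N \<and> l p = m} = {}"
    then have "f = (\<lambda>_. 0)" unfolding c by (simp only: sum.empty)
    with f(2) show False by simp
  qed
  then show "m \<in> l ` {..N}" by auto
next
  fix m assume "m \<in> l ` {..N}"
  then obtain q where q: "q \<le> N" "m = l q" by auto
  have "eigenfunction q = (\<lambda>z. \<Sum>p\<in>{p. p \<le> N \<and> l p = m}. (if p = q then 1 else 0) * eigenfunction p z)"
    using q by (auto simp: if_distrib if_distribR sum.delta cong: if_cong)
  then have "eigenfunction q \<in> eigenspace_on (poly_space N) T m"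
    unfolding eigenspace_eq mem_Collect_eq by (rule exI[of _ "\<lambda>p. if p = q then 1 else 0"])
  moreover have "eigenfunction q \<noteq> (\<lambda>_. 0)"
  proof
    assume "eigenfunction q = (\<lambda>_. 0)"
    then have "L2_inner (eigenfunction q) (eigenfunction q) = 0" by (simp add: L2_inner_def)
    with q show False by (simp add: eigenfunction_orthonormal)
  qed
  ultimately show "m \<in> eigenvalues_on (poly_space N) T" by (auto simp: eigenvalues_on_def)
qed

lemma functional_calculus_eq:
  assumes f: "f \<in> L2_disc"
  shows "functional_calculus_on (poly_space N) \<psi> T f
    = (\<lambda>z. \<Sum>p\<le>N. \<psi> (l p) * L2_inner f (eigenfunction p) * eigenfunction p z)"
proof
  fix z
  have "functional_calculus_on (poly_space N) \<psi> T f z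
      = (\<Sum>m\<in>l ` {..N}. \<psi> m * (\<Sum>p\<in>{p. p \<le> N \<and> l p = m}. L2_inner f (eigenfunction p) * eigenfunction p z))"
  proof -
    have "orth_proj (eigenspace_on (poly_space N) T m) f
        = (\<lambda>z. \<Sum>p\<in>{p. p \<le> N \<and> l p = m}. L2_inner f (eigenfunction p) * eigenfunction p z)" for m
      by (rule orth_proj_span[OF _ _ _ eigenspace_eq f])
         (auto simp: eigenfunction_L2 eigenfunction_orthonormal)
    then show ?thesis by (simp add: functional_calculus_on_def eigenvalues_eq)
  qed
  also have "\<dots> = (\<Sum>m\<in>l ` {..N}. \<Sum>p\<in>{p \<in> {..N}. l p = m}. \<psi> (l p) * L2_inner f (eigenfunction p) * eigenfunction p z)"
    by (intro sum.cong refl) (auto simp: sum_distrib_left mult.assoc intro!: sum.cong)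
  also have "\<dots> = (\<Sum>p\<le>N. \<psi> (l p) * L2_inner f (eigenfunction p) * eigenfunction p z)"
    by (rule sum.image_gen[symmetric]) simp
  finally show "functional_calculus_on (poly_space N) \<psi> T f z
    = (\<Sum>p\<le>N. \<psi> (l p) * L2_inner f (eigenfunction p) * eigenfunction p z)" .
qed

text \<open>In the eigenbasis the functional calculus is diagonal, and the squared moduli of the coordinates of
  each eigenfunction sum to one.\<close>
lemma trace_functional_calculus:
  "trace_poly_space N (functional_calculus_on (poly_space N) \<psi> T) = (\<Sum>p\<le>N. \<psi> (l p))"
proof -
  have "trace_poly_space N (functional_calculus_on (poly_space N) \<psi> T)
      = (\<Sum>n\<le>N. \<Sum>p\<le>N. \<psi> (l p) * (u p n * cnj (u p n)))"
    unfolding trace_poly_space_def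
  proof (intro sum.cong refl)
    fix n assume n: "n \<in> {..N}"
    have "L2_inner (bergman_basis n) (eigenfunction p) = cnj (u p n)" for p
      using n by (subst L2_inner_commute) (simp add: eigenfunction_inner_basis)
    then show "L2_inner (functional_calculus_on (poly_space N) \<psi> T (bergman_basis n)) (bergman_basis n)
        = (\<Sum>p\<le>N. \<psi> (l p) * (u p n * cnj (u p n)))"
      using n unfolding functional_calculus_eq[OF bergman_basis_L2]
        L2_inner_sum_left[OF eigenfunction_L2 bergman_basis_L2]
      by (intro sum.cong) (auto simp: eigenfunction_inner_basis)
  qed
  also have "\<dots> = (\<Sum>p\<le>N. \<psi> (l p) * (\<Sum>n\<le>N. u p n * cnj (u p n)))"
    by (subst sum.swap) (simp add: sum_distrib_left)
  also have "\<dots> = (\<Sum>p\<le>N. \<psi> (l p))" by (simp add: rows)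
  finally show ?thesis .
qed

end

lemma (in bounded_symbol) eigenbasis_exists: "\<exists>l u. toeplitz_eigenbasis \<sigma> C N l u"
proof -
  define a where "a i j = L2_inner (\<lambda>z. of_real (\<sigma> z) * bergman_basis j z) (bergman_basis i)" for i j
  interpret hermitian_matrix a "Suc N"
  proof
    fix i j
    have "a j i = cnj (L2_inner (bergman_basis j) (\<lambda>z. of_real (\<sigma> z) * bergman_basis i z))"
      unfolding a_def by (rule L2_inner_commute)
    also have "L2_inner (bergman_basis j) (\<lambda>z. of_real (\<sigma> z) * bergman_basis i z) = a i j"
      by (simp add: a_def L2_inner_def mult_ac)
    finally show "a j i = cnj (a i j)" .
  qed
  obtain u l where
    "\<And>p i. p < Suc N \<Longrightarrow> i < Suc N \<Longrightarrow> (\<Sum>j<Suc N. a i j * u p j) = of_real (l p) * u p i"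
    "\<And>p q. p < Suc N \<Longrightarrow> q < Suc N \<Longrightarrow> (\<Sum>i<Suc N. u p i * cnj (u q i)) = (if p = q then 1 else 0)"
    "\<And>i j. i < Suc N \<Longrightarrow> j < Suc N \<Longrightarrow> (\<Sum>p<Suc N. u p i * cnj (u p j)) = (if i = j then 1 else 0)"
    using spectral_theorem by blast
  then have "toeplitz_eigenbasis \<sigma> C N l u"
    by unfold_locales (simp_all only: lessThan_Suc_atMost less_Suc_eq_le a_def)
  then show ?thesis by blast
qed

section \<open>Energy of a function against the reproducing kernel\<close>
interpretation disc2: pair_prob_space disc_measure disc_measure ..

abbreviation disc_pair :: "(complex \<times> complex) measure" where
  "disc_pair \<equiv> disc_measure \<Otimes>\<^sub>M disc_measure"

lemma
  fixes f g :: "complex \<Rightarrow> complex"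
  assumes f: "integrable disc_measure f" and g: "integrable disc_measure g"
  shows integrable_pair_mult: "integrable disc_pair (\<lambda>p. f (fst p) * g (snd p))"
    and integral_pair_mult: "(LINT p|disc_pair. f (fst p) * g (snd p))
      = (LINT z|disc_measure. f z) * (LINT z|disc_measure. g z)"
proof -
  note [measurable] = borel_measurable_integrable[OF f] borel_measurable_integrable[OF g]
  show int: "integrable disc_pair (\<lambda>p. f (fst p) * g (snd p))"
  proof (rule disc2.Fubini_integrable)
    show "integrable disc_measure (\<lambda>x. LINT y|disc_measure. norm (f (fst (x, y)) * g (snd (x, y))))"
      using f by (simp add: norm_mult)
    show "AE x in disc_measure. integrable disc_measure (\<lambda>y. f (fst (x, y)) * g (snd (x, y)))"
      using g by simp
  qed measurable
  show "(LINT p|disc_pair. f (fst p) * g (snd p))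
      = (LINT z|disc_measure. f z) * (LINT z|disc_measure. g z)"
    using disc2.integral_fst'[OF int] by simp
qed

definition reproducing_kernel :: "nat \<Rightarrow> (nat \<Rightarrow> complex \<Rightarrow> complex) \<Rightarrow> complex \<Rightarrow> complex \<Rightarrow> complex" where
  "reproducing_kernel N g z w = (\<Sum>p\<le>N. g p z * cnj (g p w))"

definition bounded_on_disc :: "(complex \<Rightarrow> complex) \<Rightarrow> bool" where
  "bounded_on_disc a \<longleftrightarrow> a \<in> borel_measurable disc_measure \<and> (\<exists>C. \<forall>z\<in>ball 0 1. cmod (a z) \<le> C)"

lemma bounded_on_disc_mult_L2: "bounded_on_disc a \<Longrightarrow> f \<in> L2_disc \<Longrightarrow> (\<lambda>z. a z * f z) \<in> L2_disc"
  unfolding bounded_on_disc_def by (elim conjE exE) (rule L2_disc_bounded_mult, auto)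

lemma bounded_on_disc_const: "bounded_on_disc (\<lambda>_. c)"
  by (auto simp: bounded_on_disc_def)

lemma bounded_on_disc_cnj: "bounded_on_disc a \<Longrightarrow> bounded_on_disc (\<lambda>z. cnj (a z))"
  by (auto simp: bounded_on_disc_def)

lemma bounded_on_disc_mult:
  assumes "bounded_on_disc a" "bounded_on_disc b" shows "bounded_on_disc (\<lambda>z. a z * b z)"
proof -
  obtain A B where AB: "\<And>z. z \<in> ball 0 1 \<Longrightarrow> cmod (a z) \<le> A" "\<And>z. z \<in> ball 0 1 \<Longrightarrow> cmod (b z) \<le> B"
    using assms unfolding bounded_on_disc_def by blast
  have "cmod (a z * b z) \<le> A * B" if "z \<in> ball 0 1" for z
    unfolding norm_mult using AB[OF that] by (intro mult_mono) (auto intro: order_trans[OF norm_ge_zero])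
  with assms show ?thesis unfolding bounded_on_disc_def by (auto intro!: exI[of _ "A * B"])
qed

text \<open>The squared modulus of the kernel is a finite sum of products of functions of \<open>z\<close> and of \<open>w\<close>, so
  Fubini turns such double integrals into sums of products of matrix entries.\<close>
lemma
  assumes g: "\<And>p. g p \<in> L2_disc" and a: "bounded_on_disc a" and b: "bounded_on_disc b"
  shows kernel_bilinear_integrable: "integrable disc_pair
      (\<lambda>x. a (fst x) * b (snd x) * of_real ((cmod (reproducing_kernel N g (fst x) (snd x)))\<^sup>2))"
    and kernel_bilinear: "(LINT x|disc_pair.
        a (fst x) * b (snd x) * of_real ((cmod (reproducing_kernel N g (fst x) (snd x)))\<^sup>2))
      = (\<Sum>p\<le>N. \<Sum>q\<le>N. L2_inner (\<lambda>z. a z * g p z) (g q) * L2_inner (\<lambda>z. b z * g q z) (g p))"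
proof -
  have pointwise: "a z * b w * of_real ((cmod (reproducing_kernel N g z w))\<^sup>2)
    = (\<Sum>p\<le>N. \<Sum>q\<le>N. (a z * g p z * cnj (g q z)) * (b w * g q w * cnj (g p w)))" for z w
  proof -
    have "complex_of_real ((cmod (reproducing_kernel N g z w))\<^sup>2)
        = (\<Sum>p\<le>N. \<Sum>q\<le>N. (g p z * cnj (g p w)) * (cnj (g q z) * g q w))"
      unfolding complex_norm_square by (simp add: reproducing_kernel_def sum_product)
    then show ?thesis by (simp add: sum_distrib_left mult_ac)
  qed
  have int: "integrable disc_measure (\<lambda>z. a z * g p z * cnj (g q z))"
    "integrable disc_measure (\<lambda>z. b z * g p z * cnj (g q z))" for p q
    by (intro L2_integrable bounded_on_disc_mult_L2 a b g)+
  note i2 = integrable_pair_mult[OF int(1) int(2)]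
  show "integrable disc_pair
      (\<lambda>x. a (fst x) * b (snd x) * of_real ((cmod (reproducing_kernel N g (fst x) (snd x)))\<^sup>2))"
    unfolding pointwise by (intro Bochner_Integration.integrable_sum i2)
  show "(LINT x|disc_pair.
        a (fst x) * b (snd x) * of_real ((cmod (reproducing_kernel N g (fst x) (snd x)))\<^sup>2))
      = (\<Sum>p\<le>N. \<Sum>q\<le>N. L2_inner (\<lambda>z. a z * g p z) (g q) * L2_inner (\<lambda>z. b z * g q z) (g p))"
    unfolding pointwise
    by (subst Bochner_Integration.integral_sum, intro Bochner_Integration.integrable_sum i2,
        intro sum.cong refl, subst Bochner_Integration.integral_sum, intro i2,
        intro sum.cong refl, subst integral_pair_mult[OF int(1) int(2)])
       (simp add: L2_inner_def)
qed

lemma orthonormal_delta: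
  fixes g :: "nat \<Rightarrow> complex \<Rightarrow> complex"
  assumes on: "\<And>p q. p \<le> N \<Longrightarrow> q \<le> N \<Longrightarrow> L2_inner (g p) (g q) = (if p = q then 1 else 0)"
    and p: "p \<le> N"
  shows "(\<Sum>q\<le>N. X q * L2_inner (g q) (g p)) = X p" "(\<Sum>q\<le>N. L2_inner (g p) (g q) * X q) = X p"
proof -
  have "(\<Sum>q\<le>N. X q * L2_inner (g q) (g p)) = (\<Sum>q\<le>N. if q = p then X p else 0)"
    using p by (intro sum.cong) (auto simp: on)
  then show "(\<Sum>q\<le>N. X q * L2_inner (g q) (g p)) = X p" using p by simp
  have "(\<Sum>q\<le>N. L2_inner (g p) (g q) * X q) = (\<Sum>q\<le>N. if q = p then X p else 0)"
    using p by (intro sum.cong) (auto simp: on)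
  then show "(\<Sum>q\<le>N. L2_inner (g p) (g q) * X q) = X p" using p by simp
qed

text \<open>For orthonormal \<open>g 0, \<dots>, g N\<close> this is twice the squared Hilbert-Schmidt norm of the operator \<open>(1 - P) h P\<close>, where
  \<open>h\<close> acts by multiplication and \<open>P\<close> is the projection onto their span; it measures
  how much multiplication by \<open>h\<close> leaves that span. The double integral involves \<open>h\<close> only through
  \<open>\<bar>h z - h w\<bar>\<close>, so that functions can be compared through their oscillation.\<close>
definition kernel_energy :: "nat \<Rightarrow> (nat \<Rightarrow> complex \<Rightarrow> complex) \<Rightarrow> (complex \<Rightarrow> complex) \<Rightarrow> real" where
  "kernel_energy N g h = (LINT x|disc_pair.
     (cmod (h (fst x) - h (snd x)))\<^sup>2 * (cmod (reproducing_kernel N g (fst x) (snd x)))\<^sup>2)"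

text \<open>Expanding \<open>\<bar>h z - h w\<bar>\<^sup>2\<close> gives two diagonal terms, which the reproducing property of the kernel
  reduces to norms, and two mixed terms, each equal to the sum of the squared matrix entries.\<close>
lemma
  assumes g: "\<And>p. g p \<in> L2_disc"
    and on: "\<And>p q. p \<le> N \<Longrightarrow> q \<le> N \<Longrightarrow> L2_inner (g p) (g q) = (if p = q then 1 else 0)"
    and h: "bounded_on_disc h"
  shows kernel_energy_integrable: "integrable disc_pair
      (\<lambda>x. (cmod (h (fst x) - h (snd x)))\<^sup>2 * (cmod (reproducing_kernel N g (fst x) (snd x)))\<^sup>2)"
    and kernel_energy_eq: "kernel_energy N g h = 2 * (\<Sum>p\<le>N. (LINT z|disc_measure. (cmod (h z * g p z))\<^sup>2)
        - (\<Sum>q\<le>N. (cmod (L2_inner (\<lambda>z. h z * g p z) (g q)))\<^sup>2))"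
proof -
  define K where "K x = complex_of_real ((cmod (reproducing_kernel N g (fst x) (snd x)))\<^sup>2)" for x
  note hc = bounded_on_disc_cnj[OF h]
  note hh = bounded_on_disc_mult[OF h hc]
  note one = bounded_on_disc_const[of 1]
  note i = kernel_bilinear_integrable[where g = g and N = N, OF g, folded K_def]
  note b = kernel_bilinear[where g = g and N = N, OF g, folded K_def]
  have pointwise: "complex_of_real ((cmod (h (fst x) - h (snd x)))\<^sup>2 * (cmod (reproducing_kernel N g (fst x) (snd x)))\<^sup>2)
     = ((h (fst x) * cnj (h (fst x))) * 1 * K x + 1 * (h (snd x) * cnj (h (snd x))) * K x)
       - (h (fst x) * cnj (h (snd x)) * K x + cnj (h (fst x)) * h (snd x) * K x)" for x
    unfolding of_real_mult complex_norm_square[of "h (fst x) - h (snd x)"] K_def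
    by (simp add: algebra_simps)
  have ii: "integrable disc_pair (\<lambda>x.
       ((h (fst x) * cnj (h (fst x))) * 1 * K x + 1 * (h (snd x) * cnj (h (snd x))) * K x)
       - (h (fst x) * cnj (h (snd x)) * K x + cnj (h (fst x)) * h (snd x) * K x))"
    by (intro Bochner_Integration.integrable_diff Bochner_Integration.integrable_add
        i[OF hh one] i[OF one hh] i[OF h hc] i[OF hc h])
  then show "integrable disc_pair
      (\<lambda>x. (cmod (h (fst x) - h (snd x)))\<^sup>2 * (cmod (reproducing_kernel N g (fst x) (snd x)))\<^sup>2)"
    unfolding pointwise[symmetric] complex_of_real_integrable_eq .
  define c where "c p q = L2_inner (\<lambda>z. h z * g p z) (g q)" for p q
  have cc: "L2_inner (\<lambda>z. cnj (h z) * g q z) (g p) = cnj (c p q)" for p q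
    unfolding c_def by (subst L2_inner_commute[symmetric]) (simp add: L2_inner_def mult_ac)
  have nn: "L2_inner (\<lambda>z. h z * cnj (h z) * g p z) (g p)
      = of_real (LINT z|disc_measure. (cmod (h z * g p z))\<^sup>2)" for p
    unfolding L2_inner_self[symmetric] by (simp add: L2_inner_def mult_ac)
  note del = orthonormal_delta[where g = g, OF on]
  have S1: "(\<Sum>p\<le>N. \<Sum>q\<le>N. L2_inner (\<lambda>z. h z * cnj (h z) * g p z) (g q) * L2_inner (\<lambda>z. 1 * g q z) (g p))
      = (\<Sum>p\<le>N. of_real (LINT z|disc_measure. (cmod (h z * g p z))\<^sup>2))"
    unfolding mult_1 by (intro sum.cong refl) (simp only: atMost_iff del(1) nn)
  have S2: "(\<Sum>p\<le>N. \<Sum>q\<le>N. L2_inner (\<lambda>z. 1 * g p z) (g q) * L2_inner (\<lambda>z. h z * cnj (h z) * g q z) (g p))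
      = (\<Sum>p\<le>N. of_real (LINT z|disc_measure. (cmod (h z * g p z))\<^sup>2))"
    unfolding mult_1 by (intro sum.cong refl) (simp only: atMost_iff del(2) nn)
  have S3: "(\<Sum>p\<le>N. \<Sum>q\<le>N. c p q * L2_inner (\<lambda>z. cnj (h z) * g q z) (g p))
      = (\<Sum>p\<le>N. \<Sum>q\<le>N. of_real ((cmod (c p q))\<^sup>2))"
    unfolding cc complex_norm_square ..
  have S4: "(\<Sum>p\<le>N. \<Sum>q\<le>N. L2_inner (\<lambda>z. cnj (h z) * g p z) (g q) * c q p)
      = (\<Sum>p\<le>N. \<Sum>q\<le>N. of_real ((cmod (c p q))\<^sup>2))"
    unfolding cc complex_norm_square by (subst sum.swap) (simp add: mult.commute)
  have "complex_of_real (kernel_energy N g h) = (LINT x|disc_pair.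
      complex_of_real ((cmod (h (fst x) - h (snd x)))\<^sup>2 * (cmod (reproducing_kernel N g (fst x) (snd x)))\<^sup>2))"
    unfolding kernel_energy_def by (rule integral_complex_of_real[symmetric])
  also have "\<dots> = ((LINT x|disc_pair. (h (fst x) * cnj (h (fst x))) * 1 * K x)
        + (LINT x|disc_pair. 1 * (h (snd x) * cnj (h (snd x))) * K x))
      - ((LINT x|disc_pair. h (fst x) * cnj (h (snd x)) * K x)
        + (LINT x|disc_pair. cnj (h (fst x)) * h (snd x) * K x))"
    unfolding pointwise
    unfolding Bochner_Integration.integral_diff[OF
        Bochner_Integration.integrable_add[OF i[OF hh one] i[OF one hh]]
        Bochner_Integration.integrable_add[OF i[OF h hc] i[OF hc h]]]
      Bochner_Integration.integral_add[OF i[OF hh one] i[OF one hh]]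
      Bochner_Integration.integral_add[OF i[OF h hc] i[OF hc h]] ..
  also have "\<dots> = ((\<Sum>p\<le>N. of_real (LINT z|disc_measure. (cmod (h z * g p z))\<^sup>2))
        + (\<Sum>p\<le>N. of_real (LINT z|disc_measure. (cmod (h z * g p z))\<^sup>2)))
      - ((\<Sum>p\<le>N. \<Sum>q\<le>N. of_real ((cmod (c p q))\<^sup>2)) + (\<Sum>p\<le>N. \<Sum>q\<le>N. of_real ((cmod (c p q))\<^sup>2)))"
    unfolding b[OF hh one] b[OF one hh] b[OF h hc] b[OF hc h] S1 S2
    by (simp only: S3[unfolded c_def] S4[unfolded c_def] c_def)
  also have "\<dots> = complex_of_real (2 * (\<Sum>p\<le>N. (LINT z|disc_measure. (cmod (h z * g p z))\<^sup>2)
        - (\<Sum>q\<le>N. (cmod (c p q))\<^sup>2)))"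
    by (simp add: sum_subtractf)
  finally show "kernel_energy N g h = 2 * (\<Sum>p\<le>N. (LINT z|disc_measure. (cmod (h z * g p z))\<^sup>2)
        - (\<Sum>q\<le>N. (cmod (L2_inner (\<lambda>z. h z * g p z) (g q)))\<^sup>2))"
    unfolding of_real_eq_iff c_def .
qed

text \<open>The reproducing property: both marginals of \<open>\<bar>K(z,w)\<bar>\<^sup>2\<close> are \<open>K(z,z)\<close>.\<close>
lemma
  assumes g: "\<And>p. g p \<in> L2_disc"
    and on: "\<And>p q. p \<le> N \<Longrightarrow> q \<le> N \<Longrightarrow> L2_inner (g p) (g q) = (if p = q then 1 else 0)"
    and d: "bounded_on_disc (\<lambda>z. of_real (d z))"
  shows kernel_marginal_integrable:
      "integrable disc_pair (\<lambda>x. d (fst x) * (cmod (reproducing_kernel N g (fst x) (snd x)))\<^sup>2)"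
      "integrable disc_pair (\<lambda>x. d (snd x) * (cmod (reproducing_kernel N g (fst x) (snd x)))\<^sup>2)"
    and kernel_marginal:
      "(LINT x|disc_pair. d (fst x) * (cmod (reproducing_kernel N g (fst x) (snd x)))\<^sup>2)
        = (LINT z|disc_measure. d z * (\<Sum>p\<le>N. (cmod (g p z))\<^sup>2))"
      "(LINT x|disc_pair. d (snd x) * (cmod (reproducing_kernel N g (fst x) (snd x)))\<^sup>2)
        = (LINT z|disc_measure. d z * (\<Sum>p\<le>N. (cmod (g p z))\<^sup>2))"
proof -
  note one = bounded_on_disc_const[of 1]
  note i1 = kernel_bilinear_integrable[where g = g and N = N, OF g d one, unfolded mult_1_right]
  note i2 = kernel_bilinear_integrable[where g = g and N = N, OF g one d, unfolded mult_1_left]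
  show "integrable disc_pair (\<lambda>x. d (fst x) * (cmod (reproducing_kernel N g (fst x) (snd x)))\<^sup>2)"
    using i1 unfolding of_real_mult[symmetric] complex_of_real_integrable_eq .
  show "integrable disc_pair (\<lambda>x. d (snd x) * (cmod (reproducing_kernel N g (fst x) (snd x)))\<^sup>2)"
    using i2 unfolding of_real_mult[symmetric] complex_of_real_integrable_eq .
  note del = orthonormal_delta[where g = g, OF on]
  have int: "integrable disc_measure (\<lambda>z. of_real (d z) * g p z * cnj (g p z))" for p
    by (intro L2_integrable bounded_on_disc_mult_L2 d g)
  have rhs: "(\<Sum>p\<le>N. L2_inner (\<lambda>z. of_real (d z) * g p z) (g p))
      = complex_of_real (LINT z|disc_measure. d z * (\<Sum>p\<le>N. (cmod (g p z))\<^sup>2))"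
  proof -
    have "(\<Sum>p\<le>N. L2_inner (\<lambda>z. of_real (d z) * g p z) (g p))
        = (LINT z|disc_measure. (\<Sum>p\<le>N. of_real (d z) * g p z * cnj (g p z)))"
      unfolding L2_inner_def by (rule Bochner_Integration.integral_sum[symmetric]) (rule int)
    also have "\<dots> = (LINT z|disc_measure. complex_of_real (d z * (\<Sum>p\<le>N. (cmod (g p z))\<^sup>2)))"
      by (simp only: of_real_mult of_real_sum complex_norm_square sum_distrib_left mult.assoc)
    also have "\<dots> = complex_of_real (LINT z|disc_measure. d z * (\<Sum>p\<le>N. (cmod (g p z))\<^sup>2))"
      by (rule integral_complex_of_real)
    finally show ?thesis .
  qed
  have "complex_of_real (LINT x|disc_pair. d (fst x) * (cmod (reproducing_kernel N g (fst x) (snd x)))\<^sup>2)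
      = (\<Sum>p\<le>N. \<Sum>q\<le>N. L2_inner (\<lambda>z. of_real (d z) * g p z) (g q) * L2_inner (\<lambda>z. 1 * g q z) (g p))"
    using kernel_bilinear[where g = g and N = N, OF g d one] by (simp flip: integral_complex_of_real)
  also have "\<dots> = (\<Sum>p\<le>N. L2_inner (\<lambda>z. of_real (d z) * g p z) (g p))"
    unfolding mult_1 by (intro sum.cong refl) (simp only: atMost_iff del(1))
  finally show "(LINT x|disc_pair. d (fst x) * (cmod (reproducing_kernel N g (fst x) (snd x)))\<^sup>2)
        = (LINT z|disc_measure. d z * (\<Sum>p\<le>N. (cmod (g p z))\<^sup>2))"
    unfolding rhs of_real_eq_iff .
  have "complex_of_real (LINT x|disc_pair. d (snd x) * (cmod (reproducing_kernel N g (fst x) (snd x)))\<^sup>2)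
      = (\<Sum>p\<le>N. \<Sum>q\<le>N. L2_inner (\<lambda>z. 1 * g p z) (g q) * L2_inner (\<lambda>z. of_real (d z) * g q z) (g p))"
    using kernel_bilinear[where g = g and N = N, OF g one d] by (simp flip: integral_complex_of_real)
  also have "\<dots> = (\<Sum>p\<le>N. L2_inner (\<lambda>z. of_real (d z) * g p z) (g p))"
    unfolding mult_1 by (intro sum.cong refl) (simp only: atMost_iff del(2))
  finally show "(LINT x|disc_pair. d (snd x) * (cmod (reproducing_kernel N g (fst x) (snd x)))\<^sup>2)
        = (LINT z|disc_measure. d z * (\<Sum>p\<le>N. (cmod (g p z))\<^sup>2))"
    unfolding rhs of_real_eq_iff .
qed

lemma bergman_kernel_diagonal:
  assumes "z \<in> ball 0 1"
  shows "(\<Sum>n\<le>N. (cmod (bergman_basis n z))\<^sup>2) = real (N + 1) * boundary_weight N ((cmod z)\<^sup>2)"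
proof -
  have "(cmod (bergman_basis n z))\<^sup>2 = real (n + 1) * ((cmod z)\<^sup>2) ^ n" for n
    using assms by (simp add: bergman_basis_def disc_monomial_def norm_mult power_mult_distrib norm_power)
      (simp flip: power_mult add: mult.commute)
  then show ?thesis by (simp add: boundary_weight_def)
qed

lemma integral_times_kernel_diagonal:
  "(LINT z|disc_measure. d z * (\<Sum>n\<le>N. (cmod (bergman_basis n z))\<^sup>2))
    = real (N + 1) * (LINT z|disc_measure. d z * boundary_weight N ((cmod z)\<^sup>2))"
proof -
  have "(LINT z|disc_measure. d z * (\<Sum>n\<le>N. (cmod (bergman_basis n z))\<^sup>2))
      = (LINT z|disc_measure. real (N + 1) * (d z * boundary_weight N ((cmod z)\<^sup>2)))"
    by (intro Bochner_Integration.integral_cong refl) (simp add: bergman_kernel_diagonal)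
  then show ?thesis by simp
qed

lemma mult_z_bergman_basis:
  "z * bergman_basis n z = of_real (sqrt (real n + 1) / sqrt (real n + 2)) * bergman_basis (Suc n) z"
proof -
  have "of_real (sqrt (real n + 2)) \<noteq> (0 :: complex)" by simp
  then show ?thesis
    by (simp add: bergman_basis_def disc_monomial_def add.commute)
qed

lemma bounded_on_disc_id: "bounded_on_disc (\<lambda>z. z)"
  unfolding bounded_on_disc_def using measurable_disc_id by (auto intro!: exI[of _ 1])

text \<open>Multiplication by \<open>z\<close> shifts the monomial basis and so moves only the last basis element out of
  \<open>poly_space N\<close>. The energy therefore stays bounded while the dimension grows.\<close>
lemma kernel_energy_identity: "kernel_energy N bergman_basis (\<lambda>z. z) \<le> 2"
proof -
  define s where "s n = sqrt (real n + 1) / sqrt (real n + 2)" for n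
  define c where "c n = (s n)\<^sup>2" for n
  have shift: "z * bergman_basis n z = of_real (s n) * bergman_basis (Suc n) z" for n z
    unfolding s_def by (rule mult_z_bergman_basis)
  have 1: "(LINT z|disc_measure. (cmod (z * bergman_basis p z))\<^sup>2) = c p" for p
  proof -
    have "complex_of_real (LINT z|disc_measure. (cmod (z * bergman_basis p z))\<^sup>2)
        = L2_inner (\<lambda>z. z * bergman_basis p z) (\<lambda>z. z * bergman_basis p z)"
      by (rule L2_inner_self[symmetric])
    also have "\<dots> = of_real (c p)"
      unfolding shift L2_inner_cmult_left L2_inner_cmult_right
      by (simp add: L2_inner_bergman_basis c_def power2_eq_square)
    finally show ?thesis by (simp only: of_real_eq_iff)
  qed
  have 2: "(cmod (L2_inner (\<lambda>z. z * bergman_basis p z) (bergman_basis q)))\<^sup>2 = (if q = Suc p then c p else 0)" for p q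
    unfolding shift L2_inner_cmult_left
    by (simp add: L2_inner_bergman_basis c_def)
  have "kernel_energy N bergman_basis (\<lambda>z. z)
      = 2 * (\<Sum>p\<le>N. c p - (\<Sum>q\<le>N. if q = Suc p then c p else 0))"
    by (subst kernel_energy_eq[where g = bergman_basis, OF bergman_basis_L2 L2_inner_bergman_basis bounded_on_disc_id])
       (simp only: 1 2)
  also have "(\<Sum>p\<le>N. c p - (\<Sum>q\<le>N. if q = Suc p then c p else 0)) = (\<Sum>p\<le>N. if p = N then c N else 0)"
    by (intro sum.cong refl) auto
  also have "\<dots> = c N" by simp
  also have "c N \<le> 1" by (simp add: c_def s_def power_divide)
  finally show ?thesis by simp
qed

text \<open>Uniform continuity in a form that can be integrated: points at distance less than \<open>d\<close> are covered by \<open>e\<close>,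
  and for the others the quadratic term is at least \<open>2 B\<close>, where \<open>B\<close> bounds the function.\<close>
lemma quadratic_modulus_of_continuity:
  fixes f :: "'a::metric_space \<Rightarrow> real"
  assumes S: "compact S" and f: "continuous_on S f" and e: "0 < e"
  obtains K where "0 \<le> K" "\<And>x y. x \<in> S \<Longrightarrow> y \<in> S \<Longrightarrow> \<bar>f x - f y\<bar> \<le> e + K * (dist x y)\<^sup>2"
proof -
  obtain d where d: "0 < d" "\<And>x y. x \<in> S \<Longrightarrow> y \<in> S \<Longrightarrow> dist y x < d \<Longrightarrow> \<bar>f y - f x\<bar> < e"
    using compact_uniformly_continuous[OF f S] e
    unfolding uniformly_continuous_on_def dist_real_def by metis
  obtain B where B: "\<And>x. x \<in> S \<Longrightarrow> \<bar>f x\<bar> \<le> B"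
    using compact_imp_bounded[OF compact_continuous_image[OF f S]] by (auto simp: bounded_iff)
  show thesis
  proof (rule that[of "2 * \<bar>B\<bar> / d\<^sup>2"])
    fix x y assume xy: "x \<in> S" "y \<in> S"
    show "\<bar>f x - f y\<bar> \<le> e + 2 * \<bar>B\<bar> / d\<^sup>2 * (dist x y)\<^sup>2"
    proof (cases "dist x y < d")
      case True
      then have "\<bar>f x - f y\<bar> < e" using d(2)[of y x] xy by (simp add: dist_commute)
      moreover have "0 \<le> 2 * \<bar>B\<bar> / d\<^sup>2 * (dist x y)\<^sup>2" by simp
      ultimately show ?thesis by linarith
    next
      case False
      then have "d\<^sup>2 \<le> (dist x y)\<^sup>2" using d(1) by (intro power_mono) auto
      then have "2 * \<bar>B\<bar> / d\<^sup>2 * d\<^sup>2 \<le> 2 * \<bar>B\<bar> / d\<^sup>2 * (dist x y)\<^sup>2"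
        by (intro mult_left_mono) auto
      then have "2 * \<bar>B\<bar> \<le> 2 * \<bar>B\<bar> / d\<^sup>2 * (dist x y)\<^sup>2" using d(1) by simp
      moreover have "\<bar>f x - f y\<bar> \<le> 2 * \<bar>B\<bar>" using B[OF xy(1)] B[OF xy(2)] by linarith
      ultimately show ?thesis using e by linarith
    qed
  qed simp
qed

section \<open>Continuous approximation of the boundary function\<close>
text \<open>A function of the angle jumps across the nonnegative real axis, where \<open>Arg2pi\<close> is discontinuous, and at
  the origin, which lies on that axis. The factor vanishes on the axis and so removes both discontinuities.\<close>
lemma continuous_cutoff_Arg2pi:
  fixes g :: "real \<Rightarrow> real"
  assumes g: "continuous_on UNIV g" and C: "\<And>t. \<bar>g t\<bar> \<le> C" and n: "0 \<le> n"
  shows "continuous_on UNIV (\<lambda>z. min 1 (n * infdist z \<real>\<^sub>\<ge>\<^sub>0) * g (Arg2pi z))"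
  unfolding continuous_on_eq_continuous_at[OF open_UNIV]
proof
  fix z :: complex
  have cont: "isCont (\<lambda>z. min 1 (n * infdist z (\<real>\<^sub>\<ge>\<^sub>0 :: complex set))) z"
    by (intro continuous_intros)
  show "isCont (\<lambda>z. min 1 (n * infdist z \<real>\<^sub>\<ge>\<^sub>0) * g (Arg2pi z)) z"
  proof (cases "z \<in> \<real>\<^sub>\<ge>\<^sub>0")
    case False
    have "isCont (\<lambda>z. g (Arg2pi z)) z"
      by (rule isCont_o2[OF continuous_at_Arg2pi[OF False]])
         (use g in \<open>simp add: continuous_on_eq_continuous_at\<close>)
    with cont show ?thesis by (rule continuous_mult)
  next
    case True
    have "((\<lambda>w. C * min 1 (n * infdist w (\<real>\<^sub>\<ge>\<^sub>0 :: complex set))) \<longlongrightarrow> C * min 1 (n * infdist z \<real>\<^sub>\<ge>\<^sub>0)) (at z)"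
      using cont unfolding isCont_def by (rule tendsto_mult_left)
    then have "((\<lambda>w. C * min 1 (n * infdist w (\<real>\<^sub>\<ge>\<^sub>0 :: complex set))) \<longlongrightarrow> 0) (at z)"
      using True by simp
    then have "((\<lambda>w. min 1 (n * infdist w \<real>\<^sub>\<ge>\<^sub>0) * g (Arg2pi w)) \<longlongrightarrow> 0) (at z)"
    proof (rule Lim_null_comparison[rotated], intro always_eventually allI)
      fix w :: complex
      have m: "0 \<le> min 1 (n * infdist w (\<real>\<^sub>\<ge>\<^sub>0 :: complex set))" using n by (simp add: infdist_nonneg)
      show "norm (min 1 (n * infdist w \<real>\<^sub>\<ge>\<^sub>0) * g (Arg2pi w)) \<le> C * min 1 (n * infdist w \<real>\<^sub>\<ge>\<^sub>0)"
        unfolding real_norm_def abs_mult abs_of_nonneg[OF m] mult.commute[of C]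
        by (rule mult_left_mono[OF C m])
    qed
    then show ?thesis using True by (simp add: isCont_def)
  qed
qed

lemma Arg2pi_cis: "0 \<le> \<theta> \<Longrightarrow> \<theta> < 2 * pi \<Longrightarrow> Arg2pi (cis \<theta>) = \<theta>"
  by (rule Arg2pi_unique[of 1]) (auto simp: cis_conv_exp)

lemma cis_not_nonneg_Real:
  assumes "0 < \<theta>" "\<theta> < 2 * pi" shows "cis \<theta> \<notin> \<real>\<^sub>\<ge>\<^sub>0"
proof
  assume "cis \<theta> \<in> \<real>\<^sub>\<ge>\<^sub>0"
  then obtain r where r: "cis \<theta> = of_real r" "0 \<le> r" by (auto elim!: nonneg_Reals_cases)
  then have "r = 1" using norm_cis[of \<theta>] by simp
  then have "Arg2pi (cis \<theta>) = 0" using r Arg2pi_cis[of 0] by simp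
  then show False using Arg2pi_cis[of \<theta>] assms by simp
qed

text \<open>A measurable function is almost everywhere the limit of continuous functions of \<open>\<theta>\<close>. Clamping and the
  cutoff make them bounded and continuous on the plane; the cutoff tends to \<open>1\<close> on the circle away from the
  point \<open>1\<close>, so dominated convergence applies.\<close>
lemma boundary_function_approximation:
  fixes L :: "real \<Rightarrow> real"
  assumes L: "L \<in> borel_measurable circle_measure"
    and LC: "AE \<theta> in circle_measure. \<bar>L \<theta>\<bar> \<le> C" and C: "0 \<le> C" and e: "0 < e"
  obtains G where "continuous_on UNIV G" "\<And>z. \<bar>G z\<bar> \<le> C"
    "(LINT \<theta>|circle_measure. (L \<theta> - G (cis \<theta>))\<^sup>2) < e"
proof -
  let ?S = "{0..<2 * pi}"
  have S: "?S \<in> sets lebesgue" by simp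
  have "(\<lambda>\<theta>. if \<theta> \<in> ?S then L \<theta> else 0) \<in> borel_measurable lebesgue"
    using L by (subst (asm) borel_measurable_if[symmetric]) auto
  then have "(\<lambda>\<theta>. if \<theta> \<in> ?S then L \<theta> else 0) measurable_on ?S"
    by (rule lebesgue_measurable_imp_measurable_on) simp
  then obtain Z g where Z: "negligible Z" and g: "\<And>n. continuous_on UNIV (g n)"
    and lim: "\<And>\<theta>. \<theta> \<notin> Z \<Longrightarrow> (\<lambda>n. g n \<theta>) \<longlonglongrightarrow> (if \<theta> \<in> ?S then if \<theta> \<in> ?S then L \<theta> else 0 else 0)"
    unfolding measurable_on_def by blast
  define h where "h n t = max (- C) (min C (g n t))" for n :: nat and t
  have h: "continuous_on UNIV (h n)" "\<bar>h n t\<bar> \<le> C" for n t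
    using g C unfolding h_def by (auto intro!: continuous_intros)
  define G where "G n z = min 1 (real n * infdist z \<real>\<^sub>\<ge>\<^sub>0) * h n (Arg2pi z)" for n z
  have G: "continuous_on UNIV (G n)" for n
    unfolding G_def by (rule continuous_cutoff_Arg2pi[OF h]) simp
  have GC: "\<bar>G n z\<bar> \<le> C" for n z
  proof -
    have "0 \<le> min 1 (real n * infdist z (\<real>\<^sub>\<ge>\<^sub>0 :: complex set))" by (simp add: infdist_nonneg)
    then have "\<bar>G n z\<bar> \<le> 1 * C"
      unfolding G_def abs_mult by (intro mult_mono h) auto
    then show ?thesis by simp
  qed
  interpret finite_measure "lebesgue_on ?S"
    by (intro finite_measure_lebesgue_on bounded_set_imp_lmeasurable) auto
  have Gm: "(\<lambda>\<theta>. G n (cis \<theta>)) \<in> borel_measurable (lebesgue_on ?S)" for n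
  proof -
    have "continuous_on UNIV (\<lambda>\<theta>. G n (cis \<theta>))"
      by (intro continuous_on_compose2[OF G] continuous_intros) auto
    then show ?thesis
      by (intro measurable_restrict_space1 measurable_completion) (simp add: borel_measurable_continuous_onI)
  qed
  have "(\<lambda>n. LINT \<theta>|lebesgue_on ?S. (L \<theta> - G n (cis \<theta>))\<^sup>2) \<longlonglongrightarrow> (LINT \<theta>|lebesgue_on ?S. 0)"
  proof (rule integral_dominated_convergence[where w = "\<lambda>_. (2 * C)\<^sup>2"])
    show "(\<lambda>\<theta>. (L \<theta> - G n (cis \<theta>))\<^sup>2) \<in> borel_measurable (lebesgue_on ?S)" for n
      using L Gm by measurable
    show "integrable (lebesgue_on ?S) (\<lambda>_. (2 * C)\<^sup>2)" by (rule integrable_const)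
    show "AE \<theta> in lebesgue_on ?S. norm ((L \<theta> - G n (cis \<theta>))\<^sup>2) \<le> (2 * C)\<^sup>2" for n
      using LC
    proof eventually_elim
      case (elim \<theta>)
      have "\<bar>L \<theta> - G n (cis \<theta>)\<bar> \<le> 2 * C" using elim GC[of n "cis \<theta>"] by linarith
      from power_mono[OF this abs_ge_zero, of 2] show ?case by simp
    qed
    have "AE \<theta> in lebesgue. \<theta> \<notin> Z \<union> {0}"
      using Z by (intro AE_not_in) (simp add: negligible_iff_null_sets[symmetric])
    then have "AE \<theta> in lebesgue. \<theta> \<in> ?S \<longrightarrow> \<theta> \<notin> Z \<union> {0}" by eventually_elim simp
    then have "AE \<theta> in lebesgue_on ?S. \<theta> \<notin> Z \<union> {0}"
      by (subst AE_restrict_space_iff) auto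
    moreover have "AE \<theta> in lebesgue_on ?S. \<theta> \<in> ?S" by (rule AE_I2) simp
    ultimately show "AE \<theta> in lebesgue_on ?S. (\<lambda>n. (L \<theta> - G n (cis \<theta>))\<^sup>2) \<longlonglongrightarrow> 0"
      using LC
    proof eventually_elim
      case (elim \<theta>)
      then have \<theta>: "0 < \<theta>" "\<theta> < 2 * pi" "\<theta> \<notin> Z" by auto
      have "(\<lambda>n. g n \<theta>) \<longlonglongrightarrow> L \<theta>" using lim[OF \<theta>(3)] \<theta> by simp
      then have "(\<lambda>n. h n \<theta>) \<longlonglongrightarrow> max (- C) (min C (L \<theta>))"
        unfolding h_def by (intro tendsto_intros)
      also have "max (- C) (min C (L \<theta>)) = L \<theta>" using elim by auto
      finally have hl: "(\<lambda>n. h n \<theta>) \<longlonglongrightarrow> L \<theta>" .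
      define \<delta> where "\<delta> = infdist (cis \<theta>) \<real>\<^sub>\<ge>\<^sub>0"
      have "\<delta> \<noteq> 0"
        unfolding \<delta>_def using in_closed_iff_infdist_zero[of "\<real>\<^sub>\<ge>\<^sub>0 :: complex set" "cis \<theta>"]
          closed_nonneg_Reals_complex cis_not_nonneg_Real[OF \<theta>(1,2)] nonneg_Reals_zero_I by blast
      then have "\<delta> > 0" using infdist_nonneg[of "cis \<theta>" "\<real>\<^sub>\<ge>\<^sub>0"] by (simp add: \<delta>_def)
      then obtain n0 where n0: "1 \<le> real n0 * \<delta>"
        using reals_Archimedean3[of \<delta>] by (metis less_eq_real_def)
      have "eventually (\<lambda>n. G n (cis \<theta>) = h n \<theta>) sequentially"
      proof (rule eventually_sequentiallyI[of n0])
        fix n assume "n0 \<le> n"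
        then have "real n0 * \<delta> \<le> real n * \<delta>" using \<open>\<delta> > 0\<close> by simp
        then have "1 \<le> real n * \<delta>" using n0 by linarith
        then show "G n (cis \<theta>) = h n \<theta>"
          using \<theta> by (simp add: G_def \<delta>_def[symmetric] Arg2pi_cis)
      qed
      then have "(\<lambda>n. G n (cis \<theta>)) \<longlonglongrightarrow> L \<theta>" using hl by (simp add: tendsto_cong)
      then have "(\<lambda>n. (L \<theta> - G n (cis \<theta>))\<^sup>2) \<longlonglongrightarrow> (L \<theta> - L \<theta>)\<^sup>2" by (intro tendsto_intros)
      then show ?case by simp
    qed
  qed simp
  then have "(\<lambda>n. LINT \<theta>|lebesgue_on ?S. (L \<theta> - G n (cis \<theta>))\<^sup>2) \<longlonglongrightarrow> 0" by simp
  then have "\<exists>n. (LINT \<theta>|lebesgue_on ?S. (L \<theta> - G n (cis \<theta>))\<^sup>2) < e"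
    using order_tendstoD(2)[OF _ e] eventually_happens'[OF sequentially_bot] by blast
  then show thesis using that G GC by blast
qed

section \<open>Distribution of the eigenvalues\<close>
lemma integrable_bounded_times_norm:
  fixes h :: "complex \<Rightarrow> real"
  assumes [measurable]: "h \<in> borel_measurable disc_measure"
    and B: "\<And>z. z \<in> ball 0 1 \<Longrightarrow> \<bar>h z\<bar> \<le> B" and f: "f \<in> L2_disc"
  shows "integrable disc_measure (\<lambda>z. h z * (cmod (f z))\<^sup>2)"
proof -
  note [measurable] = L2_discD(1)[OF f]
  show ?thesis
  proof (rule Bochner_Integration.integrable_bound)
    show "integrable disc_measure (\<lambda>z. B * (cmod (f z))\<^sup>2)"
      using L2_discD(2)[OF f] by simp
    show "AE z in disc_measure. norm (h z * (cmod (f z))\<^sup>2) \<le> norm (B * (cmod (f z))\<^sup>2)"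
    proof (rule AE_I2)
      fix z assume "z \<in> space disc_measure"
      then have "\<bar>h z\<bar> \<le> \<bar>B\<bar>" using B[of z] by simp
      then show "norm (h z * (cmod (f z))\<^sup>2) \<le> norm (B * (cmod (f z))\<^sup>2)"
        by (simp add: abs_mult mult_right_mono)
    qed
  qed measurable
qed

lemma L2_norm_1: "L2_inner f f = 1 \<Longrightarrow> (LINT z|disc_measure. (cmod (f z))\<^sup>2) = 1"
  by (simp add: L2_inner_self)

lemma integral_boundary_weight_disc: "(LINT z|disc_measure. boundary_weight N ((cmod z)\<^sup>2)) = 1"
proof -
  have "real (N + 1) * (LINT z|disc_measure. boundary_weight N ((cmod z)\<^sup>2))
      = (LINT z|disc_measure. (\<Sum>n\<le>N. (cmod (bergman_basis n z))\<^sup>2))"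
    using integral_times_kernel_diagonal[of "\<lambda>_. 1" N] by simp
  also have "\<dots> = (\<Sum>n\<le>N. LINT z|disc_measure. (cmod (bergman_basis n z))\<^sup>2)"
    by (rule Bochner_Integration.integral_sum) (rule L2_discD(2)[OF bergman_basis_L2])
  also have "\<dots> = real (N + 1)"
    by (simp add: L2_norm_1 L2_inner_bergman_basis)
  finally show ?thesis by simp
qed

context bounded_symbol
begin

abbreviation energy :: "nat \<Rightarrow> real" where
  "energy N \<equiv> kernel_energy N bergman_basis (\<lambda>z. of_real (\<sigma> z))"

lemma bounded_on_disc_symbol: "bounded_on_disc (\<lambda>z. of_real (\<sigma> z))"
  unfolding bounded_on_disc_def using symbol_bound by (auto intro!: exI[of _ C])

text \<open>The difference \<open>\<sigma> z - \<sigma> w\<close> is split into \<open>\<sigma> - G\<close> at \<open>z\<close>, the oscillation of \<open>G\<close>, and \<open>G - \<sigma>\<close>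
  at \<open>w\<close>. The outer terms see only the diagonal of the kernel, and the oscillation of \<open>G\<close> is dominated by a
  constant and the oscillation of the identity, whose energy is at most \<open>2\<close>.\<close>
lemma energy_le_approximation:
  assumes G: "continuous_on UNIV G" "\<And>z. \<bar>G z\<bar> \<le> C"
    and mod: "\<And>z w. z \<in> ball 0 1 \<Longrightarrow> w \<in> ball 0 1 \<Longrightarrow> (G z - G w)\<^sup>2 \<le> e + K * (dist z w)\<^sup>2"
    and K: "0 \<le> K"
  shows "energy N / real (N + 1)
    \<le> 6 * (LINT z|disc_measure. (\<sigma> z - G z)\<^sup>2 * boundary_weight N ((cmod z)\<^sup>2)) + 3 * e + 6 * K / real (N + 1)"
proof -
  define k where "k x = (cmod (reproducing_kernel N bergman_basis (fst x) (snd x)))\<^sup>2" for x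
  define d where "d z = (\<sigma> z - G z)\<^sup>2" for z
  have [measurable]: "G \<in> borel_measurable disc_measure"
    using G(1) by (intro borel_measurable_disc borel_measurable_continuous_onI)
  have dB: "\<bar>d z\<bar> \<le> (2 * C)\<^sup>2" if "z \<in> ball 0 1" for z
  proof -
    have "\<bar>\<sigma> z - G z\<bar> \<le> 2 * C" using symbol_bound[OF that] G(2)[of z] by linarith
    from power_mono[OF this abs_ge_zero, of 2] show ?thesis by (simp add: d_def)
  qed
  have d: "bounded_on_disc (\<lambda>z. of_real (d z))"
    unfolding bounded_on_disc_def
  proof (intro conjI exI ballI)
    show "(\<lambda>z. complex_of_real (d z)) \<in> borel_measurable disc_measure" unfolding d_def by measurable
    show "cmod (of_real (d z)) \<le> (2 * C)\<^sup>2" if "z \<in> ball 0 1" for z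
      unfolding norm_of_real by (rule dB[OF that])
  qed
  have one: "bounded_on_disc (\<lambda>z. of_real 1)" by (rule bounded_on_disc_const)
  note i = kernel_marginal_integrable[where g = bergman_basis and N = N, OF bergman_basis_L2 L2_inner_bergman_basis, folded k_def]
  note m = kernel_marginal[where g = bergman_basis and N = N, OF bergman_basis_L2 L2_inner_bergman_basis, folded k_def]
  note ie = kernel_energy_integrable[where g = bergman_basis and N = N, OF bergman_basis_L2 L2_inner_bergman_basis, folded k_def]
  note i1 = i(1)[OF d] note i2 = i(2)[OF d] note i3 = i(1)[OF one] note i4 = ie[OF bounded_on_disc_id]
  have "energy N
      \<le> (LINT x|disc_pair. (3 * (d (fst x) * k x) + 3 * (d (snd x) * k x))
          + (3 * e * (1 * k x) + 3 * K * ((cmod (fst x - snd x))\<^sup>2 * k x)))"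
    unfolding kernel_energy_def k_def[symmetric]
  proof (rule integral_mono)
    show "integrable disc_pair (\<lambda>x. (cmod (of_real (\<sigma> (fst x)) - of_real (\<sigma> (snd x))))\<^sup>2 * k x)"
      by (rule ie[OF bounded_on_disc_symbol])
    show "integrable disc_pair (\<lambda>x. (3 * (d (fst x) * k x) + 3 * (d (snd x) * k x))
          + (3 * e * (1 * k x) + 3 * K * ((cmod (fst x - snd x))\<^sup>2 * k x)))"
      by (intro Bochner_Integration.integrable_add integrable_mult_right i1 i2 i3 i4)
    fix x assume "x \<in> space disc_pair"
    then have x: "fst x \<in> ball 0 1" "snd x \<in> ball 0 1" by (auto simp: space_pair_measure)
    define a where "a = \<sigma> (fst x) - G (fst x)"
    define b where "b = G (fst x) - G (snd x)"
    define c where "c = G (snd x) - \<sigma> (snd x)"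
    have "(a + b + c)\<^sup>2 \<le> 3 * (a\<^sup>2 + b\<^sup>2 + c\<^sup>2)"
      using sum_squares_bound[of a b] sum_squares_bound[of a c] sum_squares_bound[of b c]
      by (simp add: power2_eq_square algebra_simps)
    also have "b\<^sup>2 \<le> e + K * (cmod (fst x - snd x))\<^sup>2"
      using mod[OF x] by (simp add: b_def dist_norm)
    finally have "(a + b + c)\<^sup>2 \<le> 3 * (d (fst x) + (e + K * (cmod (fst x - snd x))\<^sup>2) + d (snd x))"
      by (simp add: a_def c_def d_def power2_commute[of "G (snd x)"])
    then have "(\<sigma> (fst x) - \<sigma> (snd x))\<^sup>2 * k x
        \<le> (3 * (d (fst x) + (e + K * (cmod (fst x - snd x))\<^sup>2) + d (snd x))) * k x"
      by (intro mult_right_mono) (auto simp: a_def b_def c_def k_def)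
    then show "(cmod (of_real (\<sigma> (fst x)) - of_real (\<sigma> (snd x))))\<^sup>2 * k x
        \<le> (3 * (d (fst x) * k x) + 3 * (d (snd x) * k x))
          + (3 * e * (1 * k x) + 3 * K * ((cmod (fst x - snd x))\<^sup>2 * k x))"
      by (simp add: algebra_simps flip: of_real_diff)
  qed
  also have "\<dots> = (3 * (LINT x|disc_pair. d (fst x) * k x) + 3 * (LINT x|disc_pair. d (snd x) * k x))
      + (3 * e * (LINT x|disc_pair. 1 * k x) + 3 * K * (LINT x|disc_pair. (cmod (fst x - snd x))\<^sup>2 * k x))"
    using i1 i2 i3 i4 by simp
  also have "(LINT x|disc_pair. (cmod (fst x - snd x))\<^sup>2 * k x) = kernel_energy N bergman_basis (\<lambda>z. z)"
    by (simp add: kernel_energy_def k_def)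
  also have "(3 * (LINT x|disc_pair. d (fst x) * k x) + 3 * (LINT x|disc_pair. d (snd x) * k x))
      + (3 * e * (LINT x|disc_pair. 1 * k x) + 3 * K * kernel_energy N bergman_basis (\<lambda>z. z))
    \<le> (3 * (LINT x|disc_pair. d (fst x) * k x) + 3 * (LINT x|disc_pair. d (snd x) * k x))
      + (3 * e * (LINT x|disc_pair. 1 * k x) + 3 * K * 2)"
    using kernel_energy_identity[of N] K by (intro add_left_mono mult_left_mono) auto
  also have "(LINT x|disc_pair. d (fst x) * k x) = real (N + 1) * (LINT z|disc_measure. d z * boundary_weight N ((cmod z)\<^sup>2))"
    unfolding m(1)[OF d] by (rule integral_times_kernel_diagonal)
  also have "(LINT x|disc_pair. d (snd x) * k x) = real (N + 1) * (LINT z|disc_measure. d z * boundary_weight N ((cmod z)\<^sup>2))"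
    unfolding m(2)[OF d] by (rule integral_times_kernel_diagonal)
  also have "(LINT x|disc_pair. 1 * k x) = real (N + 1)"
    unfolding m(1)[OF one] integral_times_kernel_diagonal by (simp add: integral_boundary_weight_disc)
  finally have "energy N
      \<le> (6 * (LINT z|disc_measure. d z * boundary_weight N ((cmod z)\<^sup>2)) + 3 * e) * real (N + 1) + 6 * K"
    by (simp add: algebra_simps)
  then have "energy N / real (N + 1)
      \<le> ((6 * (LINT z|disc_measure. d z * boundary_weight N ((cmod z)\<^sup>2)) + 3 * e) * real (N + 1) + 6 * K) / real (N + 1)"
    by (rule divide_right_mono) simp
  also have "\<dots> = 6 * (LINT z|disc_measure. d z * boundary_weight N ((cmod z)\<^sup>2)) + 3 * e + 6 * K / real (N + 1)"
    by (simp add: add_divide_distrib)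
  finally show ?thesis unfolding d_def .
qed

text \<open>The bound \<open>energy_le_approximation\<close> is applied to a \<open>G\<close> that is close in the mean square to the radial
  limit on the circle. By concentration at the boundary the weighted mean of \<open>(\<sigma> - G)\<^sup>2\<close> over the disc is then eventually small.\<close>
lemma energy_density_tendsto_0:
  assumes L: "AE \<theta> in circle_measure. ((\<lambda>r. \<sigma> (of_real r * cis \<theta>)) \<longlongrightarrow> L \<theta>) (at_left 1)"
  shows "(\<lambda>N. energy N / real (N + 1)) \<longlonglongrightarrow> 0"
proof (rule LIMSEQ_I)
  fix \<epsilon> :: real assume \<epsilon>: "0 < \<epsilon>"
  \<comment> \<open>The three contributions below add up to \<open>6 e + 3 e + e < \<epsilon>\<close>.\<close>
  define e where "e = \<epsilon> / 16"
  have e: "0 < e" using \<epsilon> by (simp add: e_def)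
  have C: "0 \<le> C" using symbol_bound[of 0] by simp
  have Lm: "L \<in> borel_measurable circle_measure"
    by (rule boundary_concentration(1)[OF measurable_symbol symbol_bound L])
  have in_disc: "eventually (\<lambda>r. of_real r * cis \<theta> \<in> ball (0::complex) 1) (at_left 1)" for \<theta>
    using eventually_at_left_real[OF zero_less_one] by (rule eventually_mono) (auto simp: norm_mult)
  have LC: "AE \<theta> in circle_measure. \<bar>L \<theta>\<bar> \<le> C"
    using L
  proof eventually_elim
    case (elim \<theta>)
    then have "((\<lambda>r. \<bar>\<sigma> (of_real r * cis \<theta>)\<bar>) \<longlongrightarrow> \<bar>L \<theta>\<bar>) (at_left 1)" by (rule tendsto_rabs)
    then show ?case
      by (rule tendsto_upperbound) (use in_disc[of \<theta>] in \<open>auto elim!: eventually_mono intro!: symbol_bound\<close>)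
  qed
  obtain G where G: "continuous_on UNIV G" "\<And>z. \<bar>G z\<bar> \<le> C"
    and Ge: "(LINT \<theta>|circle_measure. (L \<theta> - G (cis \<theta>))\<^sup>2) < e"
    using boundary_function_approximation[OF Lm LC C e] by blast
  \<comment> \<open>Squaring the oscillation of \<open>G\<close> costs a factor \<open>2 C\<close>; the summand \<open>1\<close> keeps the divisor positive when
      \<open>C = 0\<close>.\<close>
  obtain K0 where K0: "0 \<le> K0"
    "\<And>z w. z \<in> cball 0 1 \<Longrightarrow> w \<in> cball 0 1 \<Longrightarrow> \<bar>G z - G w\<bar> \<le> e / (2 * C + 1) + K0 * (dist z w)\<^sup>2"
    using quadratic_modulus_of_continuity[of "cball (0::complex) 1" G "e / (2 * C + 1)"] C e
      continuous_on_subset[OF G(1)] by auto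
  define K where "K = (2 * C + 1) * K0"
  have mod: "(G z - G w)\<^sup>2 \<le> e + K * (dist z w)\<^sup>2" if "z \<in> ball 0 1" "w \<in> ball 0 1" for z w
  proof -
    have "(G z - G w)\<^sup>2 = \<bar>G z - G w\<bar> * \<bar>G z - G w\<bar>" by (simp add: power2_eq_square)
    also have "\<dots> \<le> (2 * C + 1) * (e / (2 * C + 1) + K0 * (dist z w)\<^sup>2)"
      using G(2)[of z] G(2)[of w] that by (intro mult_mono K0(2)) (auto simp: C)
    also have "\<dots> = e + K * (dist z w)\<^sup>2" using C by (simp add: K_def field_simps)
    finally show ?thesis .
  qed
  have K: "0 \<le> K" using C K0(1) by (simp add: K_def)
  have "(\<lambda>N. LINT z|disc_measure. (\<sigma> z - G z)\<^sup>2 * boundary_weight N ((cmod z)\<^sup>2))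
      \<longlonglongrightarrow> (LINT \<theta>|circle_measure. (L \<theta> - G (cis \<theta>))\<^sup>2) / (2 * pi)"
  proof (rule boundary_concentration(2))
    have "G \<in> borel_measurable (lebesgue_on (ball 0 1))"
      by (intro measurable_restrict_space1 measurable_completion)
         (simp add: borel_measurable_continuous_onI[OF G(1)])
    then show "(\<lambda>z. (\<sigma> z - G z)\<^sup>2) \<in> borel_measurable (lebesgue_on (ball 0 1))"
      using measurable_symbol by measurable
    show "\<bar>(\<sigma> z - G z)\<^sup>2\<bar> \<le> (2 * C)\<^sup>2" if "z \<in> ball 0 1" for z
    proof -
      have "\<bar>\<sigma> z - G z\<bar> \<le> 2 * C" using symbol_bound[OF that] G(2)[of z] by linarith
      from power_mono[OF this abs_ge_zero, of 2] show ?thesis by simp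
    qed
    show "AE \<theta> in circle_measure.
        ((\<lambda>r. (\<sigma> (of_real r * cis \<theta>) - G (of_real r * cis \<theta>))\<^sup>2) \<longlongrightarrow> (L \<theta> - G (cis \<theta>))\<^sup>2) (at_left 1)"
      using L
    proof eventually_elim
      case (elim \<theta>)
      have "continuous_on UNIV (\<lambda>r::real. G (of_real r * cis \<theta>))"
        by (intro continuous_on_compose2[OF G(1)] continuous_intros) auto
      then have "isCont (\<lambda>r::real. G (of_real r * cis \<theta>)) 1"
        by (simp add: continuous_on_eq_continuous_at)
      then have "((\<lambda>r::real. G (of_real r * cis \<theta>)) \<longlongrightarrow> G (of_real 1 * cis \<theta>)) (at_left 1)"
        unfolding isCont_def by (rule filterlim_mono) (auto simp: at_le)
      with elim show ?case by (intro tendsto_intros) auto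
    qed
  qed
  moreover have "(LINT \<theta>|circle_measure. (L \<theta> - G (cis \<theta>))\<^sup>2) / (2 * pi) < e"
  proof -
    have "0 \<le> (LINT \<theta>|circle_measure. (L \<theta> - G (cis \<theta>))\<^sup>2)"
      by (rule integral_nonneg_AE) simp
    then have "(LINT \<theta>|circle_measure. (L \<theta> - G (cis \<theta>))\<^sup>2) / (2 * pi)
        \<le> (LINT \<theta>|circle_measure. (L \<theta> - G (cis \<theta>))\<^sup>2) / 1"
      using pi_gt3 by (intro divide_left_mono) auto
    with Ge show ?thesis by simp
  qed
  ultimately have "eventually (\<lambda>N. (LINT z|disc_measure. (\<sigma> z - G z)\<^sup>2 * boundary_weight N ((cmod z)\<^sup>2)) < e) sequentially"
    by (rule order_tendstoD(2))
  moreover have "eventually (\<lambda>N. 6 * K / real (N + 1) < e) sequentially"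
  proof -
    have "(\<lambda>N. 6 * K / real (N + 1)) \<longlonglongrightarrow> 0" by real_asymp
    from order_tendstoD(2)[OF this e] show ?thesis .
  qed
  ultimately have "eventually (\<lambda>N. energy N / real (N + 1) < \<epsilon>) sequentially"
  proof eventually_elim
    case (elim N)
    have "energy N / real (N + 1) \<le> 6 * e + 3 * e + e"
      using energy_le_approximation[OF G mod K, of N] elim by linarith
    also have "\<dots> < \<epsilon>" using \<epsilon> by (simp add: e_def)
    finally show ?case .
  qed
  moreover have "0 \<le> energy N / real (N + 1)" for N
    unfolding kernel_energy_def by (intro divide_nonneg_nonneg integral_nonneg_AE) auto
  ultimately show "\<exists>N0. \<forall>N\<ge>N0. norm (energy N / real (N + 1) - 0) < \<epsilon>"
    by (simp only: eventually_sequentially real_norm_def diff_0_right abs_of_nonneg)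
qed

end

context toeplitz_eigenbasis
begin

lemma eigenfunction_norm: "p \<le> N \<Longrightarrow> (LINT z|disc_measure. (cmod (eigenfunction p z))\<^sup>2) = 1"
  by (simp add: L2_norm_1 eigenfunction_orthonormal)

text \<open>The squared modulus of a normalised eigenfunction is a probability density, and the eigenvalue is the mean of
  the symbol under it. In particular it lies between the bounds of the symbol.\<close>
lemma eigenvalue_eq_mean:
  assumes "p \<le> N" shows "l p = (LINT z|disc_measure. \<sigma> z * (cmod (eigenfunction p z))\<^sup>2)"
proof -
  have "complex_of_real (l p) = L2_inner (\<lambda>z. of_real (\<sigma> z) * eigenfunction p z) (eigenfunction p)"
    using assms by (simp add: symbol_eigenfunction)
  also have "\<dots> = (LINT z|disc_measure. complex_of_real (\<sigma> z * (cmod (eigenfunction p z))\<^sup>2))"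
    by (simp only: L2_inner_def of_real_mult complex_norm_square mult.assoc)
  also have "\<dots> = complex_of_real (LINT z|disc_measure. \<sigma> z * (cmod (eigenfunction p z))\<^sup>2)"
    by (rule integral_complex_of_real)
  finally show ?thesis by (simp only: of_real_eq_iff)
qed

lemma eigenvalue_bounds:
  assumes p: "p \<le> N" and m: "\<And>z. z \<in> ball 0 1 \<Longrightarrow> m \<le> \<sigma> z" and M: "\<And>z. z \<in> ball 0 1 \<Longrightarrow> \<sigma> z \<le> M"
  shows "m \<le> l p" "l p \<le> M"
proof -
  have i: "integrable disc_measure (\<lambda>z. \<sigma> z * (cmod (eigenfunction p z))\<^sup>2)"
    by (rule integrable_bounded_times_norm[OF symbol_measurable symbol_bound eigenfunction_L2])
  have c: "integrable disc_measure (\<lambda>z. c * (cmod (eigenfunction p z))\<^sup>2)" for c :: real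
    using L2_discD(2)[OF eigenfunction_L2] by simp
  have v: "(LINT z|disc_measure. c * (cmod (eigenfunction p z))\<^sup>2) = c" for c :: real
    by (simp add: eigenfunction_norm[OF p])
  have "(LINT z|disc_measure. m * (cmod (eigenfunction p z))\<^sup>2) \<le> l p"
    unfolding eigenvalue_eq_mean[OF p] by (intro integral_mono c i mult_right_mono m) auto
  then show "m \<le> l p" by (simp only: v)
  have "l p \<le> (LINT z|disc_measure. M * (cmod (eigenfunction p z))\<^sup>2)"
    unfolding eigenvalue_eq_mean[OF p] by (intro integral_mono c i mult_right_mono M) auto
  then show "l p \<le> M" by (simp only: v)
qed

lemma eigenvalue_variance:
  assumes p: "p \<le> N"
  shows "(LINT z|disc_measure. (\<sigma> z - l p)\<^sup>2 * (cmod (eigenfunction p z))\<^sup>2)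
    = (LINT z|disc_measure. (cmod (of_real (\<sigma> z) * eigenfunction p z))\<^sup>2) - (l p)\<^sup>2"
proof -
  let ?f = "eigenfunction p" and ?s = "\<lambda>z. complex_of_real (\<sigma> z) * eigenfunction p z"
  note f = eigenfunction_L2[of p] and s = symbol_mult_L2[OF eigenfunction_L2[of p]]
  note lf = L2_disc_cmult[OF f, of "of_real (l p)"]
  let ?d = "\<lambda>z. ?s z - of_real (l p) * ?f z"
  have d: "?d \<in> L2_disc" by (rule L2_disc_diff[OF s lf])
  have sf: "L2_inner ?s ?f = of_real (l p)" using symbol_eigenfunction[OF p p] by simp
  have fs: "L2_inner ?f ?s = of_real (l p)" by (subst L2_inner_commute) (simp add: sf)
  have ff: "L2_inner ?f ?f = 1" using p by (simp add: eigenfunction_orthonormal)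
  have eq: "(\<sigma> z - l p)\<^sup>2 * (cmod (?f z))\<^sup>2 = (cmod (?d z))\<^sup>2" for z
    by (simp add: left_diff_distrib[symmetric] norm_mult power_mult_distrib flip: of_real_diff)
  have "complex_of_real (LINT z|disc_measure. (\<sigma> z - l p)\<^sup>2 * (cmod (?f z))\<^sup>2) = L2_inner ?d ?d"
    unfolding eq by (rule L2_inner_self[symmetric])
  also have "\<dots> = L2_inner ?s ?s - of_real ((l p)\<^sup>2)"
    unfolding L2_inner_diff_left[OF s lf d] L2_inner_diff_right[OF s lf s] L2_inner_diff_right[OF s lf lf]
      L2_inner_cmult_left L2_inner_cmult_right sf fs ff
    by (simp add: power2_eq_square)
  also have "\<dots> = complex_of_real ((LINT z|disc_measure. (cmod (?s z))\<^sup>2) - (l p)\<^sup>2)"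
    by (simp only: L2_inner_self of_real_diff)
  finally show ?thesis by (simp only: of_real_eq_iff)
qed

lemma kernel_eq: "reproducing_kernel N eigenfunction = reproducing_kernel N bergman_basis"
  by (simp add: fun_eq_iff reproducing_kernel_def eigenfunction_kernel)

text \<open>In the eigenbasis the matrix of multiplication by \<open>\<sigma>\<close> is diagonal, so the energy is twice the sum of the
  second moments of \<open>\<sigma>\<close> minus the squared means.\<close>
lemma sum_variance_eq_energy:
  "(\<Sum>p\<le>N. LINT z|disc_measure. (\<sigma> z - l p)\<^sup>2 * (cmod (eigenfunction p z))\<^sup>2)
    = energy N / 2"
proof -
  have "energy N = kernel_energy N eigenfunction (\<lambda>z. of_real (\<sigma> z))"
    by (simp add: kernel_energy_def kernel_eq)
  also have "\<dots> = 2 * (\<Sum>p\<le>N. (LINT z|disc_measure. (cmod (of_real (\<sigma> z) * eigenfunction p z))\<^sup>2)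
        - (\<Sum>q\<le>N. (cmod (L2_inner (\<lambda>z. of_real (\<sigma> z) * eigenfunction p z) (eigenfunction q)))\<^sup>2))"
    by (rule kernel_energy_eq[where g = eigenfunction, OF eigenfunction_L2 eigenfunction_orthonormal bounded_on_disc_symbol])
  also have "(\<Sum>p\<le>N. (LINT z|disc_measure. (cmod (of_real (\<sigma> z) * eigenfunction p z))\<^sup>2)
        - (\<Sum>q\<le>N. (cmod (L2_inner (\<lambda>z. of_real (\<sigma> z) * eigenfunction p z) (eigenfunction q)))\<^sup>2))
      = (\<Sum>p\<le>N. LINT z|disc_measure. (\<sigma> z - l p)\<^sup>2 * (cmod (eigenfunction p z))\<^sup>2)"
  proof (intro sum.cong refl)
    fix p assume "p \<in> {..N}"
    then have p: "p \<le> N" by simp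
    have "(\<Sum>q\<le>N. (cmod (L2_inner (\<lambda>z. of_real (\<sigma> z) * eigenfunction p z) (eigenfunction q)))\<^sup>2)
        = (\<Sum>q\<le>N. if q = p then (l p)\<^sup>2 else 0)"
      by (intro sum.cong refl) (auto simp: symbol_eigenfunction p)
    then show "(LINT z|disc_measure. (cmod (of_real (\<sigma> z) * eigenfunction p z))\<^sup>2)
        - (\<Sum>q\<le>N. (cmod (L2_inner (\<lambda>z. of_real (\<sigma> z) * eigenfunction p z) (eigenfunction q)))\<^sup>2)
      = (LINT z|disc_measure. (\<sigma> z - l p)\<^sup>2 * (cmod (eigenfunction p z))\<^sup>2)"
      using p by (simp add: eigenvalue_variance)
  qed
  finally show ?thesis by simp
qed

lemma sum_eigenfunction_norm:
  "(\<Sum>p\<le>N. (cmod (eigenfunction p z))\<^sup>2) = (\<Sum>n\<le>N. (cmod (bergman_basis n z))\<^sup>2)"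
proof -
  have "complex_of_real (\<Sum>p\<le>N. (cmod (eigenfunction p z))\<^sup>2) = complex_of_real (\<Sum>n\<le>N. (cmod (bergman_basis n z))\<^sup>2)"
    unfolding of_real_sum complex_norm_square by (rule eigenfunction_kernel)
  then show ?thesis by (simp only: of_real_eq_iff)
qed

text \<open>For each eigenfunction \<open>\<psi>\<close> of the mean of \<open>\<sigma>\<close> differs from the mean of \<open>\<psi> \<circ> \<sigma>\<close> by at most \<open>e\<close> plus
  \<open>K\<close> times the variance of \<open>\<sigma>\<close>. Summing, the variances add up to half the energy and the densities to the
  diagonal of the kernel.\<close>
lemma eigenvalue_sum_close:
  assumes \<psi>: "continuous_on UNIV \<psi>"
    and mod: "\<And>x y. x \<in> {m..M} \<Longrightarrow> y \<in> {m..M} \<Longrightarrow> \<bar>\<psi> x - \<psi> y\<bar> \<le> e + K * (dist x y)\<^sup>2"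
    and range: "\<And>z. z \<in> ball 0 1 \<Longrightarrow> \<sigma> z \<in> {m..M}"
  shows "\<bar>(\<Sum>p\<le>N. \<psi> (l p)) / real (N + 1)
      - (LINT z|disc_measure. \<psi> (\<sigma> z) * boundary_weight N ((cmod z)\<^sup>2))\<bar>
    \<le> e + K * (energy N / real (N + 1)) / 2"
proof -
  define B where "B = (SUP x\<in>{m..M}. \<bar>\<psi> x\<bar>)"
  have "compact ((\<lambda>x. \<bar>\<psi> x\<bar>) ` {m..M})"
    by (intro compact_continuous_image continuous_intros continuous_on_subset[OF \<psi>]) auto
  then have B: "\<bar>\<psi> x\<bar> \<le> B" if "x \<in> {m..M}" for x
    unfolding B_def using that by (intro cSUP_upper) (auto intro: bounded_imp_bdd_above compact_imp_bounded)
  have \<psi>m[measurable]: "\<psi> \<in> borel_measurable borel" using \<psi> by (rule borel_measurable_continuous_onI)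
  have [measurable]: "(\<lambda>z. \<psi> (\<sigma> z)) \<in> borel_measurable disc_measure" by measurable
  note fL = eigenfunction_L2
  have i1: "integrable disc_measure (\<lambda>z. \<psi> (\<sigma> z) * (cmod (eigenfunction p z))\<^sup>2)" for p
    by (rule integrable_bounded_times_norm[where B = B]) (use B range fL in auto)
  have lr: "l p \<in> {m..M}" if "p \<le> N" for p
    using eigenvalue_bounds[OF that, of m M] range by auto
  have close: "\<bar>\<psi> (l p) - (LINT z|disc_measure. \<psi> (\<sigma> z) * (cmod (eigenfunction p z))\<^sup>2)\<bar>
      \<le> e + K * (LINT z|disc_measure. (\<sigma> z - l p)\<^sup>2 * (cmod (eigenfunction p z))\<^sup>2)" if p: "p \<le> N" for p
  proof -
    let ?n = "\<lambda>z. (cmod (eigenfunction p z))\<^sup>2"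
    have i0: "integrable disc_measure (\<lambda>z. c * ?n z)" for c :: real
      using L2_discD(2)[OF fL] by simp
    have i2: "integrable disc_measure (\<lambda>z. (\<sigma> z - l p)\<^sup>2 * ?n z)"
    proof (rule integrable_bounded_times_norm[where B = "(C + \<bar>l p\<bar>)\<^sup>2"])
      fix z :: complex assume "z \<in> ball 0 1"
      then have "\<bar>\<sigma> z - l p\<bar> \<le> C + \<bar>l p\<bar>" using symbol_bound[of z] by linarith
      from power_mono[OF this abs_ge_zero, of 2] show "\<bar>(\<sigma> z - l p)\<^sup>2\<bar> \<le> (C + \<bar>l p\<bar>)\<^sup>2" by simp
    qed (use fL in measurable)
    have "\<psi> (l p) - (LINT z|disc_measure. \<psi> (\<sigma> z) * ?n z)
        = (LINT z|disc_measure. \<psi> (l p) * ?n z) - (LINT z|disc_measure. \<psi> (\<sigma> z) * ?n z)"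
      by (simp add: eigenfunction_norm[OF p])
    also have "\<dots> = (LINT z|disc_measure. \<psi> (l p) * ?n z - \<psi> (\<sigma> z) * ?n z)"
      by (rule Bochner_Integration.integral_diff[OF i0 i1, symmetric])
    finally have "\<bar>\<psi> (l p) - (LINT z|disc_measure. \<psi> (\<sigma> z) * ?n z)\<bar>
        = \<bar>LINT z|disc_measure. \<psi> (l p) * ?n z - \<psi> (\<sigma> z) * ?n z\<bar>" by simp
    also have "\<dots> \<le> (LINT z|disc_measure. \<bar>\<psi> (l p) * ?n z - \<psi> (\<sigma> z) * ?n z\<bar>)"
      by (rule integral_abs_bound)
    also have "\<dots> \<le> (LINT z|disc_measure. e * ?n z + K * ((\<sigma> z - l p)\<^sup>2 * ?n z))"
    proof (rule integral_mono)
      show "integrable disc_measure (\<lambda>z. \<bar>\<psi> (l p) * ?n z - \<psi> (\<sigma> z) * ?n z\<bar>)"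
        by (rule integrable_abs[OF Bochner_Integration.integrable_diff[OF i0 i1]])
      show "integrable disc_measure (\<lambda>z. e * ?n z + K * ((\<sigma> z - l p)\<^sup>2 * ?n z))"
        by (rule Bochner_Integration.integrable_add[OF i0 integrable_mult_right[OF i2]])
      fix z assume "z \<in> space disc_measure"
      then have z: "z \<in> ball 0 1" by simp
      have "\<bar>\<psi> (l p) * ?n z - \<psi> (\<sigma> z) * ?n z\<bar> = \<bar>\<psi> (l p) - \<psi> (\<sigma> z)\<bar> * ?n z"
        unfolding left_diff_distrib[symmetric] abs_mult by simp
      also have "\<dots> \<le> (e + K * (dist (l p) (\<sigma> z))\<^sup>2) * ?n z"
        by (intro mult_right_mono mod lr p range z) simp
      also have "\<dots> = e * ?n z + K * ((\<sigma> z - l p)\<^sup>2 * ?n z)"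
        by (simp add: dist_real_def power2_commute[of "l p"] algebra_simps)
      finally show "\<bar>\<psi> (l p) * ?n z - \<psi> (\<sigma> z) * ?n z\<bar> \<le> e * ?n z + K * ((\<sigma> z - l p)\<^sup>2 * ?n z)" .
    qed
    also have "\<dots> = e + K * (LINT z|disc_measure. (\<sigma> z - l p)\<^sup>2 * ?n z)"
      using i0[of e] i2 by (simp add: eigenfunction_norm[OF p])
    finally show ?thesis .
  qed
  have "real (N + 1) * (LINT z|disc_measure. \<psi> (\<sigma> z) * boundary_weight N ((cmod z)\<^sup>2))
      = (LINT z|disc_measure. \<psi> (\<sigma> z) * (\<Sum>p\<le>N. (cmod (eigenfunction p z))\<^sup>2))"
    unfolding sum_eigenfunction_norm by (rule integral_times_kernel_diagonal[symmetric])
  also have "\<dots> = (\<Sum>p\<le>N. LINT z|disc_measure. \<psi> (\<sigma> z) * (cmod (eigenfunction p z))\<^sup>2)"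
    unfolding sum_distrib_left by (rule Bochner_Integration.integral_sum) (rule i1)
  finally have "\<bar>(\<Sum>p\<le>N. \<psi> (l p)) - real (N + 1) * (LINT z|disc_measure. \<psi> (\<sigma> z) * boundary_weight N ((cmod z)\<^sup>2))\<bar>
      = \<bar>\<Sum>p\<le>N. \<psi> (l p) - (LINT z|disc_measure. \<psi> (\<sigma> z) * (cmod (eigenfunction p z))\<^sup>2)\<bar>"
    by (simp add: sum_subtractf)
  also have "\<dots> \<le> (\<Sum>p\<le>N. \<bar>\<psi> (l p) - (LINT z|disc_measure. \<psi> (\<sigma> z) * (cmod (eigenfunction p z))\<^sup>2)\<bar>)"
    by (rule sum_abs)
  also have "\<dots> \<le> (\<Sum>p\<le>N. e + K * (LINT z|disc_measure. (\<sigma> z - l p)\<^sup>2 * (cmod (eigenfunction p z))\<^sup>2))"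
    by (intro sum_mono close) simp
  also have "\<dots> = e * real (N + 1) + K * (energy N / 2)"
    unfolding sum_variance_eq_energy[symmetric] by (simp add: sum.distrib sum_distrib_left)
  finally have *: "\<bar>(\<Sum>p\<le>N. \<psi> (l p)) - real (N + 1) * (LINT z|disc_measure. \<psi> (\<sigma> z) * boundary_weight N ((cmod z)\<^sup>2))\<bar>
      \<le> e * real (N + 1) + K * (energy N / 2)" .
  define A where "A = (LINT z|disc_measure. \<psi> (\<sigma> z) * boundary_weight N ((cmod z)\<^sup>2))"
  define S where "S = (\<Sum>p\<le>N. \<psi> (l p))"
  have "S / real (N + 1) - A = (S - real (N + 1) * A) / real (N + 1)"
    by (simp add: field_simps)
  then have "\<bar>S / real (N + 1) - A\<bar> = \<bar>S - real (N + 1) * A\<bar> / real (N + 1)"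
    by (simp only: abs_divide abs_of_nat)
  also have "\<dots> \<le> (e * real (N + 1) + K * (energy N / 2)) / real (N + 1)"
    using * unfolding A_def S_def by (rule divide_right_mono) simp
  also have "\<dots> = e + K * (energy N / real (N + 1)) / 2"
    by (simp add: add_divide_distrib)
  finally show ?thesis unfolding A_def S_def .
qed

end

lemma (in bounded_symbol) eigenvalue_distribution_real:
  fixes \<psi> :: "real \<Rightarrow> real"
  assumes L: "AE \<theta> in circle_measure. ((\<lambda>r. \<sigma> (of_real r * cis \<theta>)) \<longlongrightarrow> L \<theta>) (at_left 1)"
    and basis: "\<And>N. toeplitz_eigenbasis \<sigma> C N (l N) (u N)"
    and \<psi>: "continuous_on UNIV \<psi>"
    and range: "\<And>z. z \<in> ball 0 1 \<Longrightarrow> \<sigma> z \<in> {m..M}"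
  shows "(\<lambda>N. (\<Sum>p\<le>N. \<psi> (l N p)) / real (N + 1)) \<longlonglongrightarrow> (LINT \<theta>|circle_measure. \<psi> (L \<theta>)) / (2 * pi)"
proof -
  define A where "A N = (LINT z|disc_measure. \<psi> (\<sigma> z) * boundary_weight N ((cmod z)\<^sup>2))" for N
  define S where "S N = (\<Sum>p\<le>N. \<psi> (l N p)) / real (N + 1)" for N
  have "bounded (\<psi> ` {m..M})"
    by (intro compact_imp_bounded compact_continuous_image continuous_on_subset[OF \<psi>]) auto
  then obtain B where "\<forall>y\<in>\<psi> ` {m..M}. norm y \<le> B" unfolding bounded_iff by blast
  then have B: "\<bar>\<psi> x\<bar> \<le> B" if "x \<in> {m..M}" for x using that by simp
  have A: "A \<longlonglongrightarrow> (LINT \<theta>|circle_measure. \<psi> (L \<theta>)) / (2 * pi)"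
    unfolding A_def
  proof (rule boundary_concentration(2))
    show "(\<lambda>z. \<psi> (\<sigma> z)) \<in> borel_measurable (lebesgue_on (ball 0 1))"
      using measurable_compose[OF measurable_symbol borel_measurable_continuous_onI[OF \<psi>]] .
    show "\<bar>\<psi> (\<sigma> z)\<bar> \<le> B" if "z \<in> ball 0 1" for z by (rule B[OF range[OF that]])
    show "AE \<theta> in circle_measure. ((\<lambda>r. \<psi> (\<sigma> (of_real r * cis \<theta>))) \<longlongrightarrow> \<psi> (L \<theta>)) (at_left 1)"
      using L by eventually_elim (rule continuous_on_tendsto_compose[OF \<psi>], auto)
  qed
  have "(\<lambda>N. S N - A N) \<longlonglongrightarrow> 0"
  proof (rule LIMSEQ_I)
    fix \<epsilon> :: real assume \<epsilon>: "0 < \<epsilon>"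
    obtain K where K: "0 \<le> K" "\<And>x y. x \<in> {m..M} \<Longrightarrow> y \<in> {m..M} \<Longrightarrow> \<bar>\<psi> x - \<psi> y\<bar> \<le> \<epsilon> / 2 + K * (dist x y)\<^sup>2"
      using quadratic_modulus_of_continuity[of "{m..M}" \<psi> "\<epsilon> / 2"] \<epsilon> continuous_on_subset[OF \<psi>] by auto
    have "(\<lambda>N. K * (energy N / real (N + 1)) / 2) \<longlonglongrightarrow> K * 0 / 2"
      by (intro tendsto_intros energy_density_tendsto_0[OF L]) simp
    then have "eventually (\<lambda>N. K * (energy N / real (N + 1)) / 2 < \<epsilon> / 2) sequentially"
      using \<epsilon> by (intro order_tendstoD(2)) auto
    then have "eventually (\<lambda>N. \<bar>S N - A N\<bar> < \<epsilon>) sequentially"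
    proof eventually_elim
      case (elim N)
      interpret toeplitz_eigenbasis \<sigma> C N "l N" "u N" by (rule basis)
      show ?case
        using eigenvalue_sum_close[OF \<psi> K(2) range] elim unfolding S_def A_def by linarith
    qed
    then show "\<exists>N0. \<forall>N\<ge>N0. norm (S N - A N - 0) < \<epsilon>" by (auto simp: eventually_sequentially)
  qed
  from tendsto_add[OF this A] show ?thesis by (simp add: S_def)
qed

theorem corollary4p1:
  fixes \<sigma> :: "complex \<Rightarrow> real" and \<psi> :: "real \<Rightarrow> complex"
  assumes "\<sigma> \<in> borel_measurable (lebesgue_on (ball 0 1))"
    and "bounded (\<sigma> ` ball 0 1)"
    and "has_radial_limit \<sigma>"
    and "continuous_on {(INF z\<in>ball 0 1. \<sigma> z)..(SUP z\<in>ball 0 1. \<sigma> z)} \<psi>"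
  shows "(\<lambda>N. trace_poly_space N
                (functional_calculus_on (poly_space N) \<psi>
                   (compressed_toeplitz N (\<lambda>z. complex_of_real (\<sigma> z))))
              / of_nat (N + 1))
         \<longlonglongrightarrow> (LINT \<theta>|lebesgue_on {0..<2 * pi}. \<psi> (radial_limit \<sigma> \<theta>)) / of_real (2 * pi)"
proof -
  obtain C where "\<forall>x\<in>\<sigma> ` ball 0 1. norm x \<le> C"
    using assms(2) unfolding bounded_iff by blast
  then have C: "\<bar>\<sigma> z\<bar> \<le> C" if "z \<in> ball 0 1" for z using that by simp
  interpret bounded_symbol \<sigma> C by unfold_locales (use assms(1) C in auto)
  define m where "m = (INF z\<in>ball 0 1. \<sigma> z)"
  define M where "M = (SUP z\<in>ball 0 1. \<sigma> z)"
  have range: "\<sigma> z \<in> {m..M}" if "z \<in> ball 0 1" for z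
    using that assms(2) unfolding m_def M_def
    by (auto intro!: cINF_lower cSUP_upper bounded_imp_bdd_above bounded_imp_bdd_below)
  have mM: "m \<le> M" using range[of 0] by auto
  define L where "L = radial_limit \<sigma>"
  have L: "AE \<theta> in circle_measure. ((\<lambda>r. \<sigma> (of_real r * cis \<theta>)) \<longlongrightarrow> L \<theta>) (at_left 1)"
    using assms(3) unfolding has_radial_limit_def
  proof eventually_elim
    case (elim \<theta>)
    then obtain x where x: "((\<lambda>r. \<sigma> (of_real r * cis \<theta>)) \<longlongrightarrow> x) (at_left 1)" by blast
    then have "L \<theta> = x" unfolding L_def radial_limit_def by (intro tendsto_Lim) auto
    with x show ?case by simp
  qed
  have Lm: "L \<in> borel_measurable circle_measure"
    by (rule boundary_concentration(1)[OF assms(1) C L])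
  have Lrange: "AE \<theta> in circle_measure. L \<theta> \<in> {m..M}"
    using L
  proof eventually_elim
    case (elim \<theta>)
    have "eventually (\<lambda>r. \<sigma> (of_real r * cis \<theta>) \<in> {m..M}) (at_left 1)"
      using eventually_at_left_real[OF zero_less_one]
      by (rule eventually_mono) (rule range, simp add: norm_mult)
    from Lim_in_closed_set[OF closed_atLeastAtMost this _ elim] show ?case by simp
  qed
  \<comment> \<open>\<open>\<psi>\<close> is extended continuously to the line. Eigenvalues and radial limits lie in \<open>[m, M]\<close>, where
      nothing changes.\<close>
  define \<psi>' where "\<psi>' x = \<psi> (max m (min M x))" for x
  have \<psi>': "continuous_on UNIV \<psi>'"
  proof -
    have "continuous_on UNIV (\<lambda>x. max m (min M x))" by (intro continuous_intros)
    then show ?thesis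
      unfolding \<psi>'_def using mM
      by (rule_tac continuous_on_compose2[OF assms(4)[folded m_def M_def]]) auto
  qed
  have \<psi>'_eq: "\<psi>' x = \<psi> x" if "x \<in> {m..M}" for x using that by (auto simp: \<psi>'_def)
  have "\<exists>l u. \<forall>N. toeplitz_eigenbasis \<sigma> C N (l N) (u N)"
    using eigenbasis_exists by metis
  then obtain l u where basis: "\<And>N. toeplitz_eigenbasis \<sigma> C N (l N) (u N)" by blast
  have trace: "trace_poly_space N (functional_calculus_on (poly_space N) \<psi>
      (compressed_toeplitz N (\<lambda>z. complex_of_real (\<sigma> z)))) = (\<Sum>p\<le>N. \<psi>' (l N p))" for N
  proof -
    interpret toeplitz_eigenbasis \<sigma> C N "l N" "u N" by (rule basis)
    have "l N p \<in> {m..M}" if "p \<le> N" for p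
      using eigenvalue_bounds[OF that, of m M] range by auto
    then show ?thesis unfolding trace_functional_calculus by (intro sum.cong) (auto simp: \<psi>'_eq)
  qed
  have \<psi>'L: "integrable circle_measure (\<lambda>\<theta>. \<psi>' (L \<theta>))"
  proof -
    interpret finite_measure "circle_measure"
      by (intro finite_measure_lebesgue_on bounded_set_imp_lmeasurable) auto
    have "compact (\<psi>' ` {m..M})"
      by (intro compact_continuous_image continuous_on_subset[OF \<psi>']) auto
    then obtain B where "\<And>x. x \<in> {m..M} \<Longrightarrow> norm (\<psi>' x) \<le> B"
      using compact_imp_bounded by (fastforce simp: bounded_iff)
    with Lrange show ?thesis
      by (intro integrable_const_bound[of _ B] measurable_compose[OF Lm borel_measurable_continuous_onI[OF \<psi>']])
         (auto elim: eventually_mono)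
  qed
  have int_eq: "(LINT \<theta>|circle_measure. \<psi> (radial_limit \<sigma> \<theta>)) = (LINT \<theta>|circle_measure. \<psi>' (L \<theta>))"
  proof -
    have ae: "AE \<theta> in circle_measure. \<psi>' (L \<theta>) = \<psi> (L \<theta>)"
      using Lrange by eventually_elim (rule \<psi>'_eq)
    then have "(\<lambda>\<theta>. \<psi> (L \<theta>)) \<in> borel_measurable circle_measure"
      using borel_measurable_integrable[OF \<psi>'L] by (intro lebesgue_on_measurable_AE[OF _ _ ae]) auto
    then have "(LINT \<theta>|circle_measure. \<psi>' (L \<theta>)) = (LINT \<theta>|circle_measure. \<psi> (L \<theta>))"
      using ae borel_measurable_integrable[OF \<psi>'L] by (intro integral_cong_AE) auto
    then show ?thesis by (simp add: L_def)
  qed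
  have Re: "(\<lambda>N. (\<Sum>p\<le>N. Re (\<psi>' (l N p))) / real (N + 1))
      \<longlonglongrightarrow> (LINT \<theta>|circle_measure. Re (\<psi>' (L \<theta>))) / (2 * pi)"
    by (rule eigenvalue_distribution_real[OF L basis _ range]) (intro continuous_intros \<psi>')
  have Im: "(\<lambda>N. (\<Sum>p\<le>N. Im (\<psi>' (l N p))) / real (N + 1))
      \<longlonglongrightarrow> (LINT \<theta>|circle_measure. Im (\<psi>' (L \<theta>))) / (2 * pi)"
    by (rule eigenvalue_distribution_real[OF L basis _ range]) (intro continuous_intros \<psi>')
  have e1: "(\<Sum>p\<le>N. \<psi>' (l N p)) / of_nat (N + 1)
      = Complex ((\<Sum>p\<le>N. Re (\<psi>' (l N p))) / real (N + 1)) ((\<Sum>p\<le>N. Im (\<psi>' (l N p))) / real (N + 1))" for N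
  proof -
    have of_nat: "of_nat (N + 1) = complex_of_real (real (N + 1))" by simp
    show ?thesis
      unfolding of_nat
      by (simp only: complex_eq_iff Re_divide_of_real Im_divide_of_real Re_sum Im_sum complex.sel simp_thms)
  qed
  have e2: "(LINT \<theta>|circle_measure. \<psi>' (L \<theta>)) / of_real (2 * pi)
      = Complex ((LINT \<theta>|circle_measure. Re (\<psi>' (L \<theta>))) / (2 * pi))
          ((LINT \<theta>|circle_measure. Im (\<psi>' (L \<theta>))) / (2 * pi))"
    by (simp only: complex_eq_iff Re_divide_of_real Im_divide_of_real complex.sel
        integral_Re[OF \<psi>'L] integral_Im[OF \<psi>'L] simp_thms)
  show ?thesis
    unfolding trace int_eq e1 e2 by (rule tendsto_Complex[OF Re Im])
qed

end
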